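(* For every loopless matroid $M$ with nonempty ground set, \[\underline{H}_M(x)=\sum_{F\in\mathcal{L}(M),\,F\neq\varnothing}\overline{\chi}_{M|_F}(x)\,\underline{H}_{M/F}(x).\] Consequently, the map $M\mapsto\underline{H}_M(x)$ on loopless matroids is the unique assignment $M\mapsto h_M(x)\in\mathbb{Z}[x]$ satisfying $h_M(x)=1$ when $\mathrm{rk}(M)=0$ and $h_M(x)=\sum_{F\neq\varnothing}\overline{\chi}_{M|_F}(x)\,h_{M/F}(x)$ otherwise.
   Context: Matroids are on finite ground sets; $\mathrm{rk}$ is the rank function; a matroid is loopless if every singleton has rank $1$. $\mathcal{L}(M)$ is the lattice of flats of $M$ (bottom $\varnothing$, top $E$ for loopless $M$ on $E$); $M|_F$ is the restriction and $M/F$ the contraction by a flat $F$. $\mu$ is the Möbius function of $\mathcal{L}(M)$. The characteristic polynomial is $\chi_M(x)=\sum_{F\in\mathcal{L}(M)}\mu(\varnothing,F)\,x^{\mathrm{rk}(M)-\mathrm{rk}(F)}$; the reduced characteristic polynomial is $\overline{\chi}_M(x)=\chi_M(x)/(x-1)$ if $E\neq\varnothing$ and $\overline{\chi}_M(x)=-1$ if $E=\varnothing$. Chow ring: for loopless $M$ on $E$, $\underline{\mathrm{CH}}(M)=\mathbb{Q}[x_F: F\in\mathcal{L}(M)\setminus\{\varnothing,E\}]/(I+J)$, where $I$ is generated by $x_{F_1}x_{F_2}$ for incomparable $F_1,F_2$, and $J$ by $\sum_{F\ni i}x_F-\sum_{F\ni j}x_F$ for $i,j\in E$; variables have degree $1$.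 The Chow polynomial is $\underline{H}_M(x)=\sum_j\dim_{\mathbb{Q}}\underline{\mathrm{CH}}^j(M)\,x^j$. *)

theory Defs
  imports "HOL-Computational_Algebra.Polynomial" "HOL-Computational_Algebra.Formal_Power_Series"
    "HOL-Computational_Algebra.Polynomial_FPS" "HOL-Library.Multiset" "HOL-Library.Function_Algebras"
begin

type_synonym 'a matroid = "'a set \<times> ('a set \<Rightarrow> nat)"

definition gset :: "'a matroid \<Rightarrow> 'a set" where "gset M = fst M"
definition rk :: "'a matroid \<Rightarrow> 'a set \<Rightarrow> nat" where "rk M = snd M"

definition matroid :: "'a matroid \<Rightarrow> bool" where
  "matroid M \<longleftrightarrow> finite (gset M)
     \<and> (\<forall>A. rk M A = rk M (A \<inter> gset M))
     \<and> (\<forall>A. A \<subseteq> gset M \<longrightarrow> rk M A \<le> card A)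
     \<and> (\<forall>A B. A \<subseteq> B \<longrightarrow> B \<subseteq> gset M \<longrightarrow> rk M A \<le> rk M B)
     \<and> (\<forall>A B. A \<subseteq> gset M \<longrightarrow> B \<subseteq> gset M \<longrightarrow>
            rk M (A \<union> B) + rk M (A \<inter> B) \<le> rk M A + rk M B)"

definition loopless :: "'a matroid \<Rightarrow> bool" where
  "loopless M \<longleftrightarrow> matroid M \<and> (\<forall>e \<in> gset M. rk M {e} = 1)"

definition mrank :: "'a matroid \<Rightarrow> nat" where "mrank M = rk M (gset M)"

definition is_flat :: "'a matroid \<Rightarrow> 'a set \<Rightarrow> bool" where
  "is_flat M F \<longleftrightarrow> F \<subseteq> gset M \<and> (\<forall>e \<in> gset M - F. rk M (insert e F) > rk M F)"

definition flats :: "'a matroid \<Rightarrow> 'a set set" where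
  "flats M = {F. is_flat M F}"

definition restrict :: "'a matroid \<Rightarrow> 'a set \<Rightarrow> 'a matroid" where
  "restrict M F = (F, \<lambda>A. rk M (A \<inter> F))"

definition contract :: "'a matroid \<Rightarrow> 'a set \<Rightarrow> 'a matroid" where
  "contract M F = (gset M - F, \<lambda>A. rk M ((A \<inter> (gset M - F)) \<union> F) - rk M F)"

text \<open>Moebius function of a poset of sets ordered by inclusion, via the recursion
  mu(x,x) = 1, mu(x,y) = - sum_{x \<le> z < y} mu(x,z) for x < y, and 0 otherwise.
  The natural-number argument is fuel; it suffices that it is at least card y.\<close>

fun mob_aux :: "nat \<Rightarrow> 'a set set \<Rightarrow> 'a set \<Rightarrow> 'a set \<Rightarrow> int" where
  "mob_aux 0 P x y = (if x = y then 1 else 0)"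
| "mob_aux (Suc n) P x y =
     (if x = y then 1
      else if x \<subseteq> y then - (\<Sum>z \<in> {z \<in> P. x \<subseteq> z \<and> z \<subset> y}. mob_aux n P x z)
      else 0)"

definition mobius :: "'a set set \<Rightarrow> 'a set \<Rightarrow> 'a set \<Rightarrow> int" where
  "mobius P x y = mob_aux (card y) P x y"

definition char_poly :: "'a matroid \<Rightarrow> int poly" where
  "char_poly M = (\<Sum>F \<in> flats M. monom (mobius (flats M) {} F) (mrank M - rk M F))"

definition red_char_poly :: "'a matroid \<Rightarrow> int poly" where
  "red_char_poly M = (if gset M = {} then - 1 else char_poly M div [:-1, 1:])"

text \<open>Polynomials over Q in the variables x_F are represented as functions from monomials
  (multisets of variables) to rat; the ideal I + J is the Q-span of all products of a
  monomial with a generator. The degree-j piece of the quotient has dimension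
  dim(V_j) - dim(V_j \<inter> (I+J)), V_j = homogeneous polynomials of degree j.\<close>

definition chow_vars :: "'a matroid \<Rightarrow> 'a set set" where
  "chow_vars M = flats M - {{}, gset M}"

definition mono_mult :: "'b multiset \<Rightarrow> ('b multiset \<Rightarrow> rat) \<Rightarrow> ('b multiset \<Rightarrow> rat)" where
  "mono_mult m p = (\<lambda>n. if m \<subseteq># n then p (n - m) else 0)"

definition chow_gens :: "'a matroid \<Rightarrow> ('a set multiset \<Rightarrow> rat) set" where
  "chow_gens M =
     {(\<lambda>n. if n = {#F1, F2#} then 1 else 0) | F1 F2.
        F1 \<in> chow_vars M \<and> F2 \<in> chow_vars M \<and> \<not> F1 \<subseteq> F2 \<and> \<not> F2 \<subseteq> F1}
   \<union> {(\<lambda>n. if (\<exists>F \<in> chow_vars M. n = {#F#})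
            then of_bool (i \<in> the_elem (set_mset n)) - of_bool (j \<in> the_elem (set_mset n))
            else 0) | i j. i \<in> gset M \<and> j \<in> gset M}"

definition chow_ideal :: "'a matroid \<Rightarrow> ('a set multiset \<Rightarrow> rat) set" where
  "chow_ideal M = module.span (\<lambda>c p. (\<lambda>n. c * p n))
      {mono_mult m g | m g. set_mset m \<subseteq> chow_vars M \<and> g \<in> chow_gens M}"

definition hom_polys :: "'a matroid \<Rightarrow> nat \<Rightarrow> ('a set multiset \<Rightarrow> rat) set" where
  "hom_polys M j = {p. \<forall>n. p n \<noteq> 0 \<longrightarrow> size n = j \<and> set_mset n \<subseteq> chow_vars M}"

definition chow_dim :: "'a matroid \<Rightarrow> nat \<Rightarrow> nat" where
  "chow_dim M j = vector_space.dim (\<lambda>c p. (\<lambda>n. c * p n)) (hom_polys M j)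
                 - vector_space.dim (\<lambda>c p. (\<lambda>n. c * p n)) (hom_polys M j \<inter> chow_ideal M)"

definition chow_fps :: "'a matroid \<Rightarrow> int fps" where
  "chow_fps M = Abs_fps (\<lambda>j. int (chow_dim M j))"

end

theory Submission
  imports Defs "HOL-Library.Poly_Mapping"
begin

text \<open>For a flat \<open>Z\<close> let \<open>H(Z)\<close> be the Hilbert series of the Chow ring of the contraction by \<open>Z\<close>. The heart of
  the proof is the formula of Feichtner and Yuzvinsky
  \<open>H(Z) = 1 + (\<Sum>F \<supset> Z. (x + \<dots> + x^(d - 1)) H(F))\<close> with \<open>d = rk F - rk Z\<close>.
  It is obtained by blowing up one flat at a time. For an order filter \<open>P\<close> of flats above \<open>Z\<close> put
  \<open>y\<^sub>i = (\<Sum>G \<in> P with i \<in> G. x\<^sub>G)\<close> and let \<open>R(P)\<close> be the quotient of \<open>\<rat>[x\<^sub>G : G \<in> P]\<close> by the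
  products \<open>x\<^sub>G x\<^sub>H\<close> with \<open>G\<close>, \<open>H\<close> incomparable, the products \<open>y\<^sub>i x\<^sub>G\<close> with \<open>i \<notin> G\<close>, and the products of
  the \<open>y\<^sub>i\<close> over the bases \<open>I\<close> of the members of \<open>P\<close> relative to \<open>Z\<close>. If \<open>F\<close> is a maximal flat outside \<open>P\<close>,
  then \<open>R(P \<union> {F})\<close> is \<open>R(P)[t]\<close> modulo \<open>t K\<close> and the monic polynomial \<open>p = (\<Prod>i \<in> I. y\<^sub>i + t)\<close>,
  where \<open>I\<close> is a basis of \<open>F\<close> relative to \<open>Z\<close> and \<open>K\<close> is the kernel of the map from \<open>R(P)\<close> onto the Chow ring
  of the contraction by \<open>F\<close>. Since \<open>p(0) K = 0\<close>, the new ring is \<open>R(P)\<close> plus \<open>d - 1\<close> shifted copies of that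
  Chow ring. For the filter of all flats above \<open>Z\<close> the \<open>y\<^sub>i\<close> vanish, and eliminating the variable of the ground
  set gives the Chow ring itself.

  Multiplied by \<open>1 - x\<close>, the formula reads \<open>(\<Sum>F \<supseteq> Z. (x^(rk F - rk Z) - x) H(F)) = 1 - x\<close>.
  Weighting it with \<open>\<mu>(\<emptyset>, Z)\<close> and summing over \<open>Z\<close> yields \<open>(x - 1) H(\<emptyset>) = (\<Sum>F \<noteq> \<emptyset>. \<chi>(F) H(F))\<close>, where
  \<open>\<chi>(F)\<close> is the characteristic polynomial of the restriction to \<open>F\<close>.\<close>

alias keys = Poly_Mapping.keys
alias lookup = Poly_Mapping.lookup
alias single = Poly_Mapping.single

section \<open>Ideals of subrings\<close>

text \<open>Coefficient rings are subsets of one ambient type, because the set of variables changes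
  along the induction. Quotient rings are never formed: statements about them are congruences modulo
  ideals.\<close>

definition subring :: "'r::comm_ring_1 set \<Rightarrow> bool" where
  "subring S \<longleftrightarrow> 1 \<in> S \<and> (\<forall>a\<in>S. \<forall>b\<in>S. a - b \<in> S \<and> a * b \<in> S)"

text \<open>\<open>J\<close> may reach outside \<open>S\<close>. Colon ideals and preimages under
  substitutions, which live in the whole type, thereby count as ideals over
  \<open>S\<close>.\<close>

definition ideal_in :: "'r::comm_ring_1 set \<Rightarrow> 'r set \<Rightarrow> bool" where
  "ideal_in S J \<longleftrightarrow> 0 \<in> J \<and> (\<forall>a\<in>J. \<forall>b\<in>J. a + b \<in> J) \<and> (\<forall>s\<in>S. \<forall>a\<in>J. s * a \<in> J)"

lemma subringD:
  assumes "subring S"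
  shows subring_1: "1 \<in> S" and subring_0: "0 \<in> S"
    and subring_diff: "a \<in> S \<Longrightarrow> b \<in> S \<Longrightarrow> a - b \<in> S"
    and subring_mult: "a \<in> S \<Longrightarrow> b \<in> S \<Longrightarrow> a * b \<in> S"
    and subring_uminus: "a \<in> S \<Longrightarrow> - a \<in> S"
    and subring_add: "a \<in> S \<Longrightarrow> b \<in> S \<Longrightarrow> a + b \<in> S"
proof -
  have D: "\<And>a b. a \<in> S \<Longrightarrow> b \<in> S \<Longrightarrow> a - b \<in> S" and o: "1 \<in> S"
    using assms by (auto simp: subring_def)
  have z: "0 \<in> S" using D[OF o o] by simp
  have m: "\<And>a. a \<in> S \<Longrightarrow> - a \<in> S" using D[OF z] by simp
  show "1 \<in> S" "0 \<in> S" by fact+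
  show "a \<in> S \<Longrightarrow> b \<in> S \<Longrightarrow> a - b \<in> S" by (rule D)
  show "a \<in> S \<Longrightarrow> b \<in> S \<Longrightarrow> a * b \<in> S" using assms by (auto simp: subring_def)
  show "a \<in> S \<Longrightarrow> - a \<in> S" by (rule m)
  show "a \<in> S \<Longrightarrow> b \<in> S \<Longrightarrow> a + b \<in> S" using D[OF _ m, of a b] by simp
qed

lemma subring_sum: "subring S \<Longrightarrow> (\<And>i. i \<in> A \<Longrightarrow> f i \<in> S) \<Longrightarrow> sum f A \<in> S"
  by (induction A rule: infinite_finite_induct) (auto intro: subringD)

lemma subring_prod: "subring S \<Longrightarrow> (\<And>i. i \<in> A \<Longrightarrow> f i \<in> S) \<Longrightarrow> prod f A \<in> S"
  by (induction A rule: infinite_finite_induct) (auto intro: subringD)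

lemma ideal_inD:
  assumes "ideal_in S J"
  shows ideal_0: "0 \<in> J"
    and ideal_add: "a \<in> J \<Longrightarrow> b \<in> J \<Longrightarrow> a + b \<in> J"
    and ideal_mult: "s \<in> S \<Longrightarrow> a \<in> J \<Longrightarrow> s * a \<in> J"
    and ideal_mult': "s \<in> S \<Longrightarrow> a \<in> J \<Longrightarrow> a * s \<in> J"
  using assms by (auto simp: ideal_in_def mult.commute)

lemma ideal_uminus: "subring S \<Longrightarrow> ideal_in S J \<Longrightarrow> a \<in> J \<Longrightarrow> - a \<in> J"
  using ideal_mult[of S J "- 1" a] subring_uminus[OF _ subring_1, of S] by simp

lemma ideal_diff: "subring S \<Longrightarrow> ideal_in S J \<Longrightarrow> a \<in> J \<Longrightarrow> b \<in> J \<Longrightarrow> a - b \<in> J"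
  using ideal_add[of S J a "- b"] ideal_uminus[of S J b] by simp

lemma ideal_sum: "ideal_in S J \<Longrightarrow> (\<And>i. i \<in> A \<Longrightarrow> f i \<in> J) \<Longrightarrow> sum f A \<in> J"
  by (induction A rule: infinite_finite_induct) (auto intro: ideal_inD)

text \<open>Each step adds one multiple of one generator, so an induction over the ideal has to
  treat a single product \<open>s * g\<close> at a time.\<close>

inductive_set idl :: "'r::comm_ring_1 set \<Rightarrow> 'r set \<Rightarrow> 'r set" for S G where
  zero: "0 \<in> idl S G"
| step: "a \<in> idl S G \<Longrightarrow> s \<in> S \<Longrightarrow> g \<in> G \<Longrightarrow> a + s * g \<in> idl S G"

lemma ideal_in_idl:
  assumes "subring S"
  shows "ideal_in S (idl S G)"
proof -
  have "a + b \<in> idl S G" if "a \<in> idl S G" "b \<in> idl S G" for a b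
    using that(2,1) by induction (auto simp: add.assoc[symmetric] intro: idl.intros)
  moreover have "s * a \<in> idl S G" if "a \<in> idl S G" "s \<in> S" for a s
    using that
    by induction (auto simp: distrib_left mult.assoc[symmetric] intro: idl.intros subring_mult[OF assms])
  ultimately show ?thesis
    by (auto simp: ideal_in_def idl.zero)
qed

lemma idl_base: "subring S \<Longrightarrow> g \<in> G \<Longrightarrow> g \<in> idl S G"
  using idl.step[OF idl.zero, of 1 S g G] subring_1[of S] by simp

lemma idl_subset:
  assumes "ideal_in S J" "G \<subseteq> J"
  shows "idl S G \<subseteq> J"
proof
  fix x assume "x \<in> idl S G"
  then show "x \<in> J"
    by induction (use assms in \<open>auto intro: ideal_inD\<close>)
qed

text \<open>Factors are exchanged one at a time; each exchange alters the product by a multiple of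
  some \<open>f a - g a\<close>.\<close>

lemma prod_diff_in_ideal:
  assumes S: "subring S" and J: "ideal_in S J"
    and "\<And>i. i \<in> A \<Longrightarrow> f i \<in> S" "\<And>i. i \<in> A \<Longrightarrow> g i \<in> S" "\<And>i. i \<in> A \<Longrightarrow> f i - g i \<in> J"
  shows "prod f A - prod g A \<in> J"
  using assms(3-5)
proof (induction A rule: infinite_finite_induct)
  case (insert a A)
  have "prod f (insert a A) - prod g (insert a A)
      = prod f A * (f a - g a) + g a * (prod f A - prod g A)"
    using insert.hyps by (simp add: algebra_simps)
  moreover have "prod f A * (f a - g a) \<in> J"
    using insert.prems by (intro ideal_mult[OF J] subring_prod[OF S]) auto
  moreover have "g a * (prod f A - prod g A) \<in> J"
    using insert by (intro ideal_mult[OF J]) auto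
  ultimately show ?case
    by (simp add: ideal_add[OF J])
qed (auto simp: ideal_0[OF J])

section \<open>Multivariate polynomials over the rationals\<close>

text \<open>Finitely supported functions on multisets multiply by convolution, as polynomials do.
  \<open>lookup\<close> connects them with the plain functions that present the Chow ring.\<close>

type_synonym 'v mpoly = "'v multiset \<Rightarrow>\<^sub>0 rat"

definition Var :: "'v \<Rightarrow> 'v mpoly" where "Var v = Poly_Mapping.single {#v#} 1"

definition polys :: "'v set \<Rightarrow> 'v mpoly set" where
  "polys P = {p. \<forall>m\<in>keys p. set_mset m \<subseteq> P}"

lemma mpoly_expand: "p = (\<Sum>m\<in>keys p. Poly_Mapping.single m (lookup p m))"
  by (rule poly_mapping_eqI) (auto simp: lookup_sum lookup_single when_def in_keys_iff)

lemma single_in_polys: "set_mset m \<subseteq> P \<Longrightarrow> Poly_Mapping.single m c \<in> polys P"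
  by (auto simp: polys_def)

lemma subring_polys: "subring (polys (P :: 'v set))"
  unfolding subring_def polys_def
proof (intro conjI ballI; clarify?)
  fix a b :: "'v multiset \<Rightarrow>\<^sub>0 rat" and m :: "'v multiset" and v
  assume a: "\<forall>m\<in>keys a. set_mset m \<subseteq> P" and b: "\<forall>m\<in>keys b. set_mset m \<subseteq> P" and v: "v \<in># m"
  show "v \<in> P" if "m \<in> keys (a - b)"
  proof (cases "m \<in> keys a")
    case False
    then have "m \<in> keys b"
      using that by (auto simp: in_keys_iff lookup_minus)
    then show ?thesis using b v by auto
  qed (use a v in auto)
  show "v \<in> P" if prod: "m \<in> keys (a * b)"
      proof -
    obtain m1 m2 where "m = m1 + m2" "m1 \<in> keys a" "m2 \<in> keys b"
      using subsetD[OF keys_mult prod] by auto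
    then show ?thesis using a b v by auto
  qed
qed auto

lemma polys_mono: "P \<subseteq> Q \<Longrightarrow> polys P \<subseteq> polys Q"
  by (auto simp: polys_def)

lemma Var_in_polys: "v \<in> P \<Longrightarrow> Var v \<in> polys P"
  by (auto simp: Var_def intro: single_in_polys)

lemma Var_power: "Var v ^ k = Poly_Mapping.single (replicate_mset k v) 1"
proof (induction k)
  case (Suc k)
  show ?case
    unfolding power_Suc Suc.IH unfolding Var_def mult_single by simp
qed simp

lemma lookup_mult_single:
  fixes p :: "'v mpoly"
  shows "lookup (p * Poly_Mapping.single a c) m = (if a \<subseteq># m then lookup p (m - a) * c else 0)"
proof -
  have "p * Poly_Mapping.single a c = (\<Sum>n\<in>keys p. Poly_Mapping.single (n + a) (lookup p n * c))"
    by (subst (1) mpoly_expand[of p]) (simp add: sum_distrib_right mult_single)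
  then have "lookup (p * Poly_Mapping.single a c) m
      = (\<Sum>n\<in>keys p. if n + a = m then lookup p n * c else 0)"
    by (simp add: lookup_sum lookup_single when_def)
  also have "\<dots> = (if a \<subseteq># m then lookup p (m - a) * c else 0)"
  proof (cases "a \<subseteq># m")
    case True
    then have "n + a = m \<longleftrightarrow> n = m - a" for n
      by auto
    then show ?thesis
      using True by (auto simp: in_keys_iff)
  next
    case False
    then have "n + a \<noteq> m" for n
      by auto
    then show ?thesis
      using False by simp
  qed
  finally show ?thesis .
qed

text \<open>The substitution homomorphism, fixing the rational constants. It serves first to set
  variables to zero and later to eliminate the variable of the ground set.\<close>

definition ev :: "('v \<Rightarrow> 'w mpoly) \<Rightarrow> 'v mpoly \<Rightarrow> 'w mpoly" where
  "ev f p = (\<Sum>m\<in>keys p. Poly_Mapping.single 0 (lookup p m) * (\<Prod>v\<in>#m. f v))"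

lemma ev_superset:
  assumes "finite A" "keys p \<subseteq> A"
  shows "ev f p = (\<Sum>m\<in>A. Poly_Mapping.single 0 (lookup p m) * (\<Prod>v\<in>#m. f v))"
  unfolding ev_def by (rule sum.mono_neutral_left) (use assms in \<open>auto simp: in_keys_iff\<close>)

lemma ev_single: "ev f (Poly_Mapping.single m c) = Poly_Mapping.single 0 c * (\<Prod>v\<in>#m. f v)"
  by (subst ev_superset[of "{m}"]) auto

lemma ev_Var [simp]: "ev f (Var v) = f v"
  by (simp add: Var_def ev_single)

lemma ev_0 [simp]: "ev f 0 = 0"
  by (simp add: ev_def)

lemma ev_1 [simp]: "ev f 1 = 1"
  using ev_single[of f 0 1] by simp

lemma ev_add: "ev f (p + q) = ev f p + ev f q"
proof -
  have fin: "finite (keys p \<union> keys q)" by simp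
  show ?thesis
    unfolding ev_superset[OF fin Poly_Mapping.keys_add] ev_superset[OF fin Un_upper1]
      ev_superset[OF fin Un_upper2]
    by (simp add: lookup_add single_add distrib_right sum.distrib)
qed

lemma ev_sum: "ev f (\<Sum>i\<in>A. g i) = (\<Sum>i\<in>A. ev f (g i))"
  by (induction A rule: infinite_finite_induct) (auto simp: ev_add)

lemma ev_mult:
  fixes f :: "'v \<Rightarrow> 'w mpoly"
  shows "ev f (p * q) = ev f p * ev f q"
proof -
  have "ev f (Poly_Mapping.single m c * Poly_Mapping.single n d)
      = ev f (Poly_Mapping.single m c) * ev f (Poly_Mapping.single n d)" for m n c d
  proof -
    have "Poly_Mapping.single (0::'w multiset) (c * d) = Poly_Mapping.single 0 c * Poly_Mapping.single 0 d"
      by (simp add: mult_single)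
    then show ?thesis
      unfolding mult_single[of m c n d] ev_single image_mset_union prod_mset_Un
      by (simp add: mult_ac)
  qed
  note single = this
  have "p * q = (\<Sum>m\<in>keys p. \<Sum>n\<in>keys q.
      Poly_Mapping.single m (lookup p m) * Poly_Mapping.single n (lookup q n))"
    by (subst (1) mpoly_expand[of p], subst (1) mpoly_expand[of q]) (rule sum_product)
  then have "ev f (p * q) = (\<Sum>m\<in>keys p. \<Sum>n\<in>keys q.
      ev f (Poly_Mapping.single m (lookup p m)) * ev f (Poly_Mapping.single n (lookup q n)))"
    by (simp add: ev_sum single)
  also have "\<dots> = ev f p * ev f q"
    by (subst (2) mpoly_expand[of p], subst (2) mpoly_expand[of q]) (simp add: ev_sum sum_product)
  finally show ?thesis .
qed

lemma ev_uminus: "ev f (- p) = - ev f p"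
  using ev_add[of f p "- p"] by (simp add: eq_neg_iff_add_eq_0 add.commute)

lemma ev_diff: "ev f (p - q) = ev f p - ev f q"
  using ev_add[of f p "- q"] by (simp add: ev_uminus)

lemma ev_prod: "ev f (\<Prod>i\<in>A. g i) = (\<Prod>i\<in>A. ev f (g i))"
  by (induction A rule: infinite_finite_induct) (auto simp: ev_mult)

lemma ev_in_subring:
  assumes S: "subring S" and c: "\<And>c. Poly_Mapping.single 0 c \<in> S"
    and p: "p \<in> polys P" and f: "\<And>v. v \<in> P \<Longrightarrow> f v \<in> S"
  shows "ev f p \<in> S"
proof -
  have "(\<Prod>v\<in>#m. f v) \<in> S" if "set_mset m \<subseteq> P" for m
    using that by (induction m) (auto intro: subringD[OF S] f)
  then show ?thesis
    unfolding ev_def using p by (intro subring_sum[OF S] subring_mult[OF S] c) (auto simp: polys_def)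
qed

lemma ev_polys:
  assumes "p \<in> polys P" "\<And>v. v \<in> P \<Longrightarrow> f v \<in> polys Q"
  shows "ev f p \<in> polys Q"
  by (rule ev_in_subring[OF subring_polys _ assms]) (auto intro: single_in_polys)

text \<open>Telescoping as in \<open>prod_diff_in_ideal\<close>, now along a monomial. The induction
  also carries that the first product stays in \<open>polys Q\<close>, because \<open>J\<close>
  absorbs factors from there.\<close>

lemma ev_cong_ideal:
  assumes J: "ideal_in (polys Q) J" and p: "p \<in> polys P"
    and fg: "\<And>v. v \<in> P \<Longrightarrow> f v \<in> polys Q" "\<And>v. v \<in> P \<Longrightarrow> g v \<in> polys Q" "\<And>v. v \<in> P \<Longrightarrow> f v - g v \<in> J"
  shows "ev f p - ev g p \<in> J"
proof -
  note S = subring_polys[of Q]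
  have *: "(\<Prod>v\<in>#m. f v) \<in> polys Q \<and> (\<Prod>v\<in>#m. f v) - (\<Prod>v\<in>#m. g v) \<in> J"
    if "set_mset m \<subseteq> P" for m
    using that
  proof (induction m)
    case (add v m)
    have "(\<Prod>v\<in>#add_mset v m. f v) - (\<Prod>v\<in>#add_mset v m. g v)
       = (\<Prod>v\<in>#m. f v) * (f v - g v) + g v * ((\<Prod>v\<in>#m. f v) - (\<Prod>v\<in>#m. g v))"
      by (simp add: algebra_simps)
    also have "\<dots> \<in> J"
      using add fg by (intro ideal_add[OF J] ideal_mult[OF J]) auto
    finally show ?case
      using add fg(1)[of v] by (auto intro: subring_mult[OF S])
  qed (auto intro: ideal_0[OF J] subring_1[OF S])
  have "ev f p - ev g p = (\<Sum>m\<in>keys p. Poly_Mapping.single 0 (lookup p m) *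
      ((\<Prod>v\<in>#m. f v) - (\<Prod>v\<in>#m. g v)))"
    by (simp add: ev_def sum_subtractf right_diff_distrib)
  also have "\<dots> \<in> J"
    using p * by (intro ideal_sum[OF J] ideal_mult[OF J] single_in_polys) (auto simp: polys_def)
  finally show ?thesis .
qed

lemma ev_eq_self:
  assumes "p \<in> polys P" "\<And>v. v \<in> P \<Longrightarrow> f v = Var v"
  shows "ev f p = p"
proof -
  have "(\<Prod>v\<in>#m. f v) = Poly_Mapping.single m 1" if "set_mset m \<subseteq> P" for m
    using that by (induction m) (auto simp: assms(2) Var_def mult_single)
  then have "ev f p = (\<Sum>m\<in>keys p. Poly_Mapping.single m (lookup p m))"
    unfolding ev_def using assms(1) by (intro sum.cong refl) (auto simp: polys_def mult_single)
  then show ?thesis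
    using mpoly_expand[of p] by simp
qed

section \<open>Adjoining a variable\<close>

text \<open>The monomials in \<open>B\<close> represent a rational basis of \<open>S\<close> modulo
  \<open>I\<close>: the first conjunct is spanning, the second independence. A polynomial with
  \<open>keys\<close> in \<open>B\<close> is a linear combination of these monomials.\<close>

definition monomial_basis :: "'v mpoly set \<Rightarrow> 'v mpoly set \<Rightarrow> 'v multiset set \<Rightarrow> bool" where
  "monomial_basis S I B \<longleftrightarrow> (\<forall>s\<in>S. \<exists>r. keys r \<subseteq> B \<and> s - r \<in> I) \<and>
     (\<forall>r. keys r \<subseteq> B \<longrightarrow> r \<in> I \<longrightarrow> r = 0)"

section \<open>Polynomials in one further variable over a subring\<close>

definition coeffs_in :: "'r::comm_ring_1 set \<Rightarrow> 'r poly set" where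
  "coeffs_in S = {f. \<forall>k. coeff f k \<in> S}"

lemma coeffs_inD: "f \<in> coeffs_in S \<Longrightarrow> coeff f k \<in> S"
  by (simp add: coeffs_in_def)

lemma lookup_eq_0_if_not_subset:
  assumes "p \<in> polys P" "t \<notin> P" "t \<in># m"
  shows "lookup p m = 0"
proof -
  have "m \<notin> keys p"
    using assms by (auto simp: polys_def)
  then show ?thesis
    by (simp add: in_keys_iff)
qed

lemma ideal_coeffs_in:
  assumes J: "ideal_in S J"
  shows "ideal_in (coeffs_in S) (coeffs_in J)"
  unfolding ideal_in_def
proof (intro conjI ballI)
  show "0 \<in> coeffs_in J"
    by (simp add: coeffs_in_def ideal_0[OF J])
  show "a + b \<in> coeffs_in J" if "a \<in> coeffs_in J" "b \<in> coeffs_in J" for a b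
    using that by (simp add: coeffs_in_def ideal_add[OF J])
  show "s * a \<in> coeffs_in J" if "s \<in> coeffs_in S" "a \<in> coeffs_in J" for s a
    using that by (simp add: coeffs_in_def coeff_mult ideal_sum[OF J] ideal_mult[OF J])
qed

lemma subring_coeffs_in:
  assumes S: "subring S"
  shows "subring (coeffs_in S)"
  unfolding subring_def coeffs_in_def
  by (auto simp: coeff_mult coeff_1 intro!: subring_sum[OF S] subringD[OF S])

lemma monom_coeffs_in: "0 \<in> S \<Longrightarrow> c \<in> S \<Longrightarrow> monom c k \<in> coeffs_in S"
  by (auto simp: coeffs_in_def)

lemma pCons_coeffs_in: "c \<in> S \<Longrightarrow> f \<in> coeffs_in S \<Longrightarrow> pCons c f \<in> coeffs_in S"
  by (auto simp: coeffs_in_def coeff_pCons split: nat.split)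

lemma poly_coeffs_in:
  assumes S: "subring S" and "f \<in> coeffs_in S" "x \<in> S"
  shows "poly f x \<in> S"
  unfolding poly_altdef
proof (rule subring_sum[OF S])
  have "x ^ k \<in> S" for k
    using assms(3) by (induction k) (auto intro: subring_1[OF S] subring_mult[OF S])
  then show "coeff f k * x ^ k \<in> S" for k
    using assms(2) by (auto simp: coeffs_in_def intro: subring_mult[OF S])
qed

text \<open>Sorts the terms of \<open>s\<close> by their exponent of \<open>t\<close>, which turns
  \<open>s\<close> into a polynomial in \<open>t\<close> with coefficients free of
  \<open>t\<close>.\<close>

definition as_poly :: "'v \<Rightarrow> 'v mpoly \<Rightarrow> 'v mpoly poly" where
  "as_poly t s = (\<Sum>m\<in>keys s. monom (single (filter_mset (\<lambda>v. v \<noteq> t) m) (lookup s m)) (count m t))"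

lemma poly_as_poly: "poly (as_poly t s) (Var t) = s"
proof -
  have "filter_mset (\<lambda>v. v \<noteq> t) m + replicate_mset (count m t) t = m" for m
    by (rule multiset_eqI) simp
  then show ?thesis
    by (subst (2) mpoly_expand[of s])
      (simp add: as_poly_def poly_sum poly_monom Var_power mult_single)
qed

lemma coeff_as_poly:
  "coeff (as_poly t s) k =
    (\<Sum>m\<in>{m\<in>keys s. count m t = k}. single (filter_mset (\<lambda>v. v \<noteq> t) m) (lookup s m))"
  by (simp add: as_poly_def coeff_sum sum.inter_filter[symmetric] eq_commute)

lemma keys_coeff_as_poly:
  "keys (coeff (as_poly t s) k) \<subseteq> {filter_mset (\<lambda>v. v \<noteq> t) m | m. m \<in> keys s \<and> count m t = k}"
  unfolding coeff_as_poly by (rule order_trans[OF Poly_Mapping.keys_sum]) auto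

lemma as_poly_coeffs_in:
  assumes "s \<in> polys (insert t P)"
  shows "as_poly t s \<in> coeffs_in (polys P)"
  unfolding coeffs_in_def polys_def
  using assms keys_coeff_as_poly[of t s] by (fastforce simp: polys_def)

text \<open>The coefficients do not involve \<open>t\<close>, so a monomial with exponent
  \<open>n\<close> of \<open>t\<close> can come only from the summand of degree
  \<open>n\<close>.\<close>

lemma lookup_poly_Var:
  assumes f: "f \<in> coeffs_in (polys P)" and t: "t \<notin> P" and m: "t \<notin># m"
  shows "lookup (poly f (Var t)) (m + replicate_mset n t) = lookup (coeff f n) m"
proof -
  have "lookup (coeff f i * Var t ^ i) (m + replicate_mset n t) = (if i = n then lookup (coeff f n) m else 0)"
    for i
  proof -
    have *: "replicate_mset i t \<subseteq># m + replicate_mset n t \<longleftrightarrow> i \<le> n"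
      using m by (auto simp: subseteq_mset_def not_in_iff split: if_splits)
    \<comment> \<open>For \<open>i < n\<close> some \<open>t\<close> would remain in the monomial of
      the coefficient.\<close>
    have "lookup (coeff f i) (m + replicate_mset n t - replicate_mset i t) = 0" if "i < n"
    proof -
      have "t \<in># m + replicate_mset n t - replicate_mset i t"
        using that by (simp add: in_diff_count)
      then show ?thesis
        by (rule lookup_eq_0_if_not_subset[OF coeffs_inD[OF f] t])
    qed
    then show ?thesis
      by (auto simp: Var_power lookup_mult_single *)
  qed
  then show ?thesis
    by (auto simp: poly_altdef lookup_sum coeff_eq_0)
qed

text \<open>\<open>Var t\<close> is transcendental over \<open>polys P\<close>; hence an identity
  between values at \<open>Var t\<close> lifts to the polynomials themselves.\<close>

lemma poly_Var_eq_0: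
  assumes f: "f \<in> coeffs_in (polys P)" and t: "t \<notin> P" and 0: "poly f (Var t) = 0"
  shows "f = 0"
proof (rule poly_eqI, rule poly_mapping_eqI)
  fix n m
  show "lookup (coeff f n) m = lookup (coeff 0 n) m"
  proof (cases "t \<in># m")
    case True
    then show ?thesis
      using lookup_eq_0_if_not_subset[OF coeffs_inD[OF f] t, of m n] by simp
  next
    case False
    then show ?thesis
      using lookup_poly_Var[OF f t, of m n] 0 by simp
  qed
qed

text \<open>Long division works over any commutative ring because the leading coefficient of
  \<open>p\<close> is \<open>1\<close>. The induction is on a strict bound \<open>n\<close> for the
  degree of \<open>f\<close>.\<close>

lemma monic_division:
  fixes p :: "'r::comm_ring_1 poly"
  assumes S: "subring S" and p: "p \<in> coeffs_in S" "coeff p d = 1" "\<And>k. d < k \<Longrightarrow> coeff p k = 0"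
    and "f \<in> coeffs_in S" "\<And>k. n \<le> k \<Longrightarrow> coeff f k = 0"
  shows "\<exists>u\<in>coeffs_in S. \<exists>g\<in>coeffs_in S. f = p * u + g \<and> (\<forall>k\<ge>d. coeff g k = 0)"
  using assms(5,6)
proof (induction n arbitrary: f)
  case 0
  then show ?case
    by (intro bexI[of _ 0] bexI[of _ f]) (auto simp: coeffs_in_def subring_0[OF S])
next
  case (Suc n)
  note SS = subring_coeffs_in[OF S]
  show ?case
  proof (cases "Suc n \<le> d")
    case True
    then show ?thesis
      using Suc.prems by (intro bexI[of _ 0] bexI[of _ f]) (auto simp: coeffs_in_def subring_0[OF S])
  next
    case False
    \<comment> \<open>Here \<open>d \<le> n\<close>, and \<open>p * ?q\<close> has the same
      coefficient as \<open>f\<close> in degree \<open>n\<close> and none above it.\<close>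
    let ?q = "monom (coeff f n) (n - d)"
    have q: "?q \<in> coeffs_in S"
      using Suc.prems(1) by (intro monom_coeffs_in subring_0[OF S]) (auto simp: coeffs_in_def)
    have "f - p * ?q \<in> coeffs_in S"
      using Suc.prems(1) p(1) q by (intro subring_diff[OF SS] subring_mult[OF SS])
    moreover have "coeff (f - p * ?q) k = 0" if "n \<le> k" for k
    proof (cases "k = n")
      case True
      then show ?thesis
        using False p(2) by (simp add: mult.commute[of p] coeff_monom_mult)
    next
      case F: False
      then have "coeff f k = 0" "d < k - (n - d)"
        using that False Suc.prems(2) by auto
      then show ?thesis
        using p(3) that by (simp add: mult.commute[of p] coeff_monom_mult)
    qed
    ultimately obtain u g where ug: "u \<in> coeffs_in S" "g \<in> coeffs_in S"
      "f - p * ?q = p * u + g" "\<forall>k\<ge>d. coeff g k = 0"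
      using Suc.IH by blast
    from ug(3) have "f = p * (u + ?q) + g"
      by (simp add: algebra_simps)
    then show ?thesis
      using ug q by (intro bexI[of _ "u + ?q"] bexI[of _ g] subring_add[OF SS]) auto
  qed
qed

text \<open>Let \<open>n\<close> be the highest position where \<open>u\<close> has a coefficient
  outside \<open>K\<close>. As \<open>p\<close> is monic, the coefficient of \<open>p * u\<close> in
  degree \<open>n + d\<close> is \<open>coeff u n\<close> up to an element of \<open>K\<close>, a
  contradiction.\<close>

lemma monic_mult_in_ideal:
  fixes p :: "'r::comm_ring_1 poly"
  assumes S: "subring S" and K: "ideal_in S K"
    and p: "p \<in> coeffs_in S" "coeff p d = 1" "\<And>k. d < k \<Longrightarrow> coeff p k = 0"
    and u: "u \<in> coeffs_in S" and pu: "\<And>k. d \<le> k \<Longrightarrow> coeff (p * u) k \<in> K"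
  shows "u \<in> coeffs_in K"
proof (rule ccontr)
  assume "u \<notin> coeffs_in K"
  then obtain j where j: "coeff u j \<notin> K"
    by (auto simp: coeffs_in_def)
  have bound: "k \<le> degree u" if "coeff u k \<notin> K" for k
    using that ideal_0[OF K] by (metis le_degree)
  define n where "n = Max {k. coeff u k \<notin> K}"
  have fin: "finite {k. coeff u k \<notin> K}"
    by (rule finite_subset[of _ "{..degree u}"]) (use bound in auto)
  have n: "coeff u n \<notin> K"
    using Max_in[OF fin] j unfolding n_def by auto
  have above: "coeff u k \<in> K" if "n < k" for k
    using Max_ge[OF fin, of k] that unfolding n_def by auto
  have "coeff (p * u) (n + d) = (\<Sum>i\<le>n + d. coeff p i * coeff u (n + d - i))"
    by (simp add: coeff_mult)
  also have "\<dots> = coeff u n + (\<Sum>i\<in>{..n + d} - {d}. coeff p i * coeff u (n + d - i))"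
    using p(2) by (subst sum.remove[of _ d]) auto
  finally have eq: "coeff u n = coeff (p * u) (n + d)
      - (\<Sum>i\<in>{..n + d} - {d}. coeff p i * coeff u (n + d - i))"
    by simp
  have "coeff p i * coeff u (n + d - i) \<in> K" if "i \<in> {..n + d} - {d}" for i
  proof (cases "i < d")
    case True
    then show ?thesis
      using p(1) by (intro ideal_mult[OF K] above) (auto simp: coeffs_in_def)
  next
    case False
    then show ?thesis
      using that p(3)[of i] ideal_0[OF K] by auto
  qed
  then have "coeff u n \<in> K"
    unfolding eq by (intro ideal_diff[OF S K] pu ideal_sum[OF K]) auto
  with n show False by simp
qed

text \<open>If \<open>J = (p) + I + tK[t]\<close> with \<open>p\<close> monic of degree \<open>d\<close> and \<open>p(0) K \<subseteq> I \<subseteq> K\<close>, then the quotient of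
  \<open>S[t]\<close> by \<open>J\<close> is \<open>S/I \<oplus> t S/K \<oplus> \<dots> \<oplus> t\<^sup>d\<^sup>-\<^sup>1 S/K\<close>.\<close>

lemma monomial_basis_adjoin:
  fixes P :: "'v set" and t :: 'v
  defines "S \<equiv> polys P"
  assumes t: "t \<notin> P" and I: "ideal_in S I" and K: "ideal_in S K" and IK: "I \<subseteq> K"
    and p: "p \<in> coeffs_in S" "coeff p d = 1" "\<And>k. d < k \<Longrightarrow> coeff p k = 0" "0 < d"
    and p0: "\<And>a. a \<in> K \<Longrightarrow> coeff p 0 * a \<in> I"
    and J: "J = {poly (p * u + w) (Var t) | u w. u \<in> coeffs_in S \<and> w \<in> coeffs_in K \<and> coeff w 0 \<in> I}"
    and B: "monomial_basis S I B" "\<And>m. m \<in> B \<Longrightarrow> set_mset m \<subseteq> P"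
    and C: "monomial_basis S K C" "\<And>m. m \<in> C \<Longrightarrow> set_mset m \<subseteq> P"
    and KS: "K \<subseteq> S"
  shows "monomial_basis (polys (insert t P)) J
     (B \<union> (\<lambda>(k, c). c + replicate_mset k t) ` ({1..<d} \<times> C))" (is "monomial_basis _ _ ?B")
  unfolding monomial_basis_def
proof (intro conjI ballI allI impI)
  have S: "subring S" unfolding S_def by (rule subring_polys)
  note SS = subring_coeffs_in[OF S]
  fix s assume "s \<in> polys (insert t P)"
  then have f: "as_poly t s \<in> coeffs_in S"
    unfolding S_def by (rule as_poly_coeffs_in)
  have "coeff (as_poly t s) k = 0" if "Suc (degree (as_poly t s)) \<le> k" for k
    using that by (intro coeff_eq_0) auto
  from monic_division[OF S p(1-3) f this] obtain u g where
    ug: "u \<in> coeffs_in S" "g \<in> coeffs_in S" "as_poly t s = p * u + g" "\<And>k. d \<le> k \<Longrightarrow> coeff g k = 0"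
    by blast
  \<comment> \<open>The constant coefficient of the remainder is reduced modulo \<open>I\<close>,
    all others modulo \<open>K\<close>. This is why \<open>B\<close> appears with exponent
    \<open>0\<close> of \<open>t\<close> and \<open>C\<close> with the exponents from
    \<open>1\<close> to \<open>d - 1\<close>.\<close>
  have "\<exists>r. keys r \<subseteq> (if k = 0 then B else C) \<and> coeff g k - r \<in> (if k = 0 then I else K)" for k
  proof -
    have "coeff g k \<in> S" using ug(2) by (auto simp: coeffs_in_def)
    then show ?thesis
      using B(1) C(1) unfolding monomial_basis_def by auto
  qed
  then obtain rr where rr: "\<And>k. keys (rr k) \<subseteq> (if k = 0 then B else C)"
    "\<And>k. coeff g k - rr k \<in> (if k = 0 then I else K)"
    by metis
  define r where "r = (\<Sum>k<d. monom (rr k) k)"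
  have coeff_r: "coeff r k = (if k < d then rr k else 0)" for k
    by (simp add: r_def coeff_sum if_distrib)
  define w where "w = g - r"
  have wk: "coeff w k \<in> (if k = 0 then I else K)" for k
    using rr(2)[of k] ug(4)[of k] ideal_0[OF K] p(4) by (auto simp: w_def coeff_r not_less)
  have "coeff w k \<in> K" for k
    using wk[of k] IK by (auto split: if_splits)
  then have w: "coeff w 0 \<in> I" "w \<in> coeffs_in K"
    using wk[of 0] by (auto simp: coeffs_in_def)
  have "s - poly r (Var t) = poly (p * u + w) (Var t)"
    by (subst (1) poly_as_poly[of t s, symmetric]) (simp add: ug(3) w_def)
  then have "s - poly r (Var t) \<in> J"
    unfolding J using ug(1) w by blast
  moreover have "keys (poly r (Var t)) \<subseteq> ?B"
  proof -
    have "keys (rr k * Var t ^ k) \<subseteq> ?B" if "k < d" for k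
    proof
      fix m assume "m \<in> keys (rr k * Var t ^ k)"
      then obtain c where c: "c \<in> keys (rr k)" "m = c + replicate_mset k t"
        using keys_mult[of "rr k" "Var t ^ k"] by (auto simp: Var_power)
      show "m \<in> ?B"
        using c rr(1)[of k] that by (cases "k = 0") force+
    qed
    then show ?thesis
      unfolding r_def by (simp add: poly_sum poly_monom)
        (rule order_trans[OF Poly_Mapping.keys_sum], auto)
  qed
  ultimately show "\<exists>r. keys r \<subseteq> ?B \<and> s - r \<in> J"
    by blast
next
  have S: "subring S" unfolding S_def by (rule subring_polys)
  note SS = subring_coeffs_in[OF S]
  have fl: "filter_mset (\<lambda>v. v \<noteq> t) m = m" "count m t = 0" if "set_mset m \<subseteq> P" for m
    using that t by (auto simp: filter_mset_eq_conv not_in_iff[symmetric])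
  fix r assume kr: "keys r \<subseteq> ?B" and "r \<in> J"
  then obtain u w where uw: "u \<in> coeffs_in S" "w \<in> coeffs_in K" "coeff w 0 \<in> I"
    "r = poly (p * u + w) (Var t)"
    unfolding J by blast
  have key_cases: "(m \<in> B \<and> set_mset m \<subseteq> P \<and> count m t = 0 \<and> filter_mset (\<lambda>v. v \<noteq> t) m = m) \<or>
     (set_mset m \<subseteq> insert t P \<and> 0 < count m t \<and> count m t < d \<and> filter_mset (\<lambda>v. v \<noteq> t) m \<in> C)"
    if m: "m \<in> keys r" for m
  proof (cases "m \<in> B")
    case True
    then show ?thesis using B(2)[OF True] fl[of m] by simp
  next
    case False
    then have "m \<in> (\<lambda>(k, c). c + replicate_mset k t) ` ({1..<d} \<times> C)"
      using m kr by blast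
    then obtain k c where kc: "1 \<le> k" "k < d" "c \<in> C" "m = c + replicate_mset k t"
      by auto
    have "filter_mset (\<lambda>v. v \<noteq> t) m = c" "count m t = k" "set_mset m \<subseteq> insert t P"
      unfolding kc(4) using C(2)[OF kc(3)] fl[of c] by (auto split: if_splits)
    then show ?thesis using kc by simp
  qed
  define f where "f = as_poly t r"
  have kf0: "keys (coeff f 0) \<subseteq> B"
  proof -
    have "filter_mset (\<lambda>v. v \<noteq> t) m \<in> B" if "m \<in> keys r" "count m t = 0" for m
      using key_cases[OF that(1)] that(2) by auto
    then show ?thesis
      using keys_coeff_as_poly[of t r 0] unfolding f_def by blast
  qed
  have kfk: "keys (coeff f k) \<subseteq> C" if "0 < k" for k
  proof -
    have "filter_mset (\<lambda>v. v \<noteq> t) m \<in> C" if "m \<in> keys r" "count m t = k" for m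
      using key_cases[OF that(1)] that(2) \<open>0 < k\<close> by auto
    then show ?thesis
      using keys_coeff_as_poly[of t r k] unfolding f_def by blast
  qed
  have fd: "coeff f k = 0" if "d \<le> k" for k
  proof -
    have small: "count m t < d" if "m \<in> keys r" for m
      using key_cases[OF that] p(4) by auto
    have "{m \<in> keys r. count m t = k} = {}"
      using small that by (intro equals0I) (auto simp: not_less[symmetric])
    then show ?thesis
      by (simp add: f_def coeff_as_poly del: Collect_empty_eq)
  qed
  have r: "r \<in> polys (insert t P)"
    unfolding polys_def using key_cases by blast
  have wS: "w \<in> coeffs_in S"
    using uw(2) KS by (auto simp: coeffs_in_def)
  \<comment> \<open>Both sides have the value \<open>r\<close> at the transcendental element
    \<open>Var t\<close>.\<close>
  have "f = p * u + w"
  proof -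
    have "poly (f - (p * u + w)) (Var t) = 0"
      using poly_as_poly[of t r] uw(4) by (simp add: f_def)
    moreover have "f - (p * u + w) \<in> coeffs_in (polys P)"
      using as_poly_coeffs_in[OF r] p(1) uw(1) wS unfolding f_def S_def[symmetric]
      by (intro subringD[OF SS])
    ultimately show ?thesis
      using poly_Var_eq_0[OF _ t] by fastforce
  qed
  then have pu: "p * u = f - w" by simp
  \<comment> \<open>From degree \<open>d\<close> on \<open>f\<close> vanishes, so there
    \<open>p * u\<close> equals \<open>- w\<close> and has coefficients in \<open>K\<close>.\<close>
  have "u \<in> coeffs_in K"
  proof (rule monic_mult_in_ideal[OF S K p(1-3) uw(1)])
    fix k assume "d \<le> k"
    then show "coeff (p * u) k \<in> K"
      using fd uw(2) by (auto simp: pu coeffs_in_def intro: ideal_uminus[OF S K])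
  qed
  then have puK: "p * u \<in> coeffs_in K"
    using p(1) by (rule ideal_mult[OF ideal_coeffs_in[OF K], rotated])
  have f: "f = p * u + w" using pu by simp
  have "coeff f k = 0" for k
  proof (cases "k = 0")
    case True
    \<comment> \<open>The constant coefficient must vanish modulo \<open>I\<close>, not merely
      modulo \<open>K\<close>; this is where \<open>p(0) K \<subseteq> I\<close> enters.\<close>
    have "coeff f 0 = coeff p 0 * coeff u 0 + coeff w 0"
      unfolding f by (simp add: coeff_mult)
    also have "\<dots> \<in> I"
      using \<open>u \<in> coeffs_in K\<close> uw(3) p0 by (intro ideal_add[OF I]) (auto simp: coeffs_in_def)
    finally show ?thesis
      using B(1) kf0 True by (auto simp: monomial_basis_def)
  next
    case False
    have "coeff f k \<in> K"
      unfolding f coeff_add using coeffs_inD[OF puK] coeffs_inD[OF uw(2)] by (rule ideal_add[OF K])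
    then show ?thesis
      using C(1) kfk False by (auto simp: monomial_basis_def)
  qed
  then have "f = 0" by (intro poly_eqI) simp
  then show "r = 0"
    using poly_as_poly[of t r] by (simp add: f_def)
qed

section \<open>Flats and relative bases\<close>

text \<open>\<open>I\<close> is a basis of \<open>F\<close> in the contraction by \<open>Z\<close>; the rank conditions force \<open>I\<close> to be disjoint from \<open>Z\<close>.\<close>

definition rel_basis :: "'a matroid \<Rightarrow> 'a set \<Rightarrow> 'a set \<Rightarrow> 'a set \<Rightarrow> bool" where
  "rel_basis M Z F I \<longleftrightarrow> I \<subseteq> F \<and> rk M (Z \<union> I) = rk M F \<and> rk M F = rk M Z + card I"

definition closure :: "'a matroid \<Rightarrow> 'a set \<Rightarrow> 'a set" where
  "closure M A = {e \<in> gset M. rk M (insert e A) = rk M A}"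

lemma flat_subset: "F \<in> flats M \<Longrightarrow> F \<subseteq> gset M"
  by (simp add: flats_def is_flat_def)

lemma gset_in_flats: "gset M \<in> flats M"
  by (simp add: flats_def is_flat_def)

section \<open>Rank inequalities, flats, closures and bases of a fixed matroid\<close>

context
  fixes M :: "'a matroid"
  assumes M: "matroid M"
begin

lemma finite_gset: "finite (gset M)"
  by (rule M[unfolded matroid_def, THEN conjunct1])

lemma finite_flats: "finite (flats M)"
  by (rule finite_subset[of _ "Pow (gset M)"]) (auto dest: flat_subset simp: finite_gset)

lemma finite_flat: "F \<in> flats M \<Longrightarrow> finite F"
  by (rule finite_subset[OF flat_subset finite_gset])

text \<open>Ranks see only the part inside the ground set, which frees the rank inequalities below
  from inclusions in \<open>gset M\<close>.\<close>

lemma rk_Int: "rk M (A \<inter> gset M) = rk M A"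
proof -
  have "\<forall>A. rk M A = rk M (A \<inter> gset M)"
    by (rule M[unfolded matroid_def, THEN conjunct2, THEN conjunct1])
  from this[THEN spec, of A] show ?thesis by (rule sym)
qed

lemma rk_mono:
  assumes "A \<subseteq> B"
  shows "rk M A \<le> rk M B"
proof -
  have "\<forall>A B. A \<subseteq> B \<longrightarrow> B \<subseteq> gset M \<longrightarrow> rk M A \<le> rk M B"
    by (rule M[unfolded matroid_def, THEN conjunct2, THEN conjunct2, THEN conjunct2, THEN conjunct1])
  moreover have "A \<inter> gset M \<subseteq> B \<inter> gset M" "B \<inter> gset M \<subseteq> gset M"
    using assms by auto
  ultimately have "rk M (A \<inter> gset M) \<le> rk M (B \<inter> gset M)"
    by blast
  then show ?thesis by (simp only: rk_Int)
qed

lemma rk_submodular: "rk M (A \<union> B) + rk M (A \<inter> B) \<le> rk M A + rk M B"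
proof -
  let ?A = "A \<inter> gset M" and ?B = "B \<inter> gset M"
  have "\<forall>A B. A \<subseteq> gset M \<longrightarrow> B \<subseteq> gset M \<longrightarrow>
      rk M (A \<union> B) + rk M (A \<inter> B) \<le> rk M A + rk M B"
    by (rule M[unfolded matroid_def, THEN conjunct2, THEN conjunct2, THEN conjunct2, THEN conjunct2])
  then have "rk M (?A \<union> ?B) + rk M (?A \<inter> ?B) \<le> rk M ?A + rk M ?B"
    by blast
  moreover have "?A \<union> ?B = (A \<union> B) \<inter> gset M" "?A \<inter> ?B = (A \<inter> B) \<inter> gset M"
    by auto
  ultimately show ?thesis by (simp only: rk_Int)
qed

lemma rk_le_card:
  assumes "finite A"
  shows "rk M A \<le> card A"
proof -
  have "\<forall>A. A \<subseteq> gset M \<longrightarrow> rk M A \<le> card A"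
    by (rule M[unfolded matroid_def, THEN conjunct2, THEN conjunct2, THEN conjunct1])
  then have "rk M (A \<inter> gset M) \<le> card (A \<inter> gset M)"
    by blast
  also have "\<dots> \<le> card A"
    using assms by (intro card_mono) auto
  finally show ?thesis by (simp only: rk_Int)
qed

lemma rk_empty: "rk M {} = 0"
  using rk_le_card[of "{}"] by simp

lemma rk_Un_le: "finite A \<Longrightarrow> rk M (Z \<union> A) \<le> rk M Z + card A"
  using rk_submodular[of Z A] rk_le_card[of A] by simp

lemma rk_insert_le: "rk M (insert e A) \<le> rk M A + 1"
  using rk_Un_le[of "{e}" A] by simp

lemma rk_insert_ge: "rk M A \<le> rk M (insert e A)"
  by (rule rk_mono) blast

text \<open>Submodularity for \<open>insert e A\<close> and \<open>B\<close>: their union contains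
  \<open>insert e B\<close> and their intersection contains \<open>A\<close>. Spanned elements thus
  stay spanned by larger sets.\<close>

lemma rk_insert_mono:
  assumes "A \<subseteq> B" "rk M (insert e A) = rk M A"
  shows "rk M (insert e B) = rk M B"
proof (rule antisym)
  have "rk M (insert e A \<union> B) + rk M (insert e A \<inter> B) \<le> rk M (insert e A) + rk M B"
    by (rule rk_submodular)
  moreover have "rk M (insert e B) \<le> rk M (insert e A \<union> B)"
    by (rule rk_mono) blast
  moreover have "rk M A \<le> rk M (insert e A \<inter> B)"
    using assms(1) by (intro rk_mono) blast
  ultimately show "rk M (insert e B) \<le> rk M B"
    using assms(2) by linarith
  show "rk M B \<le> rk M (insert e B)"
    by (rule rk_insert_ge)
qed

lemma rk_Un_eq:
  assumes "finite J" "\<And>j. j \<in> J \<Longrightarrow> rk M (insert j A) = rk M A"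
  shows "rk M (A \<union> J) = rk M A"
  using assms
proof (induction J rule: finite_induct)
  case (insert j J)
  have "rk M (insert j (A \<union> J)) = rk M (A \<union> J)"
    by (rule rk_insert_mono[OF _ insert.prems]) blast+
  also have "rk M (A \<union> J) = rk M A"
    by (rule insert.IH) (rule insert.prems, blast)
  finally show ?case by simp
qed simp

lemma flat_insert:
  assumes "F \<in> flats M" "e \<in> gset M" "e \<notin> F"
  shows "rk M (insert e F) = rk M F + 1"
proof -
  have "rk M F < rk M (insert e F)"
    using assms by (auto simp: flats_def is_flat_def)
  then show ?thesis using rk_insert_le[of e F] by simp
qed

text \<open>Every element of \<open>G\<close> is spanned by \<open>A\<close>, hence by
  \<open>F\<close>, and a flat contains what it spans. This is the device that forces one flat into
  another.\<close>

lemma subset_flat_if_spanned: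
  assumes F: "F \<in> flats M" and A: "A \<subseteq> F" "A \<subseteq> G" and G: "G \<subseteq> gset M" and r: "rk M A = rk M G"
  shows "G \<subseteq> F"
proof
  fix e assume e: "e \<in> G"
  have "rk M (insert e A) \<le> rk M G"
    using e A(2) by (intro rk_mono) auto
  then have "rk M (insert e A) = rk M A"
    using r rk_insert_ge[of A e] by linarith
  then have "rk M (insert e F) = rk M F"
    by (rule rk_insert_mono[OF A(1)])
  then show "e \<in> F"
    using flat_insert[OF F, of e] e G by auto
qed

lemma flat_rk_less:
  assumes "F \<in> flats M" "G \<subseteq> gset M" "F \<subset> G"
  shows "rk M F < rk M G"
proof (rule ccontr)
  assume "\<not> rk M F < rk M G"
  then have "rk M F = rk M G"
    using rk_mono[of F G] assms(3) by auto
  then have "G \<subseteq> F"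
    using subset_flat_if_spanned[of F F G] assms by auto
  then show False
    using assms(3) by auto
qed

lemma
  assumes A: "A \<subseteq> gset M"
  shows subset_closure: "A \<subseteq> closure M A"
    and rk_closure: "rk M (closure M A) = rk M A"
    and closure_in_flats: "closure M A \<in> flats M"
proof -
  show sub: "A \<subseteq> closure M A"
    using A by (auto simp: closure_def insert_absorb)
  have "rk M (A \<union> closure M A) = rk M A"
    by (rule rk_Un_eq) (auto simp: closure_def finite_gset)
  then show r: "rk M (closure M A) = rk M A"
    using sub by (simp add: Un_absorb1)
  have "rk M (closure M A) < rk M (insert e (closure M A))" if "e \<in> gset M - closure M A" for e
  proof -
    have "rk M (insert e A) \<noteq> rk M A"
      using that by (auto simp: closure_def)
    then have "rk M A < rk M (insert e A)"
      using rk_insert_ge[of A e] by linarith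
    also have "\<dots> \<le> rk M (insert e (closure M A))"
      using sub by (intro rk_mono) auto
    finally show ?thesis by (simp add: r)
  qed
  then show "closure M A \<in> flats M"
    by (auto simp: flats_def is_flat_def closure_def)
qed

text \<open>A maximal subset of \<open>F\<close> that is independent over \<open>Z\<close> spans
  \<open>F\<close> together with \<open>Z\<close>, since any unspanned element could be
  added.\<close>

lemma rel_basis_exists:
  assumes "Z \<subseteq> F" "F \<subseteq> gset M"
  obtains I where "rel_basis M Z F I"
proof -
  define S where "S = {I. I \<subseteq> F \<and> rk M (Z \<union> I) = rk M Z + card I}"
  have F: "finite F" by (rule finite_subset[OF assms(2) finite_gset])
  have "S \<subseteq> Pow F" by (auto simp: S_def)
  then have fin: "finite S" by (rule finite_subset) (simp add: F)
  have "{} \<in> S" by (simp add: S_def)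
  then have "S \<noteq> {}" by blast
  from finite_has_maximal[OF fin this] obtain I where
    I: "I \<in> S" and max: "\<forall>J\<in>S. I \<subseteq> J \<longrightarrow> I = J"
    by blast
  have IF: "I \<subseteq> F" and rI: "rk M (Z \<union> I) = rk M Z + card I"
    using I by (simp_all add: S_def)
  have finI: "finite I" by (rule finite_subset[OF IF F])
  have "rk M (insert e (Z \<union> I)) = rk M (Z \<union> I)" if e: "e \<in> F" for e
  proof (rule ccontr)
    assume ne: "rk M (insert e (Z \<union> I)) \<noteq> rk M (Z \<union> I)"
    then have eI: "e \<notin> I" by (auto simp: insert_absorb)
    have "rk M (insert e (Z \<union> I)) = rk M (Z \<union> I) + 1"
      using ne rk_insert_le[of e "Z \<union> I"] rk_insert_ge[of "Z \<union> I" e] by linarith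
    then have "rk M (Z \<union> insert e I) = rk M Z + card (insert e I)"
      using eI rI finI by simp
    then have "insert e I \<in> S"
      using e IF by (simp add: S_def)
    then show False
      using max eI by blast
  qed
  then have "rk M ((Z \<union> I) \<union> F) = rk M (Z \<union> I)"
    by (rule rk_Un_eq[OF F])
  moreover have "(Z \<union> I) \<union> F = F"
    using IF assms(1) by blast
  ultimately have "rk M F = rk M (Z \<union> I)" by simp
  then show ?thesis
    using IF rI by (intro that[of I]) (simp add: rel_basis_def)
qed

text \<open>Deleting \<open>i\<close> from \<open>I\<close> lowers the rank, so some
  \<open>j \<in> I'\<close> is not spanned by the rest. Adding this \<open>j\<close> restores the
  rank.\<close>

lemma rel_basis_exchange:
  assumes I: "rel_basis M Z F I" and I': "rel_basis M Z F I'" and F: "F \<in> flats M"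
    and i: "i \<in> I" "i \<notin> I'"
  obtains j where "j \<in> I'" "j \<notin> I" "rel_basis M Z F (insert j (I - {i}))"
proof -
  let ?A = "Z \<union> (I - {i})"
  have fin: "finite I" "finite I'"
    using I I' finite_subset[OF _ finite_flat[OF F]] by (simp_all add: rel_basis_def)
  have c: "Suc (card (I - {i})) = card I"
    using card.remove[OF fin(1) i(1)] by simp
  have A: "rk M ?A < rk M F"
    using rk_Un_le[of "I - {i}" Z] fin I c by (simp add: rel_basis_def)
  have "\<exists>j\<in>I'. rk M (insert j ?A) \<noteq> rk M ?A"
  proof (rule ccontr)
    assume "\<not> ?thesis"
    then have "rk M (?A \<union> I') = rk M ?A"
      using fin by (intro rk_Un_eq) auto
    moreover have "rk M (Z \<union> I') \<le> rk M (?A \<union> I')"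
      by (rule rk_mono) auto
    ultimately show False
      using A I' by (simp add: rel_basis_def)
  qed
  then obtain j where j: "j \<in> I'" "rk M (insert j ?A) \<noteq> rk M ?A" by blast
  have "j \<notin> I" using j i by (cases "j = i") (auto simp: insert_absorb)
  have "insert i ?A = Z \<union> I" using i by auto
  then have "rk M F \<le> rk M ?A + 1"
    using rk_insert_le[of i ?A] I by (simp add: rel_basis_def)
  moreover have "rk M ?A < rk M (insert j ?A)"
    using j(2) rk_insert_ge[of ?A j] by linarith
  ultimately have ge: "rk M F \<le> rk M (insert j ?A)" by simp
  have "rk M (Z \<union> insert j (I - {i})) \<le> rk M Z + card (insert j (I - {i}))"
    using fin by (intro rk_Un_le) auto
  also have "card (insert j (I - {i})) = card I"
    using \<open>j \<notin> I\<close> fin c by simp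
  finally have "rk M (Z \<union> insert j (I - {i})) = rk M F"
    using ge I by (simp add: rel_basis_def)
  moreover have "insert j (I - {i}) \<subseteq> F"
    using I I' j by (auto simp: rel_basis_def)
  ultimately have "rel_basis M Z F (insert j (I - {i}))"
    using I \<open>card (insert j (I - {i})) = card I\<close> by (simp add: rel_basis_def)
  then show ?thesis
    using that j \<open>j \<notin> I\<close> by blast
qed

end

section \<open>The ring of an order filter of flats\<close>

text \<open>The linear form \<open>y\<^sub>i\<close> of the opening text.\<close>

definition lin :: "'a set set \<Rightarrow> 'a \<Rightarrow> 'a set mpoly" where
  "lin P i = (\<Sum>G\<in>{G \<in> P. i \<in> G}. Var G)"

definition rels :: "'a matroid \<Rightarrow> 'a set \<Rightarrow> 'a set set \<Rightarrow> 'a set mpoly set" where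
  "rels M Z P = {Var G * Var H | G H. G \<in> P \<and> H \<in> P \<and> \<not> G \<subseteq> H \<and> \<not> H \<subseteq> G}
     \<union> {lin P i * Var G | i G. i \<in> gset M \<and> G \<in> P \<and> i \<notin> G}
     \<union> {prod (lin P) I | G I. G \<in> P \<and> rel_basis M Z G I}"

definition fy_ideal :: "'a matroid \<Rightarrow> 'a set \<Rightarrow> 'a set set \<Rightarrow> 'a set mpoly set" where
  "fy_ideal M Z P = idl (polys P) (rels M Z P)"

definition flat_filter :: "'a matroid \<Rightarrow> 'a set \<Rightarrow> 'a set set \<Rightarrow> bool" where
  "flat_filter M Z P \<longleftrightarrow> P \<subseteq> {G \<in> flats M. Z \<subset> G} \<and> (\<forall>G\<in>P. \<forall>H\<in>flats M. G \<subseteq> H \<longrightarrow> H \<in> P)"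

text \<open>The kernel \<open>K\<close> of the map onto the ring of the contraction by
  \<open>F\<close>, given by generators: variables of flats not above \<open>F\<close> and the forms
  of elements outside \<open>F\<close> go to zero. That the quotient is the intended one is
  \<open>monomial_basis_link\<close>.\<close>

definition link_ideal :: "'a matroid \<Rightarrow> 'a set \<Rightarrow> 'a set set \<Rightarrow> 'a set \<Rightarrow> 'a set mpoly set" where
  "link_ideal M Z P F = idl (polys P)
     (rels M Z P \<union> {Var G | G. G \<in> P \<and> \<not> F \<subseteq> G} \<union> {lin P i | i. i \<in> gset M - F})"

lemma lin_in_polys: "lin P i \<in> polys P"
  unfolding lin_def by (rule subring_sum[OF subring_polys]) (auto intro: Var_in_polys)

lemma prod_lin_in_polys: "prod (lin P) I \<in> polys P"
  by (rule subring_prod[OF subring_polys]) (rule lin_in_polys)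

lemma lin_insert:
  assumes "finite P" "F \<notin> P"
  shows "lin (insert F P) i = lin P i + (if i \<in> F then Var F else 0)"
proof (cases "i \<in> F")
  case True
  then have "{G \<in> insert F P. i \<in> G} = insert F {G \<in> P. i \<in> G}" by auto
  then show ?thesis
    using assms True by (simp add: lin_def)
next
  case False
  then have "{G \<in> insert F P. i \<in> G} = {G \<in> P. i \<in> G}" by auto
  then show ?thesis
    using False by (simp add: lin_def)
qed

lemma lin_diff_subset:
  assumes "finite P" "Q \<subseteq> P" "\<And>G. G \<in> Q \<Longrightarrow> i \<in> G"
  shows "lin P i - sum Var Q = sum Var {G \<in> P. i \<in> G \<and> G \<notin> Q}"
proof -
  have "{G \<in> P. i \<in> G} = {G \<in> P. i \<in> G \<and> G \<notin> Q} \<union> Q"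
    using assms(2,3) by blast
  moreover have "sum Var ({G \<in> P. i \<in> G \<and> G \<notin> Q} \<union> Q) = sum Var {G \<in> P. i \<in> G \<and> G \<notin> Q} + sum Var Q"
    using assms finite_subset[OF assms(2,1)] by (intro sum.union_disjoint) auto
  ultimately show ?thesis
    by (simp add: lin_def)
qed

text \<open>Flats containing both \<open>i\<close> and \<open>j\<close> cancel.\<close>

lemma lin_diff:
  assumes "finite P"
  shows "lin P i - lin P j = sum Var {G \<in> P. i \<in> G \<and> j \<notin> G} - sum Var {G \<in> P. j \<in> G \<and> i \<notin> G}"
proof -
  have "lin P i - sum Var {G \<in> P. i \<in> G \<and> j \<in> G} = sum Var {G \<in> P. i \<in> G \<and> j \<notin> G}"
    using lin_diff_subset[OF assms, of "{G \<in> P. i \<in> G \<and> j \<in> G}" i] by (simp cong: conj_cong)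
  moreover have "lin P j - sum Var {G \<in> P. i \<in> G \<and> j \<in> G} = sum Var {G \<in> P. j \<in> G \<and> i \<notin> G}"
    using lin_diff_subset[OF assms, of "{G \<in> P. i \<in> G \<and> j \<in> G}" j] by (simp cong: conj_cong)
  ultimately have "(lin P i - sum Var {G \<in> P. i \<in> G \<and> j \<in> G})
      - (lin P j - sum Var {G \<in> P. i \<in> G \<and> j \<in> G})
    = sum Var {G \<in> P. i \<in> G \<and> j \<notin> G} - sum Var {G \<in> P. j \<in> G \<and> i \<notin> G}"
    by (simp only:)
  then show ?thesis
    by (simp only: diff_diff_eq2 diff_add_cancel)
qed

lemma relsE:
  assumes "x \<in> rels M Z P"
  obtains (incomparable) G H where "x = Var G * Var H" "G \<in> P" "H \<in> P" "\<not> G \<subseteq> H" "\<not> H \<subseteq> G"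
    | (lin_Var) i G where "x = lin P i * Var G" "i \<in> gset M" "G \<in> P" "i \<notin> G"
    | (basis) I G where "x = prod (lin P) I" "G \<in> P" "rel_basis M Z G I"
  using assms unfolding rels_def
  by (elim UnE CollectE exE conjE)
    ((rule that(1); assumption), (rule that(2); assumption), (rule that(3); assumption))

lemma rels_in_polys: "rels M Z P \<subseteq> polys P"
  unfolding rels_def
  using lin_in_polys[of P] prod_lin_in_polys[of P] Var_in_polys[of _ P] subring_mult[OF subring_polys[of P]]
  by auto

lemma ideal_in_self: "subring S \<Longrightarrow> ideal_in S S"
  by (simp add: ideal_in_def subringD)

lemma ideal_fy: "ideal_in (polys P) (fy_ideal M Z P)"
  unfolding fy_ideal_def by (rule ideal_in_idl[OF subring_polys])

lemma ideal_link: "ideal_in (polys P) (link_ideal M Z P F)"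
  unfolding link_ideal_def by (rule ideal_in_idl[OF subring_polys])

lemma link_in_polys: "link_ideal M Z P F \<subseteq> polys P"
  unfolding link_ideal_def
  by (rule idl_subset[OF ideal_in_self[OF subring_polys]])
    (use rels_in_polys[of M Z P] lin_in_polys[of P] Var_in_polys[of _ P] in auto)

lemma
  shows fy_incomparable: "G \<in> P \<Longrightarrow> H \<in> P \<Longrightarrow> \<not> G \<subseteq> H \<Longrightarrow> \<not> H \<subseteq> G \<Longrightarrow> Var G * Var H \<in> fy_ideal M Z P"
    and fy_lin_Var: "i \<in> gset M \<Longrightarrow> G \<in> P \<Longrightarrow> i \<notin> G \<Longrightarrow> lin P i * Var G \<in> fy_ideal M Z P"
    and fy_basis: "G \<in> P \<Longrightarrow> rel_basis M Z G I \<Longrightarrow> prod (lin P) I \<in> fy_ideal M Z P"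
  unfolding fy_ideal_def rels_def by (blast intro: idl_base[OF subring_polys])+

lemma fy_subset_link: "fy_ideal M Z P \<subseteq> link_ideal M Z P F"
  unfolding fy_ideal_def
proof (rule idl_subset[OF ideal_link], rule subsetI)
  fix x assume "x \<in> rels M Z P"
  then show "x \<in> link_ideal M Z P F"
    unfolding link_ideal_def by (intro idl_base[OF subring_polys]) blast
qed

lemma
  shows link_Var: "G \<in> P \<Longrightarrow> \<not> F \<subseteq> G \<Longrightarrow> Var G \<in> link_ideal M Z P F"
    and link_lin: "i \<in> gset M \<Longrightarrow> i \<notin> F \<Longrightarrow> lin P i \<in> link_ideal M Z P F"
  unfolding link_ideal_def by (blast intro: idl_base[OF subring_polys])+

text \<open>The colon ideal of \<open>J\<close> by \<open>q\<close>. With \<open>idl_subset\<close>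
  it reduces \<open>q * a \<in> J\<close>, for all \<open>a\<close> in a generated ideal, to the
  generators. The smaller ring \<open>T\<close> admits ideals over fewer variables.\<close>

lemma ideal_colon:
  assumes S: "T \<subseteq> S" and J: "ideal_in S J"
  shows "ideal_in T {a. q * a \<in> J}"
  unfolding ideal_in_def
proof (intro conjI ballI; unfold mem_Collect_eq)
  show "q * 0 \<in> J" using ideal_0[OF J] by simp
  show "q * (a + b) \<in> J" if "q * a \<in> J" "q * b \<in> J" for a b
    using ideal_add[OF J that] by (simp add: distrib_left)
  show "q * (s * a) \<in> J" if "s \<in> T" "q * a \<in> J" for s a
    using ideal_mult[OF J _ that(2), of s] that(1) S by (auto simp: mult.left_commute)
qed

lemma ideal_in_mono: "T \<subseteq> S \<Longrightarrow> ideal_in S J \<Longrightarrow> ideal_in T J"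
  by (auto simp: ideal_in_def)

section \<open>Products of linear forms along relative bases\<close>

lemma prod_lin_remove: "finite I \<Longrightarrow> i \<in> I \<Longrightarrow> prod (lin P) I = lin P i * prod (lin P) (I - {i})"
  by (rule prod.remove)

text \<open>A single factor \<open>lin P i\<close> with \<open>i \<in> I - G\<close> annihilates
  \<open>Var G\<close>.\<close>

lemma fy_prod_lin_Var:
  assumes "finite I" "I \<subseteq> gset M" "G \<in> P" "\<not> I \<subseteq> G"
  shows "prod (lin P) I * Var G \<in> fy_ideal M Z P"
proof -
  obtain i where i: "i \<in> I" "i \<notin> G" using assms(4) by blast
  have "prod (lin P) (I - {i}) * (lin P i * Var G) \<in> fy_ideal M Z P"
    using i assms(2,3) by (intro ideal_mult[OF ideal_fy] prod_lin_in_polys fy_lin_Var) auto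
  then show ?thesis
    by (simp add: prod_lin_remove[OF assms(1) i(1)] mult_ac)
qed

lemma rel_basis_finite: "matroid M \<Longrightarrow> rel_basis M Z F I \<Longrightarrow> F \<in> flats M \<Longrightarrow> finite I"
  by (rule finite_subset[OF _ finite_flat]) (auto simp: rel_basis_def)

text \<open>If \<open>I\<close> were inside \<open>F\<close>, then \<open>F\<close> would contain
  \<open>G\<close> and so belong to the filter.\<close>

lemma rel_basis_not_subset:
  assumes M: "matroid M" and P: "flat_filter M Z P" and F: "F \<in> flats M" "Z \<subseteq> F" "F \<notin> P"
    and G: "G \<in> P" "rel_basis M Z G I"
  obtains j where "j \<in> I" "j \<notin> F" "j \<in> gset M"
proof -
  have G': "G \<in> flats M" "Z \<subseteq> G"
    using P G(1) by (auto simp: flat_filter_def)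
  have IG: "I \<subseteq> G" "rk M (Z \<union> I) = rk M G"
    using G(2) by (simp_all add: rel_basis_def)
  have "\<not> I \<subseteq> F"
  proof
    assume "I \<subseteq> F"
    then have "G \<subseteq> F"
      using subset_flat_if_spanned[OF M F(1) _ _ flat_subset[OF G'(1)] IG(2)] F(2) G'(2) IG(1) by blast
    then show False
      using P F(1,3) G(1) unfolding flat_filter_def by blast
  qed
  then show ?thesis
    using that IG(1) flat_subset[OF G'(1)] by blast
qed

text \<open>The difference is \<open>lin P i - lin P j\<close> times the product over
  \<open>I - {i}\<close>, so only flats containing exactly one of \<open>i\<close> and
  \<open>j\<close> occur. Such a flat cannot contain \<open>I - {i}\<close>: it would contain one of
  the two bases, hence \<open>F\<close>, hence both \<open>i\<close> and \<open>j\<close>. The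
  product therefore annihilates its variable.\<close>

lemma prod_lin_basis_exchange_step:
  assumes M: "matroid M" and P: "flat_filter M Z P" and F: "F \<in> flats M" "Z \<subseteq> F"
    and I: "rel_basis M Z F I" and I': "rel_basis M Z F (insert j (I - {i}))"
    and i: "i \<in> I" and j: "j \<notin> I"
  shows "prod (lin P) I - prod (lin P) (insert j (I - {i})) \<in> fy_ideal M Z P"
proof -
  let ?Q = "prod (lin P) (I - {i})"
  have fin: "finite I" by (rule rel_basis_finite[OF M I F(1)])
  have finP: "finite P"
    by (rule finite_subset[OF _ finite_flats[OF M]]) (use P in \<open>auto simp: flat_filter_def\<close>)
  have IF: "I \<subseteq> F" "j \<in> F" "rk M (Z \<union> I) = rk M F" "rk M (Z \<union> insert j (I - {i})) = rk M F"
    using I I' unfolding rel_basis_def by blast+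
  have IE: "I - {i} \<subseteq> gset M"
    using IF(1) flat_subset[OF F(1)] by blast
  have kill: "?Q * Var G \<in> fy_ideal M Z P" if G: "G \<in> P" "i \<in> G \<and> j \<notin> G \<or> j \<in> G \<and> i \<notin> G" for G
  proof -
    have fG: "G \<in> flats M" "Z \<subseteq> G" using G(1) P by (auto simp: flat_filter_def)
    have sub: "F \<subseteq> G" if "I \<subseteq> G \<or> insert j (I - {i}) \<subseteq> G"
      using that
    proof
      assume "I \<subseteq> G"
      show ?thesis
        by (rule subset_flat_if_spanned[OF M fG(1) _ _ flat_subset[OF F(1)] IF(3)])
          (use \<open>I \<subseteq> G\<close> fG(2) F(2) IF(1) in auto)
    next
      assume "insert j (I - {i}) \<subseteq> G"
      show ?thesis
        by (rule subset_flat_if_spanned[OF M fG(1) _ _ flat_subset[OF F(1)] IF(4)])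
          (use \<open>insert j (I - {i}) \<subseteq> G\<close> fG(2) F(2) IF(1,2) in auto)
    qed
    have "\<not> I - {i} \<subseteq> G"
    proof
      assume *: "I - {i} \<subseteq> G"
      then have "I \<subseteq> G \<or> insert j (I - {i}) \<subseteq> G"
        using G(2) by auto
      then have "F \<subseteq> G" by (rule sub)
      then show False using G(2) IF(1,2) i by auto
    qed
    then show ?thesis
      using fin IE G(1) by (intro fy_prod_lin_Var) auto
  qed
  have sums: "?Q * sum Var A \<in> fy_ideal M Z P"
    if "\<And>G. G \<in> A \<Longrightarrow> ?Q * Var G \<in> fy_ideal M Z P" for A
    unfolding sum_distrib_left by (rule ideal_sum[OF ideal_fy that])
  have "prod (lin P) (insert j (I - {i})) = lin P j * ?Q"
    using fin j by simp
  then have "prod (lin P) I - prod (lin P) (insert j (I - {i})) = ?Q * (lin P i - lin P j)"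
    unfolding prod_lin_remove[OF fin i] by (simp add: algebra_simps)
  also have "\<dots> = ?Q * sum Var {G \<in> P. i \<in> G \<and> j \<notin> G} - ?Q * sum Var {G \<in> P. j \<in> G \<and> i \<notin> G}"
    by (simp only: lin_diff[OF finP] right_diff_distrib)
  also have "\<dots> \<in> fy_ideal M Z P"
    by (rule ideal_diff[OF subring_polys ideal_fy]; rule sums) (auto intro: kill)
  finally show ?thesis .
qed

text \<open>Each exchange moves \<open>I\<close> one element closer to \<open>I'\<close>. The flat
  \<open>F\<close> may lie outside \<open>P\<close>, and that is the case used for the
  blow-up.\<close>

lemma prod_lin_basis_exchange:
  assumes M: "matroid M" and P: "flat_filter M Z P" and F: "F \<in> flats M" "Z \<subseteq> F"
    and I: "rel_basis M Z F I" and I': "rel_basis M Z F I'"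
  shows "prod (lin P) I - prod (lin P) I' \<in> fy_ideal M Z P"
  using I
proof (induction "card (I - I')" arbitrary: I rule: less_induct)
  case less
  have fin: "finite I" "finite I'"
    by (rule rel_basis_finite[OF M less.prems F(1)], rule rel_basis_finite[OF M I' F(1)])
  have cards: "card I = card I'"
    using less.prems I' by (simp add: rel_basis_def)
  show ?case
  proof (cases "I \<subseteq> I'")
    case True
    then have "I = I'" by (rule card_subset_eq[OF fin(2) _ cards])
    then show ?thesis by (simp add: ideal_0[OF ideal_fy])
  next
    case False
    then obtain i where i: "i \<in> I" "i \<notin> I'" by blast
    from rel_basis_exchange[OF M less.prems I' F(1) i] obtain j where
      j: "j \<in> I'" "j \<notin> I" "rel_basis M Z F (insert j (I - {i}))" .
    have "insert j (I - {i}) - I' = I - I' - {i}"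
      using j(1) by auto
    then have "insert j (I - {i}) - I' \<subset> I - I'"
      using i by auto
    then have "card (insert j (I - {i}) - I') < card (I - I')"
      using fin by (intro psubset_card_mono) auto
    from less.hyps[OF this j(3)]
    have "(prod (lin P) I - prod (lin P) (insert j (I - {i})))
       + (prod (lin P) (insert j (I - {i})) - prod (lin P) I') \<in> fy_ideal M Z P"
      by (rule ideal_add[OF ideal_fy prod_lin_basis_exchange_step[OF M P F less.prems j(3) i(1) j(2)]])
    then show ?thesis by simp
  qed
qed

text \<open>The inclusion \<open>p(0) K \<subseteq> I\<close>, checked on generators of
  \<open>K\<close>. A flat not above \<open>F\<close> misses an element of \<open>I\<close>, so its
  variable is annihilated. For \<open>i \<notin> F\<close>, adding \<open>i\<close> to
  \<open>I\<close> gives a basis of the closure of \<open>insert i F\<close>, which lies in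
  \<open>P\<close>.\<close>

lemma prod_lin_mult_link:
  assumes M: "matroid M" and P: "flat_filter M Z P" and F: "F \<in> flats M" "Z \<subset> F" "F \<notin> P"
    and above: "\<And>H. H \<in> flats M \<Longrightarrow> F \<subset> H \<Longrightarrow> H \<in> P"
    and I: "rel_basis M Z F I" and a: "a \<in> link_ideal M Z P F"
  shows "prod (lin P) I * a \<in> fy_ideal M Z P"
proof -
  have fin: "finite I" by (rule rel_basis_finite[OF M I F(1)])
  have IF: "I \<subseteq> F" "rk M (Z \<union> I) = rk M F" "rk M F = rk M Z + card I"
    using I by (simp_all add: rel_basis_def)
  have FE: "F \<subseteq> gset M" by (rule flat_subset[OF F(1)])
  have "link_ideal M Z P F \<subseteq> {a. prod (lin P) I * a \<in> fy_ideal M Z P}"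
    unfolding link_ideal_def
  proof (rule idl_subset[OF ideal_colon[OF order_refl ideal_fy]], rule subsetI, unfold mem_Collect_eq)
    fix x assume "x \<in> rels M Z P \<union> {Var G |G. G \<in> P \<and> \<not> F \<subseteq> G} \<union> {lin P i |i. i \<in> gset M - F}"
    then consider "x \<in> rels M Z P" | G where "x = Var G" "G \<in> P" "\<not> F \<subseteq> G"
      | i where "x = lin P i" "i \<in> gset M" "i \<notin> F" by blast
    then show "prod (lin P) I * x \<in> fy_ideal M Z P"
    proof cases
      case 1
      then have "x \<in> fy_ideal M Z P"
        unfolding fy_ideal_def by (rule idl_base[OF subring_polys])
      then show ?thesis by (rule ideal_mult[OF ideal_fy prod_lin_in_polys])
    next
      case (2 G)
      have G: "G \<in> flats M" "Z \<subseteq> G" using 2 P by (auto simp: flat_filter_def)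
      have "\<not> I \<subseteq> G"
        using subset_flat_if_spanned[OF M G(1) _ _ FE IF(2)] G(2) F(2) IF(1) 2(3) by blast
      then show ?thesis
        unfolding 2(1) using fin IF(1) FE 2(2) by (intro fy_prod_lin_Var) auto
    next
      case (3 i)
      let ?A = "insert i F"
      let ?H = "closure M ?A"
      have A: "?A \<subseteq> gset M" using 3 FE by blast
      have H: "F \<subset> ?H" "i \<in> ?H" using subset_closure[OF M A] 3(3) by blast+
      have "?H \<in> P" by (rule above[OF closure_in_flats[OF M A] H(1)])
      moreover have "rel_basis M Z ?H (insert i I)"
      proof -
        have iI: "i \<notin> I" using IF(1) 3(3) by blast
        have r: "rk M ?H = rk M F + 1"
          using rk_closure[OF M A] flat_insert[OF M F(1) 3(2,3)] by simp
        have "rk M (insert i (Z \<union> I)) \<noteq> rk M (Z \<union> I)"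
        proof
          assume "rk M (insert i (Z \<union> I)) = rk M (Z \<union> I)"
          then have "rk M ?A = rk M F"
            using rk_insert_mono[OF M, of "Z \<union> I" F i] F(2) IF(1) by blast
          then show False using flat_insert[OF M F(1) 3(2,3)] by simp
        qed
        then have "rk M (insert i (Z \<union> I)) = rk M (Z \<union> I) + 1"
          using rk_insert_le[OF M, of i "Z \<union> I"] rk_insert_ge[OF M, of "Z \<union> I" i] by linarith
        then show ?thesis
          using iI fin r IF H by (auto simp: rel_basis_def)
      qed
      ultimately have "prod (lin P) (insert i I) \<in> fy_ideal M Z P" by (rule fy_basis)
      moreover have "i \<notin> I" using IF(1) 3(3) by blast
      ultimately show ?thesis
        unfolding 3(1) using fin by (simp add: mult.commute)
    qed
  qed
  then show ?thesis using a by blast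
qed

text \<open>Setting all variables not strictly above \<open>F\<close> to zero carries
  \<open>?K\<close> into \<open>?I\<close>, fixes \<open>polys Q\<close>, and changes a polynomial
  only modulo \<open>?K\<close>. With \<open>?I \<subseteq> ?K\<close> the two quotients agree, and
  \<open>C\<close> serves for both.\<close>

lemma monomial_basis_link:
  assumes M: "matroid M" and P: "flat_filter M Z P" and F: "F \<in> flats M" "Z \<subset> F" "F \<notin> P"
  defines "Q \<equiv> {G \<in> flats M. F \<subset> G}"
  assumes QP: "Q \<subseteq> P"
    and C: "monomial_basis (polys Q) (fy_ideal M F Q) C" "\<And>m. m \<in> C \<Longrightarrow> set_mset m \<subseteq> Q"
  shows "monomial_basis (polys P) (link_ideal M Z P F) C"
proof -
  let ?K = "link_ideal M Z P F" and ?I = "fy_ideal M F Q"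
  let ?g = "\<lambda>G. if F \<subset> G then Var G else 0"
  have finP: "finite P"
    by (rule finite_subset[OF _ finite_flats[OF M]]) (use P in \<open>auto simp: flat_filter_def\<close>)
  have PF: "P \<subseteq> flats M" using P by (auto simp: flat_filter_def)
  have above: "F \<subset> G \<longleftrightarrow> F \<subseteq> G" if "G \<in> P" for G
    using that F(3) by blast
  have mem_Q: "G \<in> Q \<longleftrightarrow> F \<subset> G" if "G \<in> P" for G
    using that PF by (auto simp: Q_def)
  have gQ: "?g G \<in> polys Q" if "G \<in> P" for G
    using mem_Q[OF that] by (auto intro: Var_in_polys subring_0[OF subring_polys])
  have proj_lin: "ev ?g (lin P i) = lin Q i" for i
  proof -
    have "ev ?g (lin P i) = (\<Sum>G\<in>{G \<in> P. i \<in> G}. ?g G)"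
      unfolding lin_def by (simp add: ev_sum)
    also have "\<dots> = (\<Sum>G\<in>{G \<in> Q. i \<in> G}. Var G)"
      by (rule sum.mono_neutral_cong_right) (use finP QP mem_Q in auto)
    finally show ?thesis by (simp add: lin_def)
  qed
  \<comment> \<open>The two forms differ by variables of flats that do not contain
    \<open>F\<close>.\<close>
  have lin_Q_K: "lin Q i \<in> ?K" if i: "i \<in> gset M" "i \<notin> F" for i
  proof -
    have "lin P i - lin Q i = sum Var {G \<in> P. i \<in> G \<and> G \<notin> {G \<in> Q. i \<in> G}}"
      unfolding lin_def[of Q] using finP QP by (intro lin_diff_subset) auto
    also have "\<dots> \<in> ?K"
      using mem_Q above by (intro ideal_sum[OF ideal_link] link_Var) auto
    finally have "lin P i - (lin P i - lin Q i) \<in> ?K"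
      by (rule ideal_diff[OF subring_polys ideal_link link_lin[OF i]])
    then show ?thesis by simp
  qed
  \<comment> \<open>Over \<open>F\<close>, the singleton \<open>{i}\<close> is a basis of the
    closure of \<open>insert i F\<close>, so the form is itself a basis relation.\<close>
  have lin_Q_I: "lin Q i \<in> ?I" if i: "i \<in> gset M" "i \<notin> F" for i
  proof -
    let ?A = "insert i F"
    have A: "?A \<subseteq> gset M" using i flat_subset[OF F(1)] by blast
    have "closure M ?A \<in> Q"
      using closure_in_flats[OF M A] subset_closure[OF M A] i by (auto simp: Q_def)
    moreover have "rel_basis M F (closure M ?A) {i}"
      using rk_closure[OF M A] subset_closure[OF M A] flat_insert[OF M F(1) i]
      by (auto simp: rel_basis_def)
    ultimately have "prod (lin Q) {i} \<in> ?I" by (rule fy_basis)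
    then show ?thesis by simp
  qed
  have polys_QP: "polys Q \<subseteq> polys P" by (rule polys_mono[OF QP])
  have IK: "?I \<subseteq> ?K"
    unfolding fy_ideal_def
  proof (rule idl_subset[OF ideal_in_mono[OF polys_QP ideal_link]], rule subsetI)
    fix x assume "x \<in> rels M F Q"
    then show "x \<in> ?K"
    proof (cases rule: relsE)
      case 1: (incomparable G H)
      then show ?thesis
        using fy_incomparable[of G P H M Z] fy_subset_link[of M Z P F] QP by blast
    next
      case 2: (lin_Var i G)
      then have "i \<notin> F" by (auto simp: Q_def)
      then have "lin Q i \<in> ?K" by (rule lin_Q_K[OF 2(2)])
      then show ?thesis
        unfolding 2(1) using 2(3) QP by (intro ideal_mult'[OF ideal_link] Var_in_polys) auto
    next
      case 3: (basis I G)
      have G: "G \<in> flats M" "F \<subset> G" using 3(2) by (auto simp: Q_def)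
      have fin: "finite I" by (rule rel_basis_finite[OF M 3(3) G(1)])
      have "rk M F < rk M G" by (rule flat_rk_less[OF M F(1) flat_subset[OF G(1)] G(2)])
      \<comment> \<open>With \<open>I \<subseteq> F\<close> the rank of \<open>F \<union> I\<close>
        would still be that of \<open>F\<close>, which is below that of \<open>G\<close>.\<close>
      then have "I \<noteq> {}" "\<not> I \<subseteq> F"
        using 3(3) by (auto simp: rel_basis_def Un_absorb2)
      then obtain i where i: "i \<in> I" "i \<notin> F" by blast
      have "i \<in> gset M" using i(1) 3(3) flat_subset[OF G(1)] by (auto simp: rel_basis_def)
      then have "lin Q i \<in> ?K" using i(2) by (rule lin_Q_K)
      then show ?thesis
        unfolding 3(1) prod_lin_remove[OF fin i(1)]
        using prod_lin_in_polys[of Q] polys_QP by (intro ideal_mult'[OF ideal_link]) auto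
    qed
  qed
  have proj_poly: "ev ?g s \<in> polys Q" if "s \<in> polys P" for s
    by (rule ev_polys[OF that gQ])
  \<comment> \<open>The preimage of \<open>?I\<close> is an ideal, so it suffices to substitute into
    the generators.\<close>
  have "ideal_in (polys P) {a. ev ?g a \<in> ?I}"
    unfolding ideal_in_def
  proof (intro conjI ballI; unfold mem_Collect_eq)
    show "ev ?g 0 \<in> ?I" by (simp add: ideal_0[OF ideal_fy])
    show "ev ?g (a + b) \<in> ?I" if "ev ?g a \<in> ?I" "ev ?g b \<in> ?I" for a b
      unfolding ev_add by (rule ideal_add[OF ideal_fy that])
    show "ev ?g (s * a) \<in> ?I" if "s \<in> polys P" "ev ?g a \<in> ?I" for s a
      unfolding ev_mult by (rule ideal_mult[OF ideal_fy proj_poly[OF that(1)] that(2)])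
  qed
  then have "?K \<subseteq> {a. ev ?g a \<in> ?I}"
    unfolding link_ideal_def
  proof (rule idl_subset, intro subsetI, unfold mem_Collect_eq)
    fix x assume "x \<in> rels M Z P \<union> {Var G |G. G \<in> P \<and> \<not> F \<subseteq> G} \<union> {lin P i |i. i \<in> gset M - F}"
    then consider (rels) "x \<in> rels M Z P" | (Var) G where "x = Var G" "G \<in> P" "\<not> F \<subseteq> G"
      | (lin) i where "x = lin P i" "i \<in> gset M" "i \<notin> F"
      by blast
    then show "ev ?g x \<in> ?I"
    proof cases
      case rels
      then show ?thesis
      proof (cases rule: relsE)
      case 1: (incomparable G H)
      have eq: "ev ?g x = ?g G * ?g H" unfolding 1(1) ev_mult by simp
      show ?thesis
      proof (cases "F \<subset> G \<and> F \<subset> H")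
        case True
        then show ?thesis
          unfolding eq using fy_incomparable[of G Q H M F] 1 mem_Q[OF 1(2)] mem_Q[OF 1(3)] by simp
      next
        case False
        then have "ev ?g x = 0" unfolding eq by auto
        then show ?thesis by (simp add: ideal_0[OF ideal_fy])
      qed
    next
      case 2: (lin_Var i G)
      have eq: "ev ?g x = lin Q i * ?g G" unfolding 2(1) ev_mult proj_lin by simp
      show ?thesis
      proof (cases "F \<subset> G")
        case True
        then show ?thesis
          unfolding eq using fy_lin_Var[of i M G Q F] 2 mem_Q[OF 2(3)] by simp
      qed (simp add: eq ideal_0[OF ideal_fy])
    next
      case 3: (basis I G)
      have fin: "finite I" using rel_basis_finite[OF M 3(3)] 3(2) PF by blast
      obtain j where j: "j \<in> I" "j \<notin> F" "j \<in> gset M"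
        by (rule rel_basis_not_subset[OF M P F(1) _ F(3) 3(2,3)]) (use F(2) in auto)
      have "ev ?g x = lin Q j * prod (lin Q) (I - {j})"
        unfolding 3(1) ev_prod proj_lin by (rule prod_lin_remove[OF fin j(1)])
      then show ?thesis
        by (simp add: ideal_mult'[OF ideal_fy prod_lin_in_polys lin_Q_I[OF j(3,2)]])
      qed
    next
      case 4: (Var G)
      then have "ev ?g x = 0" using above[OF 4(2)] by simp
      then show ?thesis by (simp add: ideal_0[OF ideal_fy])
    next
      case 5: (lin i)
      then show ?thesis by (simp add: proj_lin lin_Q_I)
    qed
  qed
  then have proj_K: "ev ?g a \<in> ?I" if "a \<in> ?K" for a
    using that by blast
  show ?thesis
    unfolding monomial_basis_def
  proof (intro conjI ballI allI impI)
    fix s assume s: "s \<in> polys P"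
    obtain r where r: "keys r \<subseteq> C" "ev ?g s - r \<in> ?I"
      using C(1) proj_poly[OF s] unfolding monomial_basis_def by blast
    \<comment> \<open>The variables set to zero all lie in \<open>?K\<close>.\<close>
    have "ev Var s - ev ?g s \<in> ?K"
    proof (rule ev_cong_ideal[OF ideal_link s])
      fix G assume G: "G \<in> P"
      show "Var G \<in> polys P" by (rule Var_in_polys[OF G])
      show "?g G \<in> polys P" using gQ[OF G] polys_QP by blast
      show "Var G - ?g G \<in> ?K"
        using above[OF G] link_Var[OF G, of F] by (auto simp: ideal_0[OF ideal_link])
    qed
    then have "s - ev ?g s \<in> ?K"
      using ev_eq_self[OF s, of Var] by simp
    then have "(s - ev ?g s) + (ev ?g s - r) \<in> ?K"
      using r(2) IK by (intro ideal_add[OF ideal_link]) auto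
    then show "\<exists>r. keys r \<subseteq> C \<and> s - r \<in> ?K"
      using r(1) by (intro exI[of _ r]) simp
  next
    fix r assume r: "keys r \<subseteq> C" "r \<in> ?K"
    have "r \<in> polys Q" using r(1) C(2) by (auto simp: polys_def)
    then have "ev ?g r = r" by (rule ev_eq_self) (simp add: Q_def)
    then have "r \<in> ?I" using proj_K[OF r(2)] by simp
    then show "r = 0" using C(1) r(1) by (simp add: monomial_basis_def)
  qed
qed

section \<open>One blow-up: adjoining a maximal flat outside the filter\<close>

lemma monic_linear_prod:
  fixes a :: "'b \<Rightarrow> 'r::comm_ring_1"
  assumes "finite I"
  shows "coeff (\<Prod>i\<in>I. [:a i, 1:]) (card I) = 1 \<and> (\<forall>k>card I. coeff (\<Prod>i\<in>I. [:a i, 1:]) k = 0)"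
  using assms
proof (induction I rule: finite_induct)
  case (insert i I)
  let ?q = "\<Prod>i\<in>I. [:a i, 1:]"
  have "(\<Prod>i\<in>insert i I. [:a i, 1:]) = smult (a i) ?q + pCons 0 ?q"
    using insert.hyps by simp
  then show ?case
    using insert.IH insert.hyps by (auto simp: coeff_pCons split: nat.split)
qed (auto simp: coeff_1)

lemma coeff_0_prod: "coeff (\<Prod>i\<in>I. f i) 0 = (\<Prod>i\<in>I. coeff (f i) 0)"
  by (simp add: poly_0_coeff_0[symmetric] poly_prod)

context
  fixes M :: "'a matroid" and Z F :: "'a set" and P :: "'a set set" and I0 :: "'a set"
  assumes M: "matroid M" and P: "flat_filter M Z P" and F: "F \<in> flats M" "Z \<subset> F" "F \<notin> P"
    and above: "\<And>H. H \<in> flats M \<Longrightarrow> F \<subset> H \<Longrightarrow> H \<in> P"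
    and I0: "rel_basis M Z F I0"
begin

text \<open>\<open>LK\<close> and \<open>FI\<close> take the places of \<open>K\<close> and
  \<open>I\<close> in \<open>monomial_basis_adjoin\<close>.\<close>

abbreviation (input) "LK \<equiv> link_ideal M Z P F"
abbreviation (input) "FI \<equiv> fy_ideal M Z P"

text \<open>The monic polynomial \<open>p\<close> of the opening text. Its value at
  \<open>Var F\<close> is the basis relation of \<open>F\<close> for the enlarged filter.\<close>

definition min_poly :: "'a set mpoly poly" where
  "min_poly = (\<Prod>i\<in>I0. [:lin P i, 1:])"

text \<open>The ideal \<open>I + t K[t]\<close>, the part of the new ideal that does not come from
  \<open>min_poly\<close>.\<close>

definition upper_part :: "'a set mpoly poly set" where
  "upper_part = {w \<in> coeffs_in (link_ideal M Z P F). coeff w 0 \<in> fy_ideal M Z P}"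

lemma finite_filter: "finite P"
  by (rule finite_subset[OF _ finite_flats[OF M]]) (use P in \<open>auto simp: flat_filter_def\<close>)

lemma min_poly_coeffs: "min_poly \<in> coeffs_in (polys P)"
  unfolding min_poly_def
  by (rule subring_prod[OF subring_coeffs_in[OF subring_polys]], intro pCons_coeffs_in lin_in_polys)
    (auto simp: coeffs_in_def subring_0[OF subring_polys] subring_1[OF subring_polys])

lemma upper_part_ideal: "ideal_in (coeffs_in (polys P)) upper_part"
  unfolding ideal_in_def upper_part_def
proof (intro conjI ballI; unfold mem_Collect_eq)
  note K = ideal_coeffs_in[OF ideal_link[of P M Z F]]
  show "0 \<in> coeffs_in LK \<and> coeff 0 0 \<in> FI"
    by (simp add: ideal_0[OF K] ideal_0[OF ideal_fy])
  show "a + b \<in> coeffs_in LK \<and> coeff (a + b) 0 \<in> FI"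
    if "a \<in> coeffs_in LK \<and> coeff a 0 \<in> FI" "b \<in> coeffs_in LK \<and> coeff b 0 \<in> FI" for a b
    using that ideal_add[OF K, of a b] ideal_add[OF ideal_fy[of P M Z], of "coeff a 0" "coeff b 0"] by auto
  show "s * a \<in> coeffs_in LK \<and> coeff (s * a) 0 \<in> FI"
    if "s \<in> coeffs_in (polys P)" "a \<in> coeffs_in LK \<and> coeff a 0 \<in> FI" for s a
    using that ideal_mult[OF K, of s a] ideal_mult[OF ideal_fy[of P M Z] coeffs_inD[of s "polys P" 0], of "coeff a 0"]
    by (auto simp: coeff_mult)
qed

text \<open>The new forms become linear polynomials in \<open>t\<close>, whose slope records
  membership in \<open>F\<close>.\<close>

lemma lin_step: "lin (insert F P) i = poly [:lin P i, of_bool (i \<in> F):] (Var F)"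
  using lin_insert[OF finite_filter F(3)] by simp

lemma pCons_upper: "a \<in> FI \<Longrightarrow> b \<in> LK \<Longrightarrow> [:a, b:] \<in> upper_part"
  unfolding upper_part_def using fy_subset_link[of M Z P F]
  by (auto simp: coeffs_in_def coeff_pCons ideal_0[OF ideal_link] split: nat.split)

text \<open>Some \<open>j \<in> I\<close> lies outside \<open>F\<close>; its factor is the constant
  polynomial \<open>lin P j\<close> in \<open>K\<close>, which puts the whole product into
  \<open>K[t]\<close>. The constant coefficient is an old basis relation.\<close>

lemma basis_above_upper:
  assumes G: "G \<in> P" "rel_basis M Z G I"
  shows "(\<Prod>i\<in>I. [:lin P i, of_bool (i \<in> F):]) \<in> upper_part"
proof -
  let ?f = "\<lambda>i. [:lin P i, of_bool (i \<in> F):]"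
  have fin: "finite I"
    using P G(1) by (intro rel_basis_finite[OF M G(2)]) (auto simp: flat_filter_def)
  obtain j where j: "j \<in> I" "j \<notin> F" "j \<in> gset M"
    by (rule rel_basis_not_subset[OF M P F(1) _ F(3) G]) (use F(2) in auto)
  have S: "subring (coeffs_in (polys P))" by (rule subring_coeffs_in[OF subring_polys])
  have K: "ideal_in (coeffs_in (polys P)) (coeffs_in LK)" by (rule ideal_coeffs_in[OF ideal_link])
  have "?f i \<in> coeffs_in (polys P)" for i
    by (intro pCons_coeffs_in lin_in_polys)
      (auto simp: coeffs_in_def subring_0[OF subring_polys] subring_1[OF subring_polys])
  then have "prod ?f (I - {j}) \<in> coeffs_in (polys P)"
    by (intro subring_prod[OF S])
  moreover have "?f j \<in> coeffs_in LK"
    using j link_lin[of j M F P Z]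
    by (auto simp: coeffs_in_def coeff_pCons ideal_0[OF ideal_link] split: nat.split)
  ultimately have "?f j * prod ?f (I - {j}) \<in> coeffs_in LK"
    by (intro ideal_mult'[OF K])
  moreover have "?f j * prod ?f (I - {j}) = prod ?f I"
    by (rule prod.remove[OF fin j(1), symmetric])
  moreover have "coeff (prod ?f I) 0 \<in> FI"
    unfolding coeff_0_prod using fy_basis[OF G] by simp
  ultimately show ?thesis
    by (simp add: upper_part_def)
qed

text \<open>Modulo \<open>K\<close> every form \<open>lin P i\<close> with \<open>i \<in> F\<close>
  is congruent to the same sum \<open>h\<close> of variables above \<open>F\<close>, so both
  products are congruent to a power of \<open>h + t\<close>. The constant coefficients agree modulo
  \<open>I\<close> by basis exchange.\<close>

lemma basis_diff_upper:
  assumes I: "rel_basis M Z F I"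
  shows "(\<Prod>i\<in>I. [:lin P i, 1:]) - min_poly \<in> upper_part"
proof -
  let ?f = "\<lambda>i. [:lin P i, 1:]"
  define h where "h = sum Var {G \<in> P. F \<subseteq> G}"
  have S: "subring (coeffs_in (polys P))" by (rule subring_coeffs_in[OF subring_polys])
  have K: "ideal_in (coeffs_in (polys P)) (coeffs_in LK)" by (rule ideal_coeffs_in[OF ideal_link])
  have h: "h \<in> polys P"
    unfolding h_def by (rule subring_sum[OF subring_polys]) (auto intro: Var_in_polys)
  have f: "[:a, 1:] \<in> coeffs_in (polys P)" if "a \<in> polys P" for a
    using that by (auto simp: coeffs_in_def coeff_pCons subring_0[OF subring_polys]
        subring_1[OF subring_polys] split: nat.split)
  have red: "prod ?f J - [:h, 1:] ^ card J \<in> coeffs_in LK" if "J \<subseteq> F" for J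
  proof -
    have "prod ?f J - (\<Prod>i\<in>J. [:h, 1:]) \<in> coeffs_in LK"
    proof (rule prod_diff_in_ideal[OF S K])
      fix i assume i: "i \<in> J"
      show "?f i \<in> coeffs_in (polys P)" by (rule f[OF lin_in_polys])
      show "[:h, 1:] \<in> coeffs_in (polys P)" by (rule f[OF h])
      have "lin P i - h = sum Var {G \<in> P. i \<in> G \<and> G \<notin> {G \<in> P. F \<subseteq> G}}"
        unfolding h_def using i that by (intro lin_diff_subset finite_filter) auto
      also have "\<dots> \<in> LK"
        by (intro ideal_sum[OF ideal_link] link_Var) auto
      finally show "?f i - [:h, 1:] \<in> coeffs_in LK"
        by (auto simp: coeffs_in_def coeff_pCons ideal_0[OF ideal_link] split: nat.split)
    qed
    then show ?thesis by simp
  qed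
  have IF: "I \<subseteq> F" "I0 \<subseteq> F" "card I = card I0"
    using I I0 by (simp_all add: rel_basis_def)
  have "(prod ?f I - [:h, 1:] ^ card I) - (prod ?f I0 - [:h, 1:] ^ card I0) \<in> coeffs_in LK"
    by (rule ideal_diff[OF S K red[OF IF(1)] red[OF IF(2)]])
  then have "prod ?f I - min_poly \<in> coeffs_in LK"
    unfolding IF(3) min_poly_def by simp
  moreover have "coeff (prod ?f I - min_poly) 0 \<in> FI"
    unfolding min_poly_def coeff_diff coeff_0_prod
    using prod_lin_basis_exchange[OF M P F(1) _ I I0] F(2) by simp
  ultimately show ?thesis
    by (simp add: upper_part_def)
qed

text \<open>The ideal in the shape demanded by \<open>monomial_basis_adjoin\<close>; the lemmas
  below identify it with the ideal of the enlarged filter.\<close>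

definition step_ideal :: "'a set mpoly set" where
  "step_ideal = {poly (min_poly * u + w) (Var F) | u w. u \<in> coeffs_in (polys P) \<and> w \<in> upper_part}"

lemma step_idealI:
  "u \<in> coeffs_in (polys P) \<Longrightarrow> w \<in> upper_part \<Longrightarrow> poly (min_poly * u + w) (Var F) \<in> step_ideal"
  unfolding step_ideal_def by blast

lemma upper_in_step: "w \<in> upper_part \<Longrightarrow> poly w (Var F) \<in> step_ideal"
  using step_idealI[of 0 w] subring_0[OF subring_coeffs_in[OF subring_polys[of P]]] by simp

lemma ideal_step: "ideal_in (polys (insert F P)) step_ideal"
  unfolding ideal_in_def
proof (intro conjI ballI)
  note S = subring_coeffs_in[OF subring_polys[of P]]
  show "0 \<in> step_ideal"
    using upper_in_step[OF ideal_0[OF upper_part_ideal]] by simp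
  fix b assume "b \<in> step_ideal"
  then obtain u w where b: "b = poly (min_poly * u + w) (Var F)" "u \<in> coeffs_in (polys P)" "w \<in> upper_part"
    unfolding step_ideal_def by blast
  show "a + b \<in> step_ideal" if "a \<in> step_ideal" for a
  proof -
    obtain u' w' where a: "a = poly (min_poly * u' + w') (Var F)" "u' \<in> coeffs_in (polys P)" "w' \<in> upper_part"
      using \<open>a \<in> step_ideal\<close> unfolding step_ideal_def by blast
    have "a + b = poly (min_poly * (u' + u) + (w' + w)) (Var F)"
      unfolding a(1) b(1) by (simp add: algebra_simps)
    also have "\<dots> \<in> step_ideal"
      by (rule step_idealI[OF subring_add[OF S a(2) b(2)] ideal_add[OF upper_part_ideal a(3) b(3)]])
    finally show ?thesis .
  qed
  show "s * b \<in> step_ideal" if "s \<in> polys (insert F P)" for s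
  proof -
    have f: "as_poly F s \<in> coeffs_in (polys P)" by (rule as_poly_coeffs_in[OF that])
    have "s * b = poly (as_poly F s) (Var F) * b" by (simp only: poly_as_poly)
    also have "\<dots> = poly (min_poly * (as_poly F s * u) + as_poly F s * w) (Var F)"
      unfolding b(1) by (simp add: algebra_simps)
    also have "\<dots> \<in> step_ideal"
      by (rule step_idealI[OF subring_mult[OF S f b(2)] ideal_mult[OF upper_part_ideal f b(3)]])
    finally show ?thesis .
  qed
qed

lemma not_below: "G \<in> P \<Longrightarrow> \<not> G \<subseteq> F"
  using P F(1,3) unfolding flat_filter_def by blast

text \<open>Generators with the factor \<open>Var F\<close> fall into \<open>t K\<close>, the
  remaining ones attached to old flats into \<open>I + t K[t]\<close>, and a basis product of
  \<open>F\<close> is \<open>min_poly\<close> up to \<open>upper_part\<close>.\<close>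

lemma fy_insert_subset: "fy_ideal M Z (insert F P) \<subseteq> step_ideal"
  unfolding fy_ideal_def
proof (rule idl_subset[OF ideal_step], rule subsetI)
  fix x assume "x \<in> rels M Z (insert F P)"
  then show "x \<in> step_ideal"
  proof (cases rule: relsE)
    case x: (incomparable G H)
    have *: "Var A * Var F \<in> step_ideal" if "A \<in> P" "\<not> F \<subseteq> A" for A
      using upper_in_step[OF pCons_upper[OF ideal_0[OF ideal_fy] link_Var[OF that]]]
      by (simp add: mult.commute)
    show ?thesis
    proof (cases "G = F \<or> H = F")
      case True
      then show ?thesis
      proof
        assume "G = F"
        then show ?thesis
          unfolding x(1) using *[of H] x(3-5) by (auto simp: mult.commute)
      next
        assume "H = F"
        then show ?thesis
          unfolding x(1) using *[of G] x(2,4,5) by auto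
      qed
    next
      case False
      then have "Var G * Var H \<in> FI"
        using x by (intro fy_incomparable) auto
      from upper_in_step[OF pCons_upper[OF this ideal_0[OF ideal_link]]] show ?thesis
        unfolding x(1) by simp
    qed
  next
    case x: (lin_Var i G)
    show ?thesis
    proof (cases "G = F")
      case True
      then have "lin P i \<in> LK" using x by (intro link_lin) auto
      from upper_in_step[OF pCons_upper[OF ideal_0[OF ideal_fy] this]] show ?thesis
        unfolding x(1) lin_step using True x(4) by (simp add: mult.commute)
    next
      case False
      then have G: "G \<in> P" using x(3) by simp
      have a: "lin P i * Var G \<in> FI" by (rule fy_lin_Var[OF x(2) G x(4)])
      \<comment> \<open>If \<open>i \<in> F\<close> and \<open>i \<notin> G\<close>, then
        \<open>G\<close> is not above \<open>F\<close>.\<close>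
      have b: "of_bool (i \<in> F) * Var G \<in> LK"
        using link_Var[OF G, of F M Z] x(4) by (auto simp: ideal_0[OF ideal_link])
      from upper_in_step[OF pCons_upper[OF a b]] show ?thesis
        unfolding x(1) lin_step by (simp add: algebra_simps)
    qed
  next
    case x: (basis I G)
    have eq: "x = poly (\<Prod>i\<in>I. [:lin P i, of_bool (i \<in> F):]) (Var F)"
      unfolding x(1) poly_prod lin_step ..
    show ?thesis
    proof (cases "G = F")
      case True
      have "(\<Prod>i\<in>I. [:lin P i, of_bool (i \<in> F):]) = (\<Prod>i\<in>I. [:lin P i, 1:])"
        using x(3) True by (intro prod.cong) (auto simp: rel_basis_def)
      then have "x = poly (min_poly * 1 + ((\<Prod>i\<in>I. [:lin P i, 1:]) - min_poly)) (Var F)"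
        unfolding eq by simp
      also have "\<dots> \<in> step_ideal"
        using x(3) True
        by (intro step_idealI subring_1[OF subring_coeffs_in[OF subring_polys]] basis_diff_upper) auto
      finally show ?thesis .
    next
      case False
      then show ?thesis
        unfolding eq using x(2,3) by (intro upper_in_step basis_above_upper[of G]) auto
    qed
  qed
qed

text \<open>Old generators are not literally new ones, since the form of \<open>i \<in> F\<close>
  gains the summand \<open>Var F\<close>. The corrections are multiples of \<open>Var F\<close> that
  vanish by incomparability or against a factor \<open>lin ?P j\<close> with
  \<open>j \<notin> F\<close>.\<close>

lemma fy_subset_insert: "FI \<subseteq> fy_ideal M Z (insert F P)"
proof -
  let ?P = "insert F P" and ?J = "fy_ideal M Z (insert F P)"
  have PP: "polys P \<subseteq> polys ?P" by (rule polys_mono) blast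
  have lin_eq: "lin P i = lin ?P i" if "i \<notin> F" for i
    using that lin_insert[OF finite_filter F(3), of i] by simp
  have VF: "Var F \<in> polys ?P" by (rule Var_in_polys) simp
  show ?thesis
    unfolding fy_ideal_def[of M Z P]
  proof (rule idl_subset[OF ideal_in_mono[OF PP ideal_fy]], rule subsetI)
    fix x assume "x \<in> rels M Z P"
    then show "x \<in> ?J"
    proof (cases rule: relsE)
      case x: (incomparable G H)
      then show ?thesis by (simp add: fy_incomparable)
    next
      case x: (lin_Var i G)
      have 1: "lin ?P i * Var G \<in> ?J" using x by (intro fy_lin_Var) auto
      have 2: "Var F * Var G \<in> ?J" if "i \<in> F"
        using x not_below[of G] that by (intro fy_incomparable) auto
      have "x = lin ?P i * Var G - (if i \<in> F then Var F * Var G else 0)"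
        unfolding x(1) lin_insert[OF finite_filter F(3)] by (simp add: algebra_simps)
      also have "\<dots> \<in> ?J"
        using 1 2 by (auto intro: ideal_diff[OF subring_polys ideal_fy])
      finally show ?thesis .
    next
      case x: (basis I G)
      have fin: "finite I"
        using P x(2) by (intro rel_basis_finite[OF M x(3)]) (auto simp: flat_filter_def)
      obtain j where j: "j \<in> I" "j \<notin> F" "j \<in> gset M"
        by (rule rel_basis_not_subset[OF M P F(1) _ F(3) x(2,3)]) (use F(2) in auto)
      let ?A = "prod (lin P) (I - {j})" and ?B = "prod (lin ?P) (I - {j})"
      have kill: "Var F * lin ?P j \<in> ?J"
        using fy_lin_Var[of j M F ?P Z] j by (simp add: mult.commute)
      \<comment> \<open>Because \<open>lin ?P j\<close> annihilates \<open>Var F\<close>, old and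
        new forms are congruent modulo its colon ideal.\<close>
      have "?A - ?B \<in> {a. lin ?P j * a \<in> ?J}"
      proof (rule prod_diff_in_ideal[OF subring_polys ideal_colon[OF order_refl ideal_fy]])
        fix i
        show "lin P i \<in> polys ?P" using lin_in_polys[of P] PP by blast
        show "lin ?P i \<in> polys ?P" by (rule lin_in_polys)
        have "lin P i - lin ?P i = (if i \<in> F then - Var F else 0)"
          unfolding lin_insert[OF finite_filter F(3)] by simp
        then show "lin P i - lin ?P i \<in> {a. lin ?P j * a \<in> ?J}"
          using kill by (auto simp: ideal_0[OF ideal_fy] mult.commute
              intro: ideal_uminus[OF subring_polys ideal_fy])
      qed
      then have 1: "lin ?P j * (?A - ?B) \<in> ?J" by simp
      have "lin ?P j * ?B = prod (lin ?P) I"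
        by (rule prod_lin_remove[OF fin j(1), symmetric])
      moreover have "prod (lin ?P) I \<in> ?J"
        by (rule fy_basis[OF _ x(3)]) (simp add: x(2))
      ultimately have 2: "lin ?P j * ?B \<in> ?J" by simp
      have "x = lin ?P j * (?A - ?B) + lin ?P j * ?B"
        unfolding x(1) prod_lin_remove[OF fin j(1)] lin_eq[OF j(2)] by (simp add: algebra_simps)
      also have "\<dots> \<in> ?J" by (rule ideal_add[OF ideal_fy 1 2])
      finally show ?thesis .
    qed
  qed
qed

text \<open>The inclusion of \<open>t K\<close> in the new ideal. A flat of \<open>P\<close> not
  above \<open>F\<close> is incomparable to it, and forms of elements outside \<open>F\<close> do
  not change.\<close>

lemma Var_link_subset:
  assumes "a \<in> LK"
  shows "Var F * a \<in> fy_ideal M Z (insert F P)"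
proof -
  let ?P = "insert F P" and ?J = "fy_ideal M Z (insert F P)"
  have PP: "polys P \<subseteq> polys ?P" by (rule polys_mono) blast
  have VF: "Var F \<in> polys ?P" by (rule Var_in_polys) simp
  have "LK \<subseteq> {a. Var F * a \<in> ?J}"
    unfolding link_ideal_def
  proof (rule idl_subset[OF ideal_colon[OF PP ideal_fy]], rule subsetI, unfold mem_Collect_eq)
    fix x assume "x \<in> rels M Z P \<union> {Var G |G. G \<in> P \<and> \<not> F \<subseteq> G} \<union> {lin P i |i. i \<in> gset M - F}"
    then consider (rels) "x \<in> rels M Z P" | (Var) G where "x = Var G" "G \<in> P" "\<not> F \<subseteq> G"
      | (lin) i where "x = lin P i" "i \<in> gset M" "i \<notin> F"
      by blast
    then show "Var F * x \<in> ?J"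
    proof cases
      case rels
      then have "x \<in> FI" unfolding fy_ideal_def by (rule idl_base[OF subring_polys])
      then have "x \<in> ?J" using fy_subset_insert by blast
      then show ?thesis by (rule ideal_mult[OF ideal_fy VF])
    next
      case x: (Var G)
      then show ?thesis
        unfolding x(1) using not_below[of G] by (intro fy_incomparable) auto
    next
      case x: (lin i)
      have "lin ?P i * Var F \<in> ?J" using x by (intro fy_lin_Var) auto
      then show ?thesis
        unfolding x(1) lin_insert[OF finite_filter F(3)] using x(3) by (simp add: mult.commute)
    qed
  qed
  then show ?thesis using assms by blast
qed

lemma step_subset_fy: "step_ideal \<subseteq> fy_ideal M Z (insert F P)"
proof
  let ?P = "insert F P" and ?J = "fy_ideal M Z (insert F P)"
  have PP: "polys P \<subseteq> polys ?P" by (rule polys_mono) blast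
  have VF: "Var F \<in> polys ?P" by (rule Var_in_polys) simp
  fix x assume "x \<in> step_ideal"
  then obtain u w where x: "x = poly (min_poly * u + w) (Var F)" "u \<in> coeffs_in (polys P)" "w \<in> upper_part"
    unfolding step_ideal_def by blast
  \<comment> \<open>All of \<open>I0\<close> lies in \<open>F\<close>, so each factor
    \<open>lin P i + Var F\<close> is the new form of \<open>i\<close>.\<close>
  have "poly min_poly (Var F) = prod (lin ?P) I0"
    unfolding min_poly_def poly_prod
    using I0 by (intro prod.cong) (auto simp: lin_step rel_basis_def)
  also have "\<dots> \<in> ?J" by (rule fy_basis[OF _ I0]) simp
  finally have 1: "poly min_poly (Var F) \<in> ?J" .
  have "u \<in> coeffs_in (polys ?P)" using x(2) PP by (auto simp: coeffs_in_def)
  then have "poly u (Var F) \<in> polys ?P" by (rule poly_coeffs_in[OF subring_polys _ VF])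
  then have 2: "poly (min_poly * u) (Var F) \<in> ?J"
    unfolding poly_mult by (rule ideal_mult'[OF ideal_fy _ 1])
  have "coeff w k * Var F ^ k \<in> ?J" for k
  proof (cases k)
    case 0
    then show ?thesis using x(3) fy_subset_insert by (auto simp: upper_part_def)
  next
    case (Suc n)
    have "coeff w k \<in> LK" using x(3) by (auto simp: upper_part_def coeffs_in_def)
    moreover have "Var F ^ n \<in> polys ?P"
      unfolding Var_power by (rule single_in_polys) auto
    ultimately have "Var F ^ n * (Var F * coeff w k) \<in> ?J"
      by (intro ideal_mult[OF ideal_fy] Var_link_subset)
    then show ?thesis by (simp add: Suc mult_ac)
  qed
  then have 3: "poly w (Var F) \<in> ?J"
    unfolding poly_altdef by (intro ideal_sum[OF ideal_fy])
  show "x \<in> ?J"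
    unfolding x(1) poly_add by (rule ideal_add[OF ideal_fy 2 3])
qed

text \<open>\<open>monomial_basis_adjoin\<close> with \<open>t\<close> the variable of
  \<open>F\<close>. The degree of \<open>min_poly\<close> is the rank difference, positive because
  \<open>Z\<close> is a flat strictly inside \<open>F\<close>.\<close>

lemma monomial_basis_insert:
  assumes B: "monomial_basis (polys P) FI B" "\<And>m. m \<in> B \<Longrightarrow> set_mset m \<subseteq> P"
    and C: "monomial_basis (polys P) LK C" "\<And>m. m \<in> C \<Longrightarrow> set_mset m \<subseteq> P"
    and Z: "Z \<in> flats M"
  shows "monomial_basis (polys (insert F P)) (fy_ideal M Z (insert F P))
    (B \<union> (\<lambda>(k, c). c + replicate_mset k F) ` ({1..<rk M F - rk M Z} \<times> C))"
proof -
  have fin: "finite I0" by (rule rel_basis_finite[OF M I0 F(1)])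
  have d: "rk M F - rk M Z = card I0" using I0 by (simp add: rel_basis_def)
  have "rk M Z < rk M F" by (rule flat_rk_less[OF M Z flat_subset[OF F(1)] F(2)])
  then have d0: "0 < card I0" using d by simp
  have J: "fy_ideal M Z (insert F P) = {poly (min_poly * u + w) (Var F) | u w.
      u \<in> coeffs_in (polys P) \<and> w \<in> coeffs_in LK \<and> coeff w 0 \<in> FI}"
    using fy_insert_subset step_subset_fy unfolding step_ideal_def upper_part_def by auto
  have p: "coeff min_poly (card I0) = 1" "\<And>k. card I0 < k \<Longrightarrow> coeff min_poly k = 0"
    unfolding min_poly_def using monic_linear_prod[OF fin] by auto
  have p0: "coeff min_poly 0 * a \<in> FI" if "a \<in> LK" for a
    unfolding min_poly_def coeff_0_prod
    using prod_lin_mult_link[OF M P F above I0 that] by simp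
  show ?thesis
    unfolding d
    by (rule monomial_basis_adjoin[OF F(3) ideal_fy ideal_link fy_subset_link min_poly_coeffs p d0 p0 J
          B C link_in_polys])
qed

end

section \<open>The Hilbert polynomial of the Chow ring\<close>

text \<open>The recursion for \<open>H(Z)\<close> in the opening text, taken as a definition;
  \<open>chow_dim_eq\<close> ties it to the Chow ring. The value \<open>0\<close> for an infinite
  ground set is a default that secures termination.\<close>

function fy_poly :: "'a matroid \<Rightarrow> 'a set \<Rightarrow> int poly" where
  "fy_poly M Z = (if finite (gset M)
     then 1 + (\<Sum>F\<in>{F \<in> flats M. Z \<subset> F}. (\<Sum>k\<in>{1..<rk M F - rk M Z}. monom 1 k) * fy_poly M F) else 0)"
  by auto
termination
proof (relation "measure (\<lambda>(M, Z). card (gset M - Z))")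
  show "wf (measure (\<lambda>(M :: 'a matroid, Z). card (gset M - Z)))" by simp
  fix M :: "'a matroid" and Z F
  assume fin: "finite (gset M)" and F: "F \<in> {F \<in> flats M. Z \<subset> F}"
  then have "gset M - F \<subset> gset M - Z"
    using flat_subset[of F M] by blast
  then have "card (gset M - F) < card (gset M - Z)"
    using fin by (intro psubset_card_mono) auto
  then show "((M, F), (M, Z)) \<in> measure (\<lambda>(M, Z). card (gset M - Z))" by simp
qed

declare fy_poly.simps [simp del]

lemma fy_poly_rec:
  "matroid M \<Longrightarrow> fy_poly M Z
    = 1 + (\<Sum>F\<in>{F \<in> flats M. Z \<subset> F}. (\<Sum>k\<in>{1..<rk M F - rk M Z}. monom 1 k) * fy_poly M F)"
  by (subst fy_poly.simps) (simp add: finite_gset)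

definition size_poly :: "'v multiset set \<Rightarrow> int poly" where
  "size_poly B = (\<Sum>m\<in>B. monom 1 (size m))"

text \<open>The exponent of \<open>t\<close> recovers \<open>k\<close>, so the shifted copies of
  \<open>C\<close> are disjoint from each other and from \<open>B\<close>.\<close>

lemma size_poly_insert_var:
  fixes t :: 'v
  assumes "finite B" "finite C" "\<And>m. m \<in> B \<Longrightarrow> t \<notin># m" "\<And>m. m \<in> C \<Longrightarrow> t \<notin># m"
  shows "size_poly (B \<union> (\<lambda>(k, c). c + replicate_mset k t) ` ({1..<d} \<times> C))
    = size_poly B + (\<Sum>k\<in>{1..<d}. monom 1 k) * size_poly C"
proof -
  let ?f = "\<lambda>(k, c). c + replicate_mset k t"
  have cnt: "count (c + replicate_mset k t) t = k" if "c \<in> C" for k c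
    using assms(4)[OF that] by (simp add: not_in_iff)
  have inj: "inj_on ?f ({1..<d} \<times> C)"
  proof (rule inj_onI; clarify)
    fix k c k' c' assume "c \<in> C" "c' \<in> C" and eq: "c + replicate_mset k t = c' + replicate_mset k' t"
    then have "k = k'" using cnt by metis
    then show "k = k' \<and> c = c'" using eq by simp
  qed
  have disj: "B \<inter> ?f ` ({1..<d} \<times> C) = {}"
    by (auto dest: assms(3))
  have "size_poly (B \<union> ?f ` ({1..<d} \<times> C)) = size_poly B + size_poly (?f ` ({1..<d} \<times> C))"
    unfolding size_poly_def using assms disj by (intro sum.union_disjoint) auto
  also have "size_poly (?f ` ({1..<d} \<times> C)) = (\<Sum>(k, c)\<in>{1..<d} \<times> C. monom 1 k * monom 1 (size c))"
    unfolding size_poly_def by (subst sum.reindex[OF inj]) (auto simp: mult_monom add.commute intro!: sum.cong)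
  also have "\<dots> = (\<Sum>k\<in>{1..<d}. monom 1 k) * size_poly C"
    unfolding size_poly_def by (simp add: sum_product sum.cartesian_product)
  finally show ?thesis .
qed

text \<open>Start of the induction: without variables there are no relations and the ring is
  \<rat>.\<close>

lemma monomial_basis_empty: "monomial_basis (polys {}) (fy_ideal M Z {}) {{#}}"
proof -
  have "rels M Z {} = {}" by (auto simp: rels_def)
  moreover have "x = 0" if "x \<in> idl S {}" for x :: "'a set mpoly" and S
    using that by induction auto
  ultimately have I: "x = 0" if "x \<in> fy_ideal M Z {}" for x
    using that by (simp add: fy_ideal_def)
  show ?thesis
    unfolding monomial_basis_def
  proof (intro conjI ballI allI impI)
    fix s :: "'a set mpoly" assume "s \<in> polys {}"
    then show "\<exists>r. keys r \<subseteq> {{#}} \<and> s - r \<in> fy_ideal M Z {}"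
      by (intro exI[of _ s]) (auto simp: polys_def ideal_0[OF ideal_fy])
  qed (rule I)
qed

text \<open>A minimal member \<open>F\<close> of \<open>P\<close> is removed; the rest is a filter,
  and \<open>F\<close> is maximal outside it. Putting \<open>F\<close> back is one blow-up, which
  contributes exactly the summand of \<open>F\<close>.\<close>

lemma fy_basis_filter:
  assumes M: "matroid M" and Z: "Z \<in> flats M"
    and IH: "\<And>F. F \<in> flats M \<Longrightarrow> Z \<subset> F \<Longrightarrow>
      \<exists>C. finite C \<and> (\<forall>m\<in>C. set_mset m \<subseteq> {G \<in> flats M. F \<subset> G})
        \<and> monomial_basis (polys {G \<in> flats M. F \<subset> G}) (fy_ideal M F {G \<in> flats M. F \<subset> G}) C
        \<and> size_poly C = fy_poly M F"
    and P: "flat_filter M Z P"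
  shows "\<exists>B. finite B \<and> (\<forall>m\<in>B. set_mset m \<subseteq> P) \<and> monomial_basis (polys P) (fy_ideal M Z P) B
    \<and> size_poly B = 1 + (\<Sum>F\<in>P. (\<Sum>k\<in>{1..<rk M F - rk M Z}. monom 1 k) * fy_poly M F)"
proof -
  have "finite P"
    by (rule finite_subset[OF _ finite_flats[OF M]]) (use P in \<open>auto simp: flat_filter_def\<close>)
  then show ?thesis using P
  proof (induction P rule: finite_psubset_induct)
    case (psubset P)
    show ?case
    proof (cases "P = {}")
      case True
      then show ?thesis
        using monomial_basis_empty[of M Z]
        by (intro exI[of _ "{{#}}"]) (simp add: size_poly_def)
    next
      case False
      from finite_has_minimal[OF psubset.hyps(1) False] obtain F where
        F: "F \<in> P" and min: "\<And>G. G \<in> P \<Longrightarrow> G \<subseteq> F \<Longrightarrow> F = G" by blast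
      let ?P = "P - {F}" and ?Q = "{G \<in> flats M. F \<subset> G}"
      have PF: "insert F ?P = P" using F by blast
      have Ff: "F \<in> flats M" "Z \<subset> F" using psubset.prems F by (auto simp: flat_filter_def)
      have filt: "flat_filter M Z ?P"
        unfolding flat_filter_def
      proof (intro conjI ballI impI)
        show "?P \<subseteq> {G \<in> flats M. Z \<subset> G}" using psubset.prems by (auto simp: flat_filter_def)
        fix G H assume GH: "G \<in> ?P" "H \<in> flats M" "G \<subseteq> H"
        then have "H \<in> P" using psubset.prems by (auto simp: flat_filter_def)
        moreover have "H \<noteq> F" using min[of G] GH by auto
        ultimately show "H \<in> ?P" by simp
      qed
      have above: "H \<in> ?P" if "H \<in> flats M" "F \<subset> H" for H
        using that F psubset.prems by (auto simp: flat_filter_def)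
      have QP: "?Q \<subseteq> ?P" using above by blast
      have "?P \<subset> P" using F by blast
      from psubset.IH[OF this filt] obtain B where B: "finite B" "\<forall>m\<in>B. set_mset m \<subseteq> ?P"
        "monomial_basis (polys ?P) (fy_ideal M Z ?P) B"
        "size_poly B = 1 + (\<Sum>F\<in>?P. (\<Sum>k\<in>{1..<rk M F - rk M Z}. monom 1 k) * fy_poly M F)"
        by (elim exE conjE) (rule that)
      from IH[OF Ff] obtain C where C: "finite C" "\<forall>m\<in>C. set_mset m \<subseteq> ?Q"
        "monomial_basis (polys ?Q) (fy_ideal M F ?Q) C" "size_poly C = fy_poly M F"
        by (elim exE conjE) (rule that)
      have CP: "set_mset m \<subseteq> ?P" if "m \<in> C" for m
        using bspec[OF C(2) that] QP by (rule order_trans)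
      have F': "F \<notin> ?P" by simp
      have link: "monomial_basis (polys ?P) (link_ideal M Z ?P F) C"
        by (rule monomial_basis_link[OF M filt Ff F' QP C(3) bspec[OF C(2)]])
      obtain I0 where I0: "rel_basis M Z F I0"
        using rel_basis_exists[OF M _ flat_subset[OF Ff(1)]] Ff(2) by blast
      let ?B = "B \<union> (\<lambda>(k, c). c + replicate_mset k F) ` ({1..<rk M F - rk M Z} \<times> C)"
      have "monomial_basis (polys (insert F ?P)) (fy_ideal M Z (insert F ?P)) ?B"
        by (rule monomial_basis_insert[OF M filt Ff F' above I0 B(3) bspec[OF B(2)] link CP Z])
      then have 1: "monomial_basis (polys P) (fy_ideal M Z P) ?B"
        unfolding PF .
      have 2: "finite ?B" using B(1) C(1) by simp
      have 3: "set_mset m \<subseteq> P" if "m \<in> ?B" for m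
        using that
      proof
        assume "m \<in> B" then show ?thesis using B(2) by blast
      next
        assume "m \<in> (\<lambda>(k, c). c + replicate_mset k F) ` ({1..<rk M F - rk M Z} \<times> C)"
        then obtain k c where "c \<in> C" "m = c + replicate_mset k F" by auto
        then show ?thesis using CP[of c] F by auto
      qed
      have "F \<notin># m" if "m \<in> B" for m using bspec[OF B(2) that] by blast
      moreover have "F \<notin># m" if "m \<in> C" for m using bspec[OF C(2) that] by blast
      ultimately have "size_poly ?B = size_poly B
          + (\<Sum>k\<in>{1..<rk M F - rk M Z}. monom 1 k) * size_poly C"
        using B(1) C(1) by (intro size_poly_insert_var)
      also have "\<dots> = 1 + (\<Sum>F\<in>P. (\<Sum>k\<in>{1..<rk M F - rk M Z}. monom 1 k) * fy_poly M F)"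
        unfolding B(4) C(4) sum.remove[OF psubset.hyps(1) F] by (simp only: add_ac)
      finally show ?thesis using 1 2 3 by (intro exI[of _ ?B]) simp
    qed
  qed
qed

text \<open>An outer induction from large flats down to small ones: the blow-ups for
  \<open>Z\<close> use the rings of the contractions by flats strictly above
  \<open>Z\<close>.\<close>

lemma fy_basis_exists:
  assumes M: "matroid M" and "Z \<in> flats M"
  shows "\<exists>B. finite B \<and> (\<forall>m\<in>B. set_mset m \<subseteq> {G \<in> flats M. Z \<subset> G})
    \<and> monomial_basis (polys {G \<in> flats M. Z \<subset> G}) (fy_ideal M Z {G \<in> flats M. Z \<subset> G}) B
    \<and> size_poly B = fy_poly M Z"
  using assms(2)
proof (induction "card (gset M - Z)" arbitrary: Z rule: less_induct)
  case less
  have "flat_filter M Z {G \<in> flats M. Z \<subset> G}" by (auto simp: flat_filter_def)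
  moreover have "\<exists>C. finite C \<and> (\<forall>m\<in>C. set_mset m \<subseteq> {G \<in> flats M. F \<subset> G})
        \<and> monomial_basis (polys {G \<in> flats M. F \<subset> G}) (fy_ideal M F {G \<in> flats M. F \<subset> G}) C
        \<and> size_poly C = fy_poly M F" if F: "F \<in> flats M" "Z \<subset> F" for F
  proof (rule less.hyps[OF _ F(1)])
    show "card (gset M - F) < card (gset M - Z)"
      by (rule psubset_card_mono) (use finite_gset[OF M] flat_subset[OF F(1)] F(2) in auto)
  qed
  ultimately show ?case
    unfolding fy_poly_rec[OF M, of Z] by (intro fy_basis_filter[OF M less.prems])
qed

section \<open>Graded pieces\<close>

text \<open>The zero polynomial is homogeneous of every degree.\<close>

definition homog :: "nat \<Rightarrow> 'v mpoly \<Rightarrow> bool" where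
  "homog e p \<longleftrightarrow> (\<forall>m\<in>keys p. size m = e)"

definition hpart :: "nat \<Rightarrow> 'v mpoly \<Rightarrow> 'v mpoly" where
  "hpart j p = (\<Sum>m\<in>{m \<in> keys p. size m = j}. single m (lookup p m))"

lemma lookup_hpart: "lookup (hpart j p) m = (if size m = j then lookup p m else 0)"
proof -
  have "lookup (hpart j p) m = (\<Sum>n\<in>{n \<in> keys p. size n = j}. if n = m then lookup p m else 0)"
    unfolding hpart_def lookup_sum by (rule sum.cong) (auto simp: lookup_single when_def)
  also have "\<dots> = (if size m = j then lookup p m else 0)"
    by (simp add: in_keys_iff)
  finally show ?thesis .
qed

lemma hpart_0: "hpart j 0 = 0"
  by (rule poly_mapping_eqI) (simp add: lookup_hpart)

lemma hpart_add: "hpart j (p + q) = hpart j p + hpart j q"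
  by (rule poly_mapping_eqI) (simp add: lookup_hpart lookup_add)

lemma hpart_diff: "hpart j (p - q) = hpart j p - hpart j q"
  by (rule poly_mapping_eqI) (simp add: lookup_hpart lookup_minus)

lemma hpart_sum: "hpart j (\<Sum>i\<in>A. f i) = (\<Sum>i\<in>A. hpart j (f i))"
  by (induction A rule: infinite_finite_induct) (auto simp: hpart_0 hpart_add)

lemma hpart_homog: "homog e p \<Longrightarrow> hpart j p = (if e = j then p else 0)"
  by (rule poly_mapping_eqI) (auto simp: lookup_hpart homog_def in_keys_iff)

lemma homog_mult:
  assumes "homog a p" "homog b q"
  shows "homog (a + b) (p * q)"
  unfolding homog_def
proof
  fix m assume "m \<in> keys (p * q)"
  then have "m \<in> {x + y |x y. x \<in> keys p \<and> y \<in> keys q}"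
    by (rule subsetD[OF keys_mult])
  then show "size m = a + b"
    using assms by (auto simp: homog_def)
qed

lemma homog_Var: "homog 1 (Var v)"
  by (simp add: homog_def Var_def)

lemma homog_single: "homog (size m) (single m c)"
  by (simp add: homog_def)

lemma homog_sum: "(\<And>i. i \<in> A \<Longrightarrow> homog e (f i)) \<Longrightarrow> homog e (sum f A)"
  unfolding homog_def using Poly_Mapping.keys_sum[of f A] by blast

lemma homog_uminus: "homog e p \<Longrightarrow> homog e (- p)"
  by (simp add: homog_def in_keys_iff)

lemma homog_prod:
  assumes "\<And>i. i \<in> A \<Longrightarrow> homog 1 (f i)"
  shows "homog (if finite A then card A else 0) (prod f A)"
  using assms
proof (induction A rule: infinite_finite_induct)
  case (insert i A)
  have "homog (1 + card A) (f i * prod f A)"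
    using insert by (intro homog_mult) auto
  then show ?case using insert.hyps by simp
qed (auto simp: homog_def)

lemma homog_ev:
  assumes p: "homog e p" "p \<in> polys P" and f: "\<And>v. v \<in> P \<Longrightarrow> homog 1 (f v)"
  shows "homog e (ev f p)"
  unfolding ev_def
proof (rule homog_sum)
  have *: "homog (size m) (\<Prod>v\<in>#m. f v)" if "set_mset m \<subseteq> P" for m
    using that
  proof (induction m)
    case (add v m)
    then have "homog (1 + size m) (f v * (\<Prod>v\<in>#m. f v))"
      by (intro homog_mult f) auto
    then show ?case by simp
  qed (simp add: homog_def)
  fix m assume m: "m \<in> keys p"
  then have "homog (0 + size m) (single 0 (lookup p m) * (\<Prod>v\<in>#m. f v))"
    using p(2) homog_single[of 0 "lookup p m"]
    by (intro homog_mult *) (auto simp: polys_def)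
  then show "homog e (single 0 (lookup p m) * (\<Prod>v\<in>#m. f v))"
    using p(1) m by (simp add: homog_def)
qed

text \<open>Expanding \<open>s\<close> into monomials makes every summand of \<open>s * g\<close>
  homogeneous, so taking a part keeps or drops it as a whole.\<close>

lemma hpart_idl:
  assumes G: "\<And>g. g \<in> G \<Longrightarrow> \<exists>e. homog e g" and x: "x \<in> idl (polys P) G"
  shows "hpart j x \<in> idl (polys P) G"
  using x
proof induction
  case zero
  then show ?case by (simp add: hpart_0 idl.zero)
next
  case (step a s g)
  note I = ideal_in_idl[OF subring_polys[of P], of G]
  obtain e where e: "homog e g" using G[OF step.hyps(3)] by blast
  have "s * g = (\<Sum>m\<in>keys s. single m (lookup s m) * g)"
    by (subst (1) mpoly_expand[of s]) (rule sum_distrib_right)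
  then have "hpart j (s * g) = (\<Sum>m\<in>keys s. hpart j (single m (lookup s m) * g))"
    by (simp add: hpart_sum)
  also have "\<dots> \<in> idl (polys P) G"
  proof (rule ideal_sum[OF I])
    fix m assume "m \<in> keys s"
    then have "single m (lookup s m) \<in> polys P"
      using step.hyps(2) by (intro single_in_polys) (auto simp: polys_def)
    then have "single m (lookup s m) * g \<in> idl (polys P) G"
      by (rule ideal_mult[OF I _ idl_base[OF subring_polys step.hyps(3)]])
    then show "hpart j (single m (lookup s m) * g) \<in> idl (polys P) G"
      unfolding hpart_homog[OF homog_mult[OF homog_single e]] by (simp add: ideal_0[OF I])
  qed
  finally show ?case
    unfolding hpart_add by (rule ideal_add[OF I step.IH])
qed

lemma homog_lin: "homog 1 (lin P i)"
  unfolding lin_def by (rule homog_sum) (rule homog_Var)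

lemma hpart_fy: "x \<in> fy_ideal M Z P \<Longrightarrow> hpart j x \<in> fy_ideal M Z P"
  unfolding fy_ideal_def
proof (rule hpart_idl)
  fix g assume "g \<in> rels M Z P"
  then show "\<exists>e. homog e g"
  proof (cases rule: relsE)
    case (incomparable G H)
    show ?thesis unfolding incomparable(1) by (rule exI, rule homog_mult[OF homog_Var homog_Var])
  next
    case (lin_Var i G)
    show ?thesis unfolding lin_Var(1) by (rule exI, rule homog_mult[OF homog_lin homog_Var])
  next
    case (basis I G)
    show ?thesis unfolding basis(1) by (rule exI, rule homog_prod, rule homog_lin)
  qed
qed

section \<open>Linear algebra of graded pieces\<close>

context vector_space
begin

text \<open>The vectors \<open>e m\<close> span a complement of \<open>U\<close> in
  \<open>V\<close>. They are added to a basis of \<open>U\<close> one at a time, and the injectivity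
  of \<open>e\<close> is obtained along the way.\<close>

lemma dim_complement:
  assumes U: "subspace U" and V: "subspace V" and UV: "U \<subseteq> V"
    and T: "finite T" "V \<subseteq> span T" and J: "finite J"
    and eV: "\<And>m. m \<in> J \<Longrightarrow> e m \<in> V"
    and indep: "\<And>c. (\<Sum>m\<in>J. scale (c m) (e m)) \<in> U \<Longrightarrow> \<forall>m\<in>J. c m = 0"
    and gen: "\<And>v. v \<in> V \<Longrightarrow> \<exists>c. v - (\<Sum>m\<in>J. scale (c m) (e m)) \<in> U"
  shows "dim V = dim U + card J"
proof -
  obtain A where A: "A \<subseteq> U" "independent A" "U \<subseteq> span A" "card A = dim U"
    by (rule basis_exists[of U])
  have spA: "span A = U" using A(1,3) U by (intro span_subspace)
  have "A \<subseteq> span T" using A(1) UV T(2) by (intro order_trans[OF A(1)] order_trans[OF UV])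
  then have finA: "finite A" using independent_span_bound[OF T(1) A(2)] by simp
  have *: "independent (A \<union> e ` K) \<and> inj_on e K \<and> A \<inter> e ` K = {}" if "finite K" "K \<subseteq> J" for K
    using that
  proof (induction K rule: finite_induct)
    case (insert b K)
    then have IH: "independent (A \<union> e ` K)" "inj_on e K" "A \<inter> e ` K = {}" by simp_all
    have bK: "b \<in> J" "K \<subseteq> J" "b \<notin> K" using insert by auto
    have b: "e b \<notin> span (A \<union> e ` K)"
    proof
      assume "e b \<in> span (A \<union> e ` K)"
      then obtain x y where xy: "e b = x + y" "x \<in> span A" "y \<in> span (e ` K)"
        unfolding span_Un by auto
      from xy(3) obtain u where "y = (\<Sum>v\<in>e ` K. scale (u v) v)"
        using insert.hyps(1) by (auto simp: span_finite)
      then have y: "y = (\<Sum>m\<in>K. scale (u (e m)) (e m))"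
        by (simp add: sum.reindex[OF IH(2)])
      \<comment> \<open>The coefficients of the supposed dependence of \<open>e b\<close>: the
        combination equals \<open>x\<close>, which lies in \<open>U\<close>, although its
        coefficient at \<open>b\<close> is \<open>1\<close>.\<close>
      define c where "c = (\<lambda>m. if m = b then 1 else if m \<in> K then - u (e m) else 0)"
      have "(\<Sum>m\<in>J. scale (c m) (e m)) = (\<Sum>m\<in>insert b K. scale (c m) (e m))"
        using J bK by (intro sum.mono_neutral_right) (auto simp: c_def)
      also have "\<dots> = e b + (\<Sum>m\<in>K. scale (c m) (e m))"
        using insert.hyps by (simp add: c_def)
      also have "(\<Sum>m\<in>K. scale (c m) (e m)) = (\<Sum>m\<in>K. - scale (u (e m)) (e m))"
        using bK(3) by (intro sum.cong) (auto simp: c_def)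
      also have "e b + \<dots> = x"
        unfolding xy(1) y by (simp add: sum_negf)
      finally have "(\<Sum>m\<in>J. scale (c m) (e m)) \<in> U" using xy(2) spA by simp
      then have "c b = 0" using indep bK(1) by blast
      then show False by (simp add: c_def)
    qed
    have "e b \<notin> A \<union> e ` K"
    proof
      assume "e b \<in> A \<union> e ` K"
      then have "e b \<in> span (A \<union> e ` K)" by (rule span_base)
      with b show False by simp
    qed
    moreover have "independent (insert (e b) (A \<union> e ` K))"
      by (rule independent_insertI[OF b IH(1)])
    ultimately show ?case using IH insert.hyps(2) by (simp add: Diff_insert_absorb)
  qed (simp add: A(2))
  have B: "independent (A \<union> e ` J)" "inj_on e J" "A \<inter> e ` J = {}"
    using *[OF J order_refl] by simp_all
  have "V \<subseteq> span (A \<union> e ` J)"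
  proof
    fix v assume "v \<in> V"
    then obtain c where c: "v - (\<Sum>m\<in>J. scale (c m) (e m)) \<in> span A"
      using gen spA by blast
    have "v - (\<Sum>m\<in>J. scale (c m) (e m)) \<in> span (A \<union> e ` J)"
      using c span_mono[of A "A \<union> e ` J"] by blast
    moreover have "(\<Sum>m\<in>J. scale (c m) (e m)) \<in> span (A \<union> e ` J)"
      by (intro span_sum span_scale span_base) blast
    ultimately have "(v - (\<Sum>m\<in>J. scale (c m) (e m))) + (\<Sum>m\<in>J. scale (c m) (e m)) \<in> span (A \<union> e ` J)"
      by (rule span_add)
    then show "v \<in> span (A \<union> e ` J)" by simp
  qed
  moreover have "A \<union> e ` J \<subseteq> V" using A(1) UV eV by blast
  ultimately have "card (A \<union> e ` J) = dim V"
    using B(1) by (intro basis_card_eq_dim)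
  moreover have "card (A \<union> e ` J) = card A + card (e ` J)"
    using finA J B(3) by (intro card_Un_disjoint) auto
  ultimately show ?thesis
    using A(4) card_image[OF B(2)] by simp
qed

end

text \<open>The vector space in which \<open>chow_ideal\<close> and \<open>chow_dim\<close> form
  spans and dimensions.\<close>

interpretation fun_space: vector_space "\<lambda>(c::rat) (p :: 'b \<Rightarrow> rat) n. c * p n"
  by standard (auto simp: fun_eq_iff algebra_simps)

lemma lookup_scale:
  fixes p :: "'v mpoly"
  shows "lookup (single 0 c * p) = (\<lambda>n. c * lookup p n)"
  using lookup_mult_single[of p 0 c] by (auto simp: fun_eq_iff mult.commute)

lemma lookup_single_mult:
  fixes p :: "'v mpoly"
  shows "lookup (single m 1 * p) = mono_mult m (lookup p)"
  using lookup_mult_single[of p m 1] by (auto simp: fun_eq_iff mult.commute mono_mult_def)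

lemma lookup_plus: "lookup (p + q) = lookup p + lookup q"
  by (auto simp: fun_eq_iff lookup_add)

lemma lookup_zero_fun: "lookup 0 = 0"
  by (auto simp: fun_eq_iff)

lemma lookup_sum_fun: "lookup (\<Sum>i\<in>A. f i) = (\<Sum>i\<in>A. lookup (f i))"
  by (induction A rule: infinite_finite_induct) (simp_all add: lookup_zero_fun lookup_plus)

text \<open>Expanding multipliers into monomials shows that a linear span of monomial multiples is
  already the generated ideal.\<close>

lemma span_monomial_multiples:
  "fun_space.span {mono_mult m (lookup g) | m g. set_mset m \<subseteq> P \<and> g \<in> G} = lookup ` idl (polys P) G"
    (is "fun_space.span ?A = _")
proof
  note I = ideal_in_idl[OF subring_polys[of P], of G]
  show "fun_space.span ?A \<subseteq> lookup ` idl (polys P) G"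
  proof (rule fun_space.span_minimal)
    show "?A \<subseteq> lookup ` idl (polys P) G"
    proof
      fix x assume "x \<in> ?A"
      then obtain m g where x: "x = lookup (single m 1 * g)" "set_mset m \<subseteq> P" "g \<in> G"
        unfolding lookup_single_mult by blast
      then show "x \<in> lookup ` idl (polys P) G"
        unfolding x(1) by (intro imageI ideal_mult[OF I] single_in_polys idl_base[OF subring_polys])
    qed
    show "fun_space.subspace (lookup ` idl (polys P) G)"
    proof (rule fun_space.subspaceI)
      show "0 \<in> lookup ` idl (polys P) G"
        by (rule image_eqI[of _ _ 0]) (simp_all add: lookup_zero_fun idl.zero)
      fix x assume "x \<in> lookup ` idl (polys P) G"
      then obtain p where p: "x = lookup p" "p \<in> idl (polys P) G" by blast
      show "x + y \<in> lookup ` idl (polys P) G" if "y \<in> lookup ` idl (polys P) G" for y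
      proof -
        obtain q where q: "y = lookup q" "q \<in> idl (polys P) G" using \<open>y \<in> _\<close> by blast
        show ?thesis
          unfolding p(1) q(1) lookup_plus[symmetric] by (rule imageI[OF ideal_add[OF I p(2) q(2)]])
      qed
      show "(\<lambda>n. c * x n) \<in> lookup ` idl (polys P) G" for c
        unfolding p(1) lookup_scale[symmetric]
        by (rule imageI[OF ideal_mult[OF I _ p(2)]]) (simp add: single_in_polys)
    qed
  qed
  show "lookup ` idl (polys P) G \<subseteq> fun_space.span ?A"
  proof
    fix x assume "x \<in> lookup ` idl (polys P) G"
    then obtain p where p: "x = lookup p" "p \<in> idl (polys P) G" by blast
    from p(2) have "lookup p \<in> fun_space.span ?A"
    proof induction
      case zero
      then show ?case unfolding lookup_zero_fun by (rule fun_space.span_zero)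
    next
      case (step a s g)
      have "s * g = (\<Sum>m\<in>keys s. single 0 (lookup s m) * (single m 1 * g))"
        by (subst (1) mpoly_expand[of s]) (simp add: sum_distrib_right mult.assoc[symmetric] mult_single)
      then have "lookup (s * g) = (\<Sum>m\<in>keys s. (\<lambda>n. lookup s m * mono_mult m (lookup g) n))"
        by (simp only: lookup_sum_fun lookup_scale lookup_single_mult)
      also have "\<dots> \<in> fun_space.span ?A"
      proof (rule fun_space.span_sum, rule fun_space.span_scale, rule fun_space.span_base)
        fix m assume "m \<in> keys s"
        then have "set_mset m \<subseteq> P" using step.hyps(2) by (simp add: polys_def)
        then show "mono_mult m (lookup g) \<in> ?A" using step.hyps(3) by blast
      qed
      finally show ?case
        unfolding lookup_plus by (rule fun_space.span_add[OF step.IH])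
    qed
    then show "x \<in> fun_space.span ?A" by (simp only: p(1))
  qed
qed

section \<open>Comparison with the presentation of the Chow ring\<close>

text \<open>The polynomials whose coefficient functions are \<open>chow_gens\<close>.\<close>

definition lin_gens :: "'a matroid \<Rightarrow> 'a set mpoly set" where
  "lin_gens M = {Var G * Var H | G H. G \<in> chow_vars M \<and> H \<in> chow_vars M \<and> \<not> G \<subseteq> H \<and> \<not> H \<subseteq> G}
     \<union> {lin (chow_vars M) i - lin (chow_vars M) j | i j. i \<in> gset M \<and> j \<in> gset M}"

lemma lookup_Var_Var: "lookup (Var G * Var H) = (\<lambda>n. if n = {#G, H#} then 1 else 0)"
  by (auto simp: fun_eq_iff Var_def mult_single lookup_single when_def add_mset_commute)

lemma lookup_lin:
  assumes "finite P"
  shows "lookup (lin P i) n = (if \<exists>F\<in>P. n = {#F#} then of_bool (i \<in> the_elem (set_mset n)) else 0)"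
proof -
  have *: "lookup (lin P i) n = (\<Sum>G\<in>{G \<in> P. i \<in> G}. if n = {#G#} then 1 else 0)"
    by (auto simp: lin_def lookup_sum Var_def lookup_single when_def intro!: sum.cong)
  show ?thesis
  proof (cases "\<exists>F\<in>P. n = {#F#}")
    case True
    then obtain F where F: "F \<in> P" "n = {#F#}" by blast
    have "(\<Sum>G\<in>{G \<in> P. i \<in> G}. if n = {#G#} then 1 else 0)
        = (\<Sum>G\<in>{G \<in> P. i \<in> G}. if F = G then 1 else (0::rat))"
      using F(2) by simp
    also have "\<dots> = of_bool (i \<in> F)"
      using F(1) assms by simp
    finally show ?thesis using * True F by simp
  next
    case False
    then show ?thesis unfolding * by (auto intro!: sum.neutral)
  qed
qed

lemma chow_gens_eq:
  assumes "finite (chow_vars M)"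
  shows "chow_gens M = lookup ` lin_gens M"
proof -
  have 1: "lookup ` {Var G * Var H | G H. G \<in> chow_vars M \<and> H \<in> chow_vars M \<and> \<not> G \<subseteq> H \<and> \<not> H \<subseteq> G}
     = {(\<lambda>n. if n = {#F1, F2#} then 1 else 0) | F1 F2.
        F1 \<in> chow_vars M \<and> F2 \<in> chow_vars M \<and> \<not> F1 \<subseteq> F2 \<and> \<not> F2 \<subseteq> F1}"
    unfolding lookup_Var_Var[symmetric] by blast
  have eq: "lookup (lin (chow_vars M) i - lin (chow_vars M) j) =
      (\<lambda>n. if (\<exists>F \<in> chow_vars M. n = {#F#})
            then of_bool (i \<in> the_elem (set_mset n)) - of_bool (j \<in> the_elem (set_mset n)) else 0)" for i j
    by (auto simp: fun_eq_iff lookup_minus lookup_lin[OF assms])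
  have 2: "lookup ` {lin (chow_vars M) i - lin (chow_vars M) j | i j. i \<in> gset M \<and> j \<in> gset M}
     = {(\<lambda>n. if (\<exists>F \<in> chow_vars M. n = {#F#})
            then of_bool (i \<in> the_elem (set_mset n)) - of_bool (j \<in> the_elem (set_mset n))
            else 0) | i j. i \<in> gset M \<and> j \<in> gset M}"
    unfolding eq[symmetric] by blast
  show ?thesis
    unfolding chow_gens_def lin_gens_def image_Un 1 2 ..
qed

lemma chow_ideal_eq:
  assumes "finite (chow_vars M)"
  shows "chow_ideal M = lookup ` idl (polys (chow_vars M)) (lin_gens M)"
proof -
  have "{mono_mult m g | m g. set_mset m \<subseteq> chow_vars M \<and> g \<in> chow_gens M}
      = {mono_mult m (lookup g) | m g. set_mset m \<subseteq> chow_vars M \<and> g \<in> lin_gens M}"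
    unfolding chow_gens_eq[OF assms] by blast
  then show ?thesis
    unfolding chow_ideal_def using span_monomial_multiples[of "chow_vars M" "lin_gens M"] by simp
qed

text \<open>Functions in \<open>hom_polys\<close> have finite support, because finitely many
  variables admit only finitely many monomials of degree \<open>j\<close>.\<close>

lemma hom_polys_eq:
  assumes "finite (chow_vars M)"
  shows "hom_polys M j = lookup ` {p \<in> polys (chow_vars M). homog j p}"
proof
  show "lookup ` {p \<in> polys (chow_vars M). homog j p} \<subseteq> hom_polys M j"
    by (auto simp: hom_polys_def polys_def homog_def in_keys_iff)
  show "hom_polys M j \<subseteq> lookup ` {p \<in> polys (chow_vars M). homog j p}"
  proof
    fix f assume f: "f \<in> hom_polys M j"
    have "{n. f n \<noteq> 0} \<subseteq> multisets_of_size (chow_vars M) j"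
      using f by (auto simp: hom_polys_def multisets_of_size_def)
    then have "finite {n. f n \<noteq> 0}"
      by (rule finite_subset) (rule finite_multisets_of_size[OF assms])
    then have l: "lookup (Abs_poly_mapping f) = f" by simp
    then have "Abs_poly_mapping f \<in> polys (chow_vars M)" "homog j (Abs_poly_mapping f)"
      using f by (auto simp: hom_polys_def polys_def homog_def in_keys_iff)
    then show "f \<in> lookup ` {p \<in> polys (chow_vars M). homog j p}"
      using l by (intro image_eqI[of _ _ "Abs_poly_mapping f"]) auto
  qed
qed

section \<open>Elimination of the variable of the ground set\<close>

context
  fixes M :: "'a matroid"
  assumes ll: "loopless M"
begin

lemma loopless_matroid: "matroid M"
  using ll by (simp only: loopless_def)

lemma loopless_rk: "e \<in> gset M \<Longrightarrow> rk M {e} = 1"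
  using ll unfolding loopless_def by blast

lemma empty_in_flats: "{} \<in> flats M"
  using loopless_rk rk_empty[OF loopless_matroid] by (simp add: flats_def is_flat_def)

lemma finite_chow_vars: "finite (chow_vars M)"
  by (rule finite_subset[OF _ finite_flats[OF loopless_matroid]]) (auto simp: chow_vars_def)

abbreviation (input) "AV \<equiv> {G \<in> flats M. {} \<subset> G}"
abbreviation (input) "CV \<equiv> chow_vars M"
abbreviation (input) "CI \<equiv> idl (polys (chow_vars M)) (lin_gens M)"
abbreviation (input) "FY \<equiv> fy_ideal M {} {G \<in> flats M. {} \<subset> G}"

lemma chow_vars_subset: "CV \<subseteq> AV"
  by (auto simp: chow_vars_def)

lemma all_vars: "gset M \<noteq> {} \<Longrightarrow> AV = insert (gset M) CV"
  using gset_in_flats[of M] by (auto simp: chow_vars_def)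

lemma lin_all:
  assumes "i \<in> gset M"
  shows "lin AV i = lin CV i + Var (gset M)"
proof -
  have "gset M \<notin> CV" by (simp add: chow_vars_def)
  moreover have "gset M \<noteq> {}" using assms by blast
  ultimately show ?thesis
    unfolding all_vars[OF \<open>gset M \<noteq> {}\<close>] using lin_insert[OF finite_chow_vars, of "gset M" i] assms by simp
qed

text \<open>Looplessness makes \<open>{i}\<close> a basis of its closure, so the form of
  \<open>i\<close> is a basis relation.\<close>

lemma lin_all_in_fy:
  assumes "i \<in> gset M"
  shows "lin AV i \<in> FY"
proof -
  have i: "{i} \<subseteq> gset M" using assms by simp
  note c = subset_closure[OF loopless_matroid i] rk_closure[OF loopless_matroid i]
    closure_in_flats[OF loopless_matroid i]
  have "closure M {i} \<in> AV" using c by auto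
  moreover have "rel_basis M {} (closure M {i}) {i}"
    using c(1,2) loopless_rk[OF assms] rk_empty[OF loopless_matroid] by (simp add: rel_basis_def)
  ultimately have "prod (lin AV) {i} \<in> FY" by (rule fy_basis)
  then show ?thesis by simp
qed

text \<open>In the full presentation \<open>y\<^sub>i = 0\<close> expresses the variable of the ground set through the others.\<close>

definition elim_top :: "'a set \<Rightarrow> 'a set mpoly" where
  "elim_top G = (if G = gset M then - lin (chow_vars M) (SOME i. i \<in> gset M) else Var G)"

lemma some_gset: "gset M \<noteq> {} \<Longrightarrow> (SOME i. i \<in> gset M) \<in> gset M"
  by (simp add: some_in_eq)

lemma elim_top_polys: "G \<in> AV \<Longrightarrow> elim_top G \<in> polys CV"
  unfolding elim_top_def
  by (auto simp: chow_vars_def intro!: Var_in_polys subring_uminus[OF subring_polys] lin_in_polys)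

lemma ev_elim_polys: "s \<in> polys AV \<Longrightarrow> ev elim_top s \<in> polys CV"
  by (rule ev_polys) (auto intro: elim_top_polys)

lemma homog_elim_top: "homog 1 (elim_top G)"
  unfolding elim_top_def by (simp del: One_nat_def add: homog_uminus homog_lin homog_Var)

lemma ev_elim_id: "s \<in> polys CV \<Longrightarrow> ev elim_top s = s"
  by (rule ev_eq_self) (auto simp: elim_top_def chow_vars_def)

lemma ideal_CI: "ideal_in (polys CV) CI"
  by (rule ideal_in_idl[OF subring_polys])

text \<open>The element picked by \<open>SOME\<close> is harmless, since forms of any two elements
  differ by a generator of \<open>CI\<close>.\<close>

lemma ev_elim_lin: "i \<in> gset M \<Longrightarrow> ev elim_top (lin AV i) \<in> CI"
proof -
  assume i: "i \<in> gset M"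
  then have "gset M \<noteq> {}" by blast
  then have 0: "(SOME i. i \<in> gset M) \<in> gset M" by (rule some_gset)
  have "ev elim_top (lin AV i) = lin CV i - lin CV (SOME i. i \<in> gset M)"
    unfolding lin_all[OF i] ev_add ev_elim_id[OF lin_in_polys] by (simp add: elim_top_def)
  also have "\<dots> \<in> CI"
    unfolding lin_gens_def using i 0 by (intro idl_base[OF subring_polys] UnI2 CollectI exI conjI) (rule refl)
  finally show ?thesis .
qed

text \<open>Incomparable flats are both proper, so their product is left alone; every other
  generator has some form of a ground set element as a factor.\<close>

lemma ev_elim_fy:
  assumes "x \<in> FY"
  shows "ev elim_top x \<in> CI"
proof -
  have "ideal_in (polys AV) {a. ev elim_top a \<in> CI}"
    unfolding ideal_in_def
  proof (intro conjI ballI; unfold mem_Collect_eq)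
    show "ev elim_top 0 \<in> CI" by (simp add: ideal_0[OF ideal_CI])
    show "ev elim_top (a + b) \<in> CI" if "ev elim_top a \<in> CI" "ev elim_top b \<in> CI" for a b
      unfolding ev_add by (rule ideal_add[OF ideal_CI that])
    show "ev elim_top (s * a) \<in> CI" if "s \<in> polys AV" "ev elim_top a \<in> CI" for s a
      unfolding ev_mult by (rule ideal_mult[OF ideal_CI ev_elim_polys[OF that(1)] that(2)])
  qed
  then have "FY \<subseteq> {a. ev elim_top a \<in> CI}"
    unfolding fy_ideal_def
  proof (rule idl_subset, intro subsetI, unfold mem_Collect_eq[of _ "\<lambda>a. ev elim_top a \<in> CI"])
    fix x assume "x \<in> rels M {} AV"
    then show "ev elim_top x \<in> CI"
    proof (cases rule: relsE)
      case x: (incomparable G H)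
      have sub: "G \<subseteq> gset M" "H \<subseteq> gset M" using x(2,3) flat_subset by blast+
      then have GH: "G \<in> CV" "H \<in> CV" "G \<noteq> gset M" "H \<noteq> gset M"
        using x(2-5) by (auto simp: chow_vars_def)
      then have "ev elim_top x = Var G * Var H"
        unfolding x(1) ev_mult by (simp add: elim_top_def)
      also have "\<dots> \<in> CI"
        unfolding lin_gens_def using GH(1,2) x(4,5)
        by (intro idl_base[OF subring_polys] UnI1 CollectI exI conjI) (rule refl)
      finally show ?thesis .
    next
      case x: (lin_Var i G)
      show ?thesis
        unfolding x(1) ev_mult
        by (rule ideal_mult'[OF ideal_CI _ ev_elim_lin[OF x(2)]]) (simp only: ev_Var elim_top_polys[OF x(3)])
    next
      case x: (basis I G)
      have G: "G \<in> flats M" "{} \<subset> G" using x(2) by auto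
      have fin: "finite I" by (rule rel_basis_finite[OF loopless_matroid x(3) G(1)])
      have "rk M {} < rk M G"
        by (rule flat_rk_less[OF loopless_matroid empty_in_flats flat_subset[OF G(1)] G(2)])
      then have "I \<noteq> {}" using x(3) by (auto simp: rel_basis_def)
      then obtain i where i: "i \<in> I" by blast
      have "i \<in> gset M" using i x(3) flat_subset[OF G(1)] by (auto simp: rel_basis_def)
      from ev_elim_lin[OF this] show ?thesis
        unfolding x(1) prod_lin_remove[OF fin i] ev_mult
        by (rule ideal_mult'[OF ideal_CI ev_elim_polys[OF prod_lin_in_polys]])
    qed
  qed
  then show ?thesis using assms by blast
qed

text \<open>In a difference of two forms the variable of the ground set cancels.\<close>

lemma CI_subset_FY: "CI \<subseteq> FY"
proof (rule idl_subset[OF ideal_in_mono[OF polys_mono[OF chow_vars_subset] ideal_fy]], rule subsetI)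
  fix x assume "x \<in> lin_gens M"
  then consider (1) G H where "x = Var G * Var H" "G \<in> CV" "H \<in> CV" "\<not> G \<subseteq> H" "\<not> H \<subseteq> G"
    | (2) i j where "x = lin CV i - lin CV j" "i \<in> gset M" "j \<in> gset M"
    unfolding lin_gens_def by blast
  then show "x \<in> FY"
  proof cases
    case 1
    have "G \<in> AV" "H \<in> AV" using 1(2,3) chow_vars_subset by blast+
    then show ?thesis
      unfolding 1(1) by (rule fy_incomparable[OF _ _ 1(4,5)])
  next
    case 2
    have "x = lin AV i - lin AV j"
      unfolding 2(1) lin_all[OF 2(2)] lin_all[OF 2(3)] by simp
    also have "\<dots> \<in> FY"
      by (rule ideal_diff[OF subring_polys ideal_fy lin_all_in_fy[OF 2(2)] lin_all_in_fy[OF 2(3)]])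
    finally show ?thesis .
  qed
qed

text \<open>Elimination changes only the variable of the ground set, and does so by a form that lies
  in \<open>FY\<close>.\<close>

lemma diff_ev_elim:
  assumes s: "s \<in> polys AV"
  shows "s - ev elim_top s \<in> FY"
proof -
  have "ev Var s - ev elim_top s \<in> FY"
  proof (rule ev_cong_ideal[OF ideal_fy s])
    fix G assume G: "G \<in> AV"
    show "Var G \<in> polys AV" by (rule Var_in_polys[OF G])
    show "elim_top G \<in> polys AV" using elim_top_polys[OF G] polys_mono[OF chow_vars_subset] by blast
    show "Var G - elim_top G \<in> FY"
    proof (cases "G = gset M")
      case True
      let ?i = "SOME i. i \<in> gset M"
      have i: "?i \<in> gset M" using G True by (intro some_gset) auto
      have "Var G - elim_top G = lin AV ?i"
        unfolding lin_all[OF i] by (simp add: elim_top_def True)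
      then show ?thesis using lin_all_in_fy[OF i] by simp
    qed (simp add: elim_top_def ideal_0[OF ideal_fy])
  qed
  then show ?thesis using ev_eq_self[OF s, of Var] by simp
qed

text \<open>The basis monomials of degree \<open>j\<close>, after elimination, span a complement of
  the ideal's part in \<open>hom_polys M j\<close>. Independence is tested in \<open>FY\<close>,
  spanning in \<open>CI\<close>.\<close>

lemma chow_dim_eq: "int (chow_dim M j) = coeff (fy_poly M {}) j"
proof -
  note fin = finite_chow_vars
  obtain B where B: "finite B" "\<forall>m\<in>B. set_mset m \<subseteq> AV" "monomial_basis (polys AV) FY B"
    "size_poly B = fy_poly M {}"
    using fy_basis_exists[OF loopless_matroid empty_in_flats] by (elim exE conjE) (rule that)
  define J where "J = {m \<in> B. size m = j}"
  define e where "e m = lookup (ev elim_top (single m 1))" for m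
  have J: "finite J" using B(1) by (simp add: J_def)
  let ?V = "hom_polys M j" and ?U = "hom_polys M j \<inter> chow_ideal M"
  let ?T = "(\<lambda>m. lookup (single m 1)) ` multisets_of_size CV j"
  have "?V = {p. \<forall>n. \<not> (size n = j \<and> set_mset n \<subseteq> CV) \<longrightarrow> p n = 0}"
    unfolding hom_polys_def by blast
  then have V_sub: "fun_space.subspace ?V"
    by (simp add: fun_space.subspace_def)
  have U_sub: "fun_space.subspace ?U"
    unfolding chow_ideal_def by (intro fun_space.subspace_inter V_sub fun_space.subspace_span)
  have VT: "?V \<subseteq> fun_space.span ?T"
  proof
    fix v assume "v \<in> ?V"
    then obtain p where p: "v = lookup p" "p \<in> polys CV" "homog j p"
      unfolding hom_polys_eq[OF fin] by blast
    have "p = (\<Sum>m\<in>keys p. single 0 (lookup p m) * single m 1)"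
      by (subst (1) mpoly_expand[of p]) (simp add: mult_single)
    then have "lookup p = lookup (\<Sum>m\<in>keys p. single 0 (lookup p m) * single m 1)"
      by (rule arg_cong)
    also have "\<dots> = (\<Sum>m\<in>keys p. (\<lambda>n. lookup p m * lookup (single m 1) n))"
      by (simp only: lookup_sum_fun lookup_scale)
    also have "\<dots> \<in> fun_space.span ?T"
    proof (rule fun_space.span_sum, rule fun_space.span_scale, rule fun_space.span_base, rule imageI)
      fix m assume "m \<in> keys p"
      then show "m \<in> multisets_of_size CV j"
        using p(2,3) by (simp add: polys_def homog_def multisets_of_size_def)
    qed
    finally show "v \<in> fun_space.span ?T" unfolding p(1) .
  qed
  have finT: "finite ?T" by (rule finite_imageI[OF finite_multisets_of_size[OF fin]])
  have comb: "(\<Sum>m\<in>J. (\<lambda>n. c m * e m n)) = lookup (ev elim_top (\<Sum>m\<in>J. single m (c m)))" for c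
  proof -
    have "ev elim_top (\<Sum>m\<in>J. single m (c m))
        = (\<Sum>m\<in>J. single 0 (c m) * ev elim_top (single m 1))"
      by (simp add: ev_sum ev_single)
    then show ?thesis
      by (simp add: lookup_sum_fun lookup_scale e_def)
  qed
  have J_polys: "(\<Sum>m\<in>J. single m (c m)) \<in> polys AV" for c
    using B(2) by (intro subring_sum[OF subring_polys] single_in_polys) (auto simp: J_def)
  have J_homog: "homog j (\<Sum>m\<in>J. single m (c m))" for c
    by (rule homog_sum) (auto simp: homog_def J_def)
  have J_V: "lookup (ev elim_top (\<Sum>m\<in>J. single m (c m))) \<in> ?V" for c
    unfolding hom_polys_eq[OF fin]
    by (intro imageI CollectI conjI ev_elim_polys[OF J_polys] homog_ev[OF J_homog J_polys] homog_elim_top)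
  have lookup_CI: "lookup p \<in> chow_ideal M \<longleftrightarrow> p \<in> CI" for p
    unfolding chow_ideal_eq[OF fin] by (auto simp: lookup_inject)
  have "fun_space.dim ?V = fun_space.dim ?U + card J"
  proof (rule fun_space.dim_complement[OF U_sub V_sub _ finT VT J, where e = e])
    show "?U \<subseteq> ?V" by blast
    fix m assume m: "m \<in> J"
    then have "homog j (single m 1 :: 'a set mpoly)" "single m 1 \<in> polys AV"
      using B(2) by (auto simp: J_def homog_def intro!: single_in_polys)
    then show "e m \<in> ?V"
      unfolding hom_polys_eq[OF fin] e_def
      by (intro imageI CollectI conjI ev_elim_polys homog_ev homog_elim_top)
  next
    fix c assume "(\<Sum>m\<in>J. (\<lambda>n. c m * e m n)) \<in> ?U"
    let ?r = "\<Sum>m\<in>J. single m (c m)"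
    have "ev elim_top ?r \<in> CI"
      using \<open>_ \<in> ?U\<close> unfolding comb by (simp add: lookup_CI)
    then have 1: "ev elim_top ?r \<in> FY" using CI_subset_FY by blast
    have "(?r - ev elim_top ?r) + ev elim_top ?r \<in> FY"
      by (rule ideal_add[OF ideal_fy diff_ev_elim[OF J_polys] 1])
    then have "?r \<in> FY" by simp
    moreover have "keys ?r \<subseteq> B"
      using Poly_Mapping.keys_sum[of "\<lambda>m. single m (c m)" J] by (auto simp: J_def split: if_splits)
    ultimately have r0: "?r = 0" using B(3) by (simp add: monomial_basis_def)
    have "lookup ?r m = c m" if "m \<in> J" for m
      using J that by (simp add: lookup_sum lookup_single when_def)
    then show "\<forall>m\<in>J. c m = 0" unfolding r0 by simp
  next
    fix v assume v: "v \<in> ?V"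
    then obtain p where p: "v = lookup p" "p \<in> polys CV" "homog j p"
      unfolding hom_polys_eq[OF fin] by blast
    have pA: "p \<in> polys AV" using p(2) polys_mono[OF chow_vars_subset] by blast
    obtain r where r: "keys r \<subseteq> B" "p - r \<in> FY"
      using B(3) pA unfolding monomial_basis_def by blast
    \<comment> \<open>\<open>FY\<close> is homogeneous, so the terms of \<open>r\<close> in other
      degrees may be discarded.\<close>
    have "p - hpart j r \<in> FY"
      using hpart_fy[OF r(2), of j] hpart_homog[OF p(3), of j] by (simp add: hpart_diff)
    then have 1: "p - ev elim_top (hpart j r) \<in> CI"
      using ev_elim_fy[of "p - hpart j r"] ev_elim_id[OF p(2)] by (simp add: ev_diff)
    have "hpart j r = (\<Sum>m\<in>J. single m (lookup r m))"
      unfolding hpart_def by (rule sum.mono_neutral_left) (use J r(1) in \<open>auto simp: J_def in_keys_iff\<close>)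
    then have 2: "p - ev elim_top (\<Sum>m\<in>J. single m (lookup r m)) \<in> CI" using 1 by simp
    have eq: "v - (\<Sum>m\<in>J. (\<lambda>n. lookup r m * e m n))
        = lookup (p - ev elim_top (\<Sum>m\<in>J. single m (lookup r m)))"
      unfolding comb p(1) by (auto simp: fun_eq_iff lookup_minus)
    have "v - (\<Sum>m\<in>J. (\<lambda>n. lookup r m * e m n)) \<in> ?V"
      by (rule fun_space.subspace_diff[OF V_sub v]) (simp only: comb J_V)
    moreover have "v - (\<Sum>m\<in>J. (\<lambda>n. lookup r m * e m n)) \<in> chow_ideal M"
      unfolding eq lookup_CI by (rule 2)
    ultimately show "\<exists>c. v - (\<Sum>m\<in>J. (\<lambda>n. c m * e m n)) \<in> ?U" by blast
  qed
  \<comment> \<open>The equation just proved makes the truncated subtraction in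
    \<open>chow_dim\<close> exact.\<close>
  then have "chow_dim M j = card J" by (simp add: chow_dim_def)
  moreover have "coeff (size_poly B) j = int (card J)"
    unfolding size_poly_def coeff_sum J_def using B(1) by (simp add: sum.If_cases Int_def)
  ultimately show ?thesis using B(4) by simp
qed

lemma chow_fps_eq: "chow_fps M = fps_of_poly (fy_poly M {})"
  by (rule fps_ext) (simp add: chow_fps_def chow_dim_eq)

end

section \<open>Restriction, contraction and the Moebius function\<close>

text \<open>Each recursive call passes to a proper subset of \<open>y\<close>, so
  \<open>card y\<close> units of fuel suffice.\<close>

lemma mob_aux_fuel:
  assumes "finite y" "card y \<le> n" "card y \<le> n'"
  shows "mob_aux n P x y = mob_aux n' P x y"
  using assms
proof (induction n arbitrary: n' y)
  case 0
  then have "y = {}" by simp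
  then show ?case by (cases n') auto
next
  case (Suc n)
  show ?case
  proof (cases n')
    case 0
    then have "y = {}" using Suc.prems by simp
    then show ?thesis by (simp add: 0)
  next
    case n': (Suc k)
    have "mob_aux n P x z = mob_aux k P x z" if "z \<subset> y" for z
    proof (rule Suc.IH)
      show "finite z" using that Suc.prems(1) finite_subset by blast
      have "card z < card y" by (rule psubset_card_mono[OF Suc.prems(1) that])
      then show "card z \<le> n" "card z \<le> k" using Suc.prems n' by auto
    qed
    then have "(\<Sum>z\<in>{z \<in> P. x \<subseteq> z \<and> z \<subset> y}. mob_aux n P x z)
        = (\<Sum>z\<in>{z \<in> P. x \<subseteq> z \<and> z \<subset> y}. mob_aux k P x z)"
      by (intro sum.cong) auto
    then show ?thesis by (simp add: n')
  qed
qed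

lemma mobius_empty_bot: "mobius P {} {} = 1"
  by (simp add: mobius_def)

lemma mobius_rec:
  assumes "finite y" "y \<noteq> {}"
  shows "mobius P {} y = - (\<Sum>z\<in>{z \<in> P. z \<subset> y}. mobius P {} z)"
proof -
  obtain n where n: "card y = Suc n"
    using assms by (metis card_eq_0_iff not0_implies_Suc)
  have "mob_aux n P {} z = mobius P {} z" if z: "z \<subset> y" for z
  proof -
    have "finite z" using z assms(1) finite_subset by blast
    moreover have "card z \<le> n" using psubset_card_mono[OF assms(1) z] n by simp
    ultimately show ?thesis unfolding mobius_def by (intro mob_aux_fuel) auto
  qed
  then have "(\<Sum>z\<in>{z \<in> P. z \<subset> y}. mob_aux n P {} z) = (\<Sum>z\<in>{z \<in> P. z \<subset> y}. mobius P {} z)"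
    by (intro sum.cong) auto
  then show ?thesis
    using assms(2) by (simp add: mobius_def[of P "{}" y] n)
qed

lemma mobius_sum:
  assumes "finite P" "{} \<in> P" "y \<in> P" "finite y"
  shows "(\<Sum>z\<in>{z \<in> P. z \<subseteq> y}. mobius P {} z) = (if y = {} then 1 else 0)"
proof (cases "y = {}")
  case True
  then have "{z \<in> P. z \<subseteq> y} = {{}}" using assms(2) by auto
  then show ?thesis using True by (simp add: mobius_empty_bot)
next
  case False
  have "{z \<in> P. z \<subseteq> y} = insert y {z \<in> P. z \<subset> y}" using assms(3) by auto
  then show ?thesis
    using assms(1) False by (simp add: mobius_rec[OF assms(4) False])
qed

text \<open>The recursion visits only subsets of \<open>y\<close>, where the two posets
  agree.\<close>

lemma mobius_cong_below:
  assumes "\<And>z. z \<subseteq> F \<Longrightarrow> z \<in> P \<longleftrightarrow> z \<in> Q" "y \<subseteq> F"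
  shows "mobius P x y = mobius Q x y"
proof -
  have "mob_aux n P x y = mob_aux n Q x y" for n
    using assms(2)
  proof (induction n arbitrary: y)
    case (Suc n)
    have "(\<Sum>z\<in>{z \<in> P. x \<subseteq> z \<and> z \<subset> y}. mob_aux n P x z)
        = (\<Sum>z\<in>{z \<in> Q. x \<subseteq> z \<and> z \<subset> y}. mob_aux n Q x z)"
    proof (rule sum.cong)
      show "{z \<in> P. x \<subseteq> z \<and> z \<subset> y} = {z \<in> Q. x \<subseteq> z \<and> z \<subset> y}"
        using assms(1) Suc.prems by (intro Collect_cong) (meson psubsetE subset_trans)
      fix z assume "z \<in> {z \<in> Q. x \<subseteq> z \<and> z \<subset> y}"
      then show "mob_aux n P x z = mob_aux n Q x z"
        using Suc.prems by (intro Suc.IH) auto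
    qed
    then show ?case by simp
  qed simp
  then show ?thesis by (simp add: mobius_def)
qed

section \<open>Restriction to and contraction by a flat\<close>

lemma gset_restrict: "gset (restrict M F) = F"
  by (simp add: gset_def restrict_def)

lemma rk_restrict: "rk (restrict M F) A = rk M (A \<inter> F)"
  by (simp add: rk_def restrict_def)

lemma gset_contract: "gset (contract M F) = gset M - F"
  by (simp add: gset_def contract_def)

lemma rk_contract: "rk (contract M F) A = rk M (A \<inter> (gset M - F) \<union> F) - rk M F"
  by (simp add: rk_def contract_def gset_def)

lemma rk_contract_subset:
  "A \<subseteq> gset M - F \<Longrightarrow> rk (contract M F) A = rk M (A \<union> F) - rk M F"
  by (simp add: rk_contract Int_absorb2)

text \<open>An element outside \<open>F\<close> that is spanned by \<open>G \<subseteq> F\<close>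
  would be spanned by \<open>F\<close>, against \<open>F\<close> being a flat.\<close>

lemma flats_restrict:
  assumes M: "matroid M" and F: "F \<in> flats M"
  shows "flats (restrict M F) = {G \<in> flats M. G \<subseteq> F}"
proof (intro equalityI subsetI)
  fix G assume "G \<in> flats (restrict M F)"
  then have G: "G \<subseteq> F" "\<And>e. e \<in> F - G \<Longrightarrow> rk M (G \<inter> F) < rk M (insert e G \<inter> F)"
    by (simp_all add: flats_def is_flat_def gset_restrict rk_restrict)
  have GF: "G \<inter> F = G" using G(1) by blast
  have "rk M G < rk M (insert e G)" if e: "e \<in> gset M - G" for e
  proof (cases "e \<in> F")
    case True
    then have "insert e G \<inter> F = insert e G" using G(1) by blast
    then show ?thesis using G(2)[of e] True e GF by simp
  next
    case False
    show ?thesis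
    proof (rule ccontr)
      assume "\<not> ?thesis"
      then have "rk M (insert e G) = rk M G" using rk_insert_ge[OF M, of G e] by linarith
      then have "rk M (insert e F) = rk M F" by (rule rk_insert_mono[OF M G(1)])
      then show False using flat_insert[OF M F, of e] e False by simp
    qed
  qed
  then have "is_flat M G"
    using G(1) flat_subset[OF F] unfolding is_flat_def by (intro conjI ballI) auto
  then show "G \<in> {G \<in> flats M. G \<subseteq> F}" using G(1) by (simp add: flats_def)
next
  fix G assume "G \<in> {G \<in> flats M. G \<subseteq> F}"
  then have G: "G \<in> flats M" "G \<subseteq> F" by simp_all
  have "rk M (G \<inter> F) < rk M (insert e G \<inter> F)" if e: "e \<in> F - G" for e
  proof -
    have "G \<inter> F = G" "insert e G \<inter> F = insert e G" using G(2) e by blast+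
    then show ?thesis using flat_insert[OF M G(1), of e] e flat_subset[OF F] by auto
  qed
  then show "G \<in> flats (restrict M F)"
    using G(2) by (simp add: flats_def is_flat_def gset_restrict rk_restrict)
qed

lemma char_poly_restrict:
  assumes M: "matroid M" and F: "F \<in> flats M"
  shows "char_poly (restrict M F)
    = (\<Sum>G\<in>{G \<in> flats M. G \<subseteq> F}. monom (mobius (flats M) {} G) (rk M F - rk M G))"
  unfolding char_poly_def flats_restrict[OF M F]
proof (rule sum.cong[OF refl])
  fix G assume G: "G \<in> {G \<in> flats M. G \<subseteq> F}"
  have "mobius {G \<in> flats M. G \<subseteq> F} {} G = mobius (flats M) {} G"
    by (rule mobius_cong_below[of F]) (use G in auto)
  moreover have "G \<inter> F = G" using G by blast
  ultimately show "monom (mobius {G \<in> flats M. G \<subseteq> F} {} G) (mrank (restrict M F) - rk (restrict M F) G)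
      = monom (mobius (flats M) {} G) (rk M F - rk M G)"
    by (simp add: mrank_def gset_restrict rk_restrict)
qed

lemma matroid_contract:
  assumes M: "matroid M" and F: "F \<subseteq> gset M"
  shows "matroid (contract M F)"
  unfolding matroid_def gset_contract
proof (intro conjI allI impI)
  show "finite (gset M - F)" using finite_gset[OF M] by simp
  fix A B
  have "A \<inter> (gset M - F) \<inter> (gset M - F) = A \<inter> (gset M - F)" by blast
  then show "rk (contract M F) A = rk (contract M F) (A \<inter> (gset M - F))"
    by (simp only: rk_contract)
  \<comment> \<open>This makes the truncated subtractions in the contracted ranks exact.\<close>
  have ge: "rk M F \<le> rk M (C \<union> F)" for C by (rule rk_mono[OF M]) blast
  show "rk (contract M F) A \<le> card A" if A: "A \<subseteq> gset M - F"
  proof -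
    have "finite A" using A finite_gset[OF M] finite_subset by blast
    from rk_Un_le[OF M this, of F] show ?thesis
      unfolding rk_contract_subset[OF A] by (simp add: Un_commute)
  qed
  show "rk (contract M F) A \<le> rk (contract M F) B" if "A \<subseteq> B" "B \<subseteq> gset M - F"
  proof -
    have "rk M (A \<union> F) \<le> rk M (B \<union> F)" using that(1) by (intro rk_mono[OF M]) blast
    then show ?thesis
      using that rk_contract_subset[of A M F] rk_contract_subset[of B M F] by simp
  qed
  show "rk (contract M F) (A \<union> B) + rk (contract M F) (A \<inter> B) \<le> rk (contract M F) A + rk (contract M F) B"
    if AB: "A \<subseteq> gset M - F" "B \<subseteq> gset M - F"
  proof -
    have "rk M ((A \<union> F) \<union> (B \<union> F)) + rk M ((A \<union> F) \<inter> (B \<union> F)) \<le> rk M (A \<union> F) + rk M (B \<union> F)"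
      by (rule rk_submodular[OF M])
    moreover have "(A \<union> F) \<union> (B \<union> F) = (A \<union> B) \<union> F" "(A \<union> F) \<inter> (B \<union> F) = (A \<inter> B) \<union> F"
      by blast+
    ultimately have le: "rk M ((A \<union> B) \<union> F) + rk M ((A \<inter> B) \<union> F) \<le> rk M (A \<union> F) + rk M (B \<union> F)"
      by (simp only:)
    have sub: "A \<union> B \<subseteq> gset M - F" "A \<inter> B \<subseteq> gset M - F" using AB by blast+
    show ?thesis
      unfolding rk_contract_subset[OF AB(1)] rk_contract_subset[OF AB(2)]
        rk_contract_subset[OF sub(1)] rk_contract_subset[OF sub(2)]
      using le ge[of A] ge[of B] ge[of "A \<union> B"] ge[of "A \<inter> B"] by linarith
  qed
qed

text \<open>A loop would be an element outside \<open>F\<close> that does not raise its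
  rank.\<close>

lemma loopless_contract:
  assumes M: "matroid M" and F: "F \<in> flats M"
  shows "loopless (contract M F)"
  unfolding loopless_def
proof (intro conjI ballI)
  show "matroid (contract M F)" by (rule matroid_contract[OF M flat_subset[OF F]])
  fix e assume "e \<in> gset (contract M F)"
  then have e: "e \<in> gset M" "e \<notin> F" by (simp_all add: gset_contract)
  then show "rk (contract M F) {e} = 1"
    using rk_contract_subset[of "{e}" M F] flat_insert[OF M F e] by simp
qed

lemma flats_contract_iff:
  assumes M: "matroid M" and F: "F \<in> flats M"
  shows "H \<in> flats (contract M F) \<longleftrightarrow> H \<subseteq> gset M - F \<and> H \<union> F \<in> flats M"
proof (cases "H \<subseteq> gset M - F")
  case True
  have ge: "rk M F \<le> rk M (H \<union> F)" by (rule rk_mono[OF M]) blast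
  have "rk (contract M F) H < rk (contract M F) (insert e H) \<longleftrightarrow> rk M (H \<union> F) < rk M (insert e (H \<union> F))"
    if e: "e \<in> gset M - F - H" for e
  proof -
    have "insert e H \<subseteq> gset M - F" using e True by blast
    moreover have "insert e H \<union> F = insert e (H \<union> F)" by blast
    ultimately have "rk (contract M F) (insert e H) = rk M (insert e (H \<union> F)) - rk M F"
      using rk_contract_subset by metis
    then show ?thesis
      using rk_contract_subset[OF True] ge rk_insert_ge[OF M, of "H \<union> F" e] by linarith
  qed
  moreover have "gset M - F - H = gset M - (H \<union> F)" by blast
  ultimately show ?thesis
    using True flat_subset[OF F] by (auto simp: flats_def is_flat_def gset_contract)
next
  case False
  then show ?thesis using flat_subset[of H "contract M F"] by (auto simp: gset_contract)
qed

text \<open>Adding \<open>F\<close> maps the flats of the contraction bijectively to the flats above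
  \<open>F\<close> and preserves rank differences, so both recursions coincide.\<close>

lemma fy_poly_contract:
  assumes M: "matroid M" and F: "F \<in> flats M" and "H \<in> flats (contract M F)"
  shows "fy_poly (contract M F) H = fy_poly M (H \<union> F)"
  using assms(3)
proof (induction "card (gset M - H)" arbitrary: H rule: less_induct)
  case less
  note N = matroid_contract[OF M flat_subset[OF F]]
  let ?N = "contract M F"
  have H: "H \<subseteq> gset M - F" "H \<union> F \<in> flats M"
    using less.prems flats_contract_iff[OF M F] by blast+
  have "(\<Sum>H'\<in>{H' \<in> flats ?N. H \<subset> H'}. (\<Sum>k\<in>{1..<rk ?N H' - rk ?N H}. monom 1 k) * fy_poly ?N H')
     = (\<Sum>G\<in>{G \<in> flats M. H \<union> F \<subset> G}. (\<Sum>k\<in>{1..<rk M G - rk M (H \<union> F)}. monom 1 k) * fy_poly M G)"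
  proof (rule sum.reindex_bij_witness[where j = "\<lambda>H'. H' \<union> F" and i = "\<lambda>G. G - F"])
    fix H' assume "H' \<in> {H' \<in> flats ?N. H \<subset> H'}"
    then have H': "H' \<in> flats ?N" "H \<subset> H'" "H' \<subseteq> gset M - F" "H' \<union> F \<in> flats M"
      using flats_contract_iff[OF M F] by auto
    show "H' \<union> F - F = H'" using H'(3) by blast
    show "H' \<union> F \<in> {G \<in> flats M. H \<union> F \<subset> G}" using H' by blast
    have "card (gset M - H') < card (gset M - H)"
      by (rule psubset_card_mono) (use finite_gset[OF M] H' in auto)
    then have "fy_poly ?N H' = fy_poly M (H' \<union> F)" by (rule less.hyps[OF _ H'(1)])
    moreover have "rk ?N H' - rk ?N H = rk M (H' \<union> F) - rk M (H \<union> F)"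
      using rk_contract_subset[OF H'(3)] rk_contract_subset[OF H(1)] rk_mono[OF M, of F "H \<union> F"] by auto
    ultimately show "(\<Sum>k\<in>{1..<rk M (H' \<union> F) - rk M (H \<union> F)}. monom 1 k) * fy_poly M (H' \<union> F)
       = (\<Sum>k\<in>{1..<rk ?N H' - rk ?N H}. monom 1 k) * fy_poly ?N H'" by simp
  next
    fix G assume "G \<in> {G \<in> flats M. H \<union> F \<subset> G}"
    then have G: "G \<in> flats M" "H \<union> F \<subset> G" by simp_all
    have eq: "G - F \<union> F = G" using G(2) by blast
    show "G - F \<union> F = G" by (rule eq)
    have "G - F \<in> flats ?N"
      unfolding flats_contract_iff[OF M F] eq using G(1) flat_subset[OF G(1)] by blast
    moreover have "H \<subset> G - F" using G(2) H(1) by blast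
    ultimately show "G - F \<in> {H' \<in> flats ?N. H \<subset> H'}" by blast
  qed
  then show ?case
    unfolding fy_poly_rec[OF N, of H] fy_poly_rec[OF M, of "H \<union> F"] by simp
qed

lemma chow_fps_contract:
  assumes M: "matroid M" and F: "F \<in> flats M"
  shows "chow_fps (contract M F) = fps_of_poly (fy_poly M F)"
proof -
  note L = loopless_contract[OF M F]
  have "fy_poly (contract M F) {} = fy_poly M F"
    using fy_poly_contract[OF M F empty_in_flats[OF L]] by simp
  then show ?thesis using chow_fps_eq[OF L] by simp
qed

section \<open>The recursion\<close>

lemma geometric_gap:
  fixes x :: "'r::comm_ring_1"
  assumes "1 \<le> d"
  shows "(1 - x) * (\<Sum>k\<in>{1..<d}. x ^ k) = x - x ^ d"
  using assms
proof (induction d rule: dec_induct)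
  case (step n)
  have "{1..<Suc n} = insert n {1..<n}" using step.hyps by auto
  then have "(1 - x) * (\<Sum>k\<in>{1..<Suc n}. x ^ k) = (1 - x) * x ^ n + (1 - x) * (\<Sum>k\<in>{1..<n}. x ^ k)"
    by (simp add: distrib_left)
  also have "\<dots> = x - x ^ Suc n"
    unfolding step.IH by (simp add: algebra_simps)
  finally show ?case .
qed simp

text \<open>Multiplication by \<open>1 - x\<close> collapses the geometric sums. The summand for
  \<open>F = Z\<close> has exponent \<open>0\<close> and absorbs
  \<open>(1 - x) H(Z)\<close>.\<close>

lemma fy_poly_interval_sum:
  fixes x :: "int poly"
  assumes M: "matroid M" and Z: "Z \<in> flats M"
  defines "x \<equiv> monom 1 1"
  shows "(\<Sum>F\<in>{F \<in> flats M. Z \<subseteq> F}. (x ^ (rk M F - rk M Z) - x) * fy_poly M F) = 1 - x"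
proof -
  let ?A = "{F \<in> flats M. Z \<subset> F}"
  have fin: "finite ?A" using finite_flats[OF M] by simp
  have mx: "monom 1 = (^) x" by (rule ext) (simp add: x_def monom_power)
  define a where "a F = (\<Sum>k\<in>{1..<rk M F - rk M Z}. x ^ k)" for F
  have "fy_poly M Z = 1 + (\<Sum>F\<in>?A. a F * fy_poly M F)"
    by (subst fy_poly_rec[OF M]) (simp only: mx a_def)
  then have "(1 - x) * fy_poly M Z = (1 - x) + (\<Sum>F\<in>?A. ((1 - x) * a F) * fy_poly M F)"
    by (simp only: distrib_left mult_1_right sum_distrib_left mult.assoc)
  also have "(\<Sum>F\<in>?A. ((1 - x) * a F) * fy_poly M F)
      = (\<Sum>F\<in>?A. (x - x ^ (rk M F - rk M Z)) * fy_poly M F)"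
  proof (rule sum.cong[OF refl])
    fix F assume F: "F \<in> ?A"
    then have "rk M Z < rk M F" using flat_rk_less[OF M Z flat_subset, of F] by auto
    then have "1 \<le> rk M F - rk M Z" by simp
    then show "((1 - x) * a F) * fy_poly M F = (x - x ^ (rk M F - rk M Z)) * fy_poly M F"
      unfolding a_def by (simp only: geometric_gap)
  qed
  also have "\<dots> = - (\<Sum>F\<in>?A. (x ^ (rk M F - rk M Z) - x) * fy_poly M F)"
    unfolding sum_negf[symmetric] by (rule sum.cong) (simp_all add: algebra_simps)
  finally have 1: "(1 - x) * fy_poly M Z
      = (1 - x) - (\<Sum>F\<in>?A. (x ^ (rk M F - rk M Z) - x) * fy_poly M F)" by simp
  have "{F \<in> flats M. Z \<subseteq> F} = insert Z ?A" using Z by auto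
  then have "(\<Sum>F\<in>{F \<in> flats M. Z \<subseteq> F}. (x ^ (rk M F - rk M Z) - x) * fy_poly M F)
      = (1 - x) * fy_poly M Z + (\<Sum>F\<in>?A. (x ^ (rk M F - rk M Z) - x) * fy_poly M F)"
    using fin by simp
  then show ?thesis using 1 by simp
qed

text \<open>The value at \<open>1\<close> is a full Moebius sum over a nontrivial interval and
  vanishes, so the division in \<open>red_char_poly\<close> is exact.\<close>

lemma char_poly_restrict_eq:
  assumes L: "loopless M" and F: "F \<in> flats M" "F \<noteq> {}"
  shows "char_poly (restrict M F) = [:-1, 1:] * red_char_poly (restrict M F)"
proof -
  note M = loopless_matroid[OF L]
  have "poly (char_poly (restrict M F)) 1 = (\<Sum>G\<in>{G \<in> flats M. G \<subseteq> F}. mobius (flats M) {} G)"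
    unfolding char_poly_restrict[OF M F(1)] by (simp add: poly_sum poly_monom)
  also have "\<dots> = 0"
    using mobius_sum[OF finite_flats[OF M] empty_in_flats[OF L] F(1) finite_flat[OF M F(1)]] F(2) by simp
  finally have "[:-1, 1:] dvd char_poly (restrict M F)"
    by (simp add: poly_eq_0_iff_dvd)
  from dvd_mult_div_cancel[OF this] show ?thesis
    using F(2) by (simp only: red_char_poly_def gset_restrict if_False)
qed

lemma fy_poly_recursion:
  assumes L: "loopless M" and E: "gset M \<noteq> {}"
  shows "fy_poly M {} = (\<Sum>F\<in>flats M - {{}}. red_char_poly (restrict M F) * fy_poly M F)"
proof -
  note M = loopless_matroid[OF L]
  note fin = finite_flats[OF M] and bot = empty_in_flats[OF L]
  define x :: "int poly" where "x = monom 1 1"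
  define \<mu> :: "'a set \<Rightarrow> int poly" where "\<mu> G = of_int (mobius (flats M) {} G)" for G
  have mobius_sum': "(\<Sum>G\<in>{G \<in> flats M. G \<subseteq> F}. \<mu> G) = (if F = {} then 1 else 0)" if "F \<in> flats M" for F
    using mobius_sum[OF fin bot that finite_flat[OF M that]]
    unfolding \<mu>_def of_int_sum[symmetric] by simp
  have chi: "(\<Sum>G\<in>{G \<in> flats M. G \<subseteq> F}. \<mu> G * x ^ (rk M F - rk M G)) = char_poly (restrict M F)"
    if "F \<in> flats M" for F
    unfolding char_poly_restrict[OF M that]
    by (rule sum.cong) (simp_all add: \<mu>_def x_def monom_power of_int_poly smult_monom)
  \<comment> \<open>The Moebius values of all flats sum to zero. Each factor \<open>1 - x\<close> is
    then replaced by the interval sum for \<open>G\<close>.\<close>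
  have "0 = (\<Sum>G\<in>{G \<in> flats M. G \<subseteq> gset M}. \<mu> G) * (1 - x)"
    using mobius_sum'[OF gset_in_flats] E by simp
  also have "{G \<in> flats M. G \<subseteq> gset M} = flats M" using flat_subset by blast
  also have "(\<Sum>G\<in>flats M. \<mu> G) * (1 - x) = (\<Sum>G\<in>flats M. \<Sum>F\<in>{F \<in> flats M. G \<subseteq> F}.
      \<mu> G * ((x ^ (rk M F - rk M G) - x) * fy_poly M F))"
    unfolding sum_distrib_right sum_distrib_left[symmetric]
    by (rule sum.cong) (simp_all only: fy_poly_interval_sum[OF M] x_def)
  also have "\<dots> = (\<Sum>F\<in>flats M. \<Sum>G\<in>{G \<in> flats M. G \<subseteq> F}.
      \<mu> G * ((x ^ (rk M F - rk M G) - x) * fy_poly M F))"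
    by (rule sum.swap_restrict[OF fin fin])
  \<comment> \<open>After the exchange of summations, the terms with \<open>x\<close> form a Moebius
    sum below \<open>F\<close>, which survives only for the empty flat.\<close>
  also have "\<dots> = (\<Sum>F\<in>flats M. (char_poly (restrict M F) - (if F = {} then x else 0)) * fy_poly M F)"
  proof (rule sum.cong[OF refl])
    fix F assume F: "F \<in> flats M"
    have "(\<Sum>G\<in>{G \<in> flats M. G \<subseteq> F}. \<mu> G * ((x ^ (rk M F - rk M G) - x) * fy_poly M F))
       = ((\<Sum>G\<in>{G \<in> flats M. G \<subseteq> F}. \<mu> G * x ^ (rk M F - rk M G))
          - (\<Sum>G\<in>{G \<in> flats M. G \<subseteq> F}. \<mu> G) * x) * fy_poly M F"
      by (simp add: sum_distrib_right sum_distrib_left sum_subtractf algebra_simps)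
    also have "\<dots> = (char_poly (restrict M F) - (if F = {} then x else 0)) * fy_poly M F"
      by (simp only: chi[OF F] mobius_sum'[OF F]) simp
    finally show "(\<Sum>G\<in>{G \<in> flats M. G \<subseteq> F}. \<mu> G * ((x ^ (rk M F - rk M G) - x) * fy_poly M F))
       = (char_poly (restrict M F) - (if F = {} then x else 0)) * fy_poly M F" .
  qed
  also have "\<dots> = (char_poly (restrict M {}) - x) * fy_poly M {}
      + (\<Sum>F\<in>flats M - {{}}. (char_poly (restrict M F) - (if F = {} then x else 0)) * fy_poly M F)"
    unfolding sum.remove[OF fin bot] by (simp only: refl if_True)
  also have "char_poly (restrict M {}) = 1"
  proof -
    have "{G \<in> flats M. G \<subseteq> {}} = {{}}" using bot by auto
    then show ?thesis
      unfolding char_poly_restrict[OF M bot] by (simp add: mobius_empty_bot)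
  qed
  also have "(\<Sum>F\<in>flats M - {{}}. (char_poly (restrict M F) - (if F = {} then x else 0)) * fy_poly M F)
      = [:-1, 1:] * (\<Sum>F\<in>flats M - {{}}. red_char_poly (restrict M F) * fy_poly M F)"
    unfolding sum_distrib_left
  proof (rule sum.cong[OF refl])
    fix F assume "F \<in> flats M - {{}}"
    then have F: "F \<in> flats M" "F \<noteq> {}" by auto
    show "(char_poly (restrict M F) - (if F = {} then x else 0)) * fy_poly M F
        = [:-1, 1:] * (red_char_poly (restrict M F) * fy_poly M F)"
      unfolding char_poly_restrict_eq[OF L F] using F(2) by (simp only: if_False diff_0_right mult.assoc)
  qed
  \<comment> \<open>The empty flat contributes \<open>(1 - x) H(\<emptyset>)\<close>; moved to the
    other side, it has the common factor \<open>x - 1\<close>, which can be cancelled.\<close>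
  also have "1 - x = - [:-1, 1:]" by (simp add: x_def monom_altdef one_pCons)
  finally have "[:-1, 1:] * fy_poly M {}
      = [:-1, 1:] * (\<Sum>F\<in>flats M - {{}}. red_char_poly (restrict M F) * fy_poly M F)"
    by (simp only: mult_minus_left)
  then show ?thesis by (simp only: mult_cancel_left) simp
qed

section \<open>Transfer to the Chow series and uniqueness\<close>

lemma chow_fps_recursion:
  assumes L: "loopless M" and E: "gset M \<noteq> {}"
  shows "chow_fps M = (\<Sum>F\<in>flats M - {{}}. fps_of_poly (red_char_poly (restrict M F)) * chow_fps (contract M F))"
proof -
  have "chow_fps M = (\<Sum>F\<in>flats M - {{}}. fps_of_poly (red_char_poly (restrict M F)) * fps_of_poly (fy_poly M F))"
    unfolding chow_fps_eq[OF L] fy_poly_recursion[OF L E] by (simp add: fps_of_poly_sum fps_of_poly_mult)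
  also have "\<dots> = (\<Sum>F\<in>flats M - {{}}. fps_of_poly (red_char_poly (restrict M F)) * chow_fps (contract M F))"
    by (rule sum.cong) (simp_all add: chow_fps_contract[OF loopless_matroid[OF L]])
  finally show ?thesis .
qed

lemma loopless_mrank_eq_0:
  assumes L: "loopless M" and "mrank M = 0"
  shows "gset M = {}"
proof (rule ccontr)
  assume "gset M \<noteq> {}"
  then obtain e where e: "e \<in> gset M" by blast
  then have "rk M {e} \<le> mrank M"
    unfolding mrank_def by (intro rk_mono[OF loopless_matroid[OF L]]) simp
  then show False using loopless_rk[OF L e] assms(2) by simp
qed

lemma chow_fps_mrank_0:
  assumes L: "loopless M" and "mrank M = 0"
  shows "chow_fps M = 1"
proof -
  have "{F \<in> flats M. {} \<subset> F} = {}"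
    using loopless_mrank_eq_0[OF assms] flat_subset[of _ M] by auto
  then have "fy_poly M {} = 1"
    unfolding fy_poly_rec[OF loopless_matroid[OF L], of "{}"] by (simp only: sum.empty add_0_right)
  then show ?thesis by (simp add: chow_fps_eq[OF L])
qed

text \<open>Contraction by a nonempty flat shrinks the ground set, so the recursion determines all
  values.\<close>

lemma chow_fps_unique:
  fixes h :: "'a matroid \<Rightarrow> int poly"
  assumes h0: "\<And>M. loopless M \<Longrightarrow> mrank M = 0 \<Longrightarrow> h M = 1"
    and h1: "\<And>M. loopless M \<Longrightarrow> mrank M \<noteq> 0 \<Longrightarrow>
      h M = (\<Sum>F\<in>flats M - {{}}. red_char_poly (restrict M F) * h (contract M F))"
    and "loopless M"
  shows "fps_of_poly (h M) = chow_fps M"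
  using assms(3)
proof (induction "card (gset M)" arbitrary: M rule: less_induct)
  case less
  note M = loopless_matroid[OF less.prems]
  show ?case
  proof (cases "mrank M = 0")
    case True
    then show ?thesis by (simp add: h0[OF less.prems] chow_fps_mrank_0[OF less.prems])
  next
    case False
    then have E: "gset M \<noteq> {}" using rk_empty[OF M] by (auto simp: mrank_def)
    have IH: "fps_of_poly (h (contract M F)) = chow_fps (contract M F)" if "F \<in> flats M - {{}}" for F
    proof (rule less.hyps)
      have F: "F \<in> flats M" "F \<noteq> {}" using that by auto
      show "loopless (contract M F)" by (rule loopless_contract[OF M F(1)])
      have "gset M - F \<subset> gset M" using F(2) flat_subset[OF F(1)] by blast
      then show "card (gset (contract M F)) < card (gset M)"
        unfolding gset_contract by (rule psubset_card_mono[OF finite_gset[OF M]])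
    qed
    have "fps_of_poly (h M)
        = (\<Sum>F\<in>flats M - {{}}. fps_of_poly (red_char_poly (restrict M F)) * fps_of_poly (h (contract M F)))"
      unfolding h1[OF less.prems False] by (simp add: fps_of_poly_sum fps_of_poly_mult)
    also have "\<dots> = (\<Sum>F\<in>flats M - {{}}. fps_of_poly (red_char_poly (restrict M F)) * chow_fps (contract M F))"
      by (rule sum.cong) (simp_all only: IH)
    also have "\<dots> = chow_fps M" by (rule chow_fps_recursion[OF less.prems E, symmetric])
    finally show ?thesis .
  qed
qed

text \<open>\<open>chow_fps\<close> is a power series; the second conjunct makes it a polynomial, so
  the identity is one of polynomials and the assignment belongs to the class in which the last
  conjunct asserts uniqueness.\<close>

theorem theorem1p4:
  shows "(\<forall>M :: 'a matroid. loopless M \<and> gset M \<noteq> {} \<longrightarrow>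
            chow_fps M = (\<Sum>F \<in> flats M - {{}}.
               fps_of_poly (red_char_poly (restrict M F)) * chow_fps (contract M F)))
       \<and> (\<forall>M :: 'a matroid. loopless M \<longrightarrow> (\<exists>p :: int poly. chow_fps M = fps_of_poly p))
       \<and> (\<forall>M :: 'a matroid. loopless M \<and> mrank M = 0 \<longrightarrow> chow_fps M = 1)
       \<and> (\<forall>h :: 'a matroid \<Rightarrow> int poly.
            (\<forall>M. loopless M \<and> mrank M = 0 \<longrightarrow> h M = 1)
          \<and> (\<forall>M. loopless M \<and> mrank M \<noteq> 0 \<longrightarrow>
               h M = (\<Sum>F \<in> flats M - {{}}. red_char_poly (restrict M F) * h (contract M F)))
          \<longrightarrow> (\<forall>M. loopless M \<longrightarrow> fps_of_poly (h M) = chow_fps M))"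
proof (intro conjI allI impI; (elim conjE)?)
  fix M :: "'a matroid"
  show "chow_fps M = (\<Sum>F \<in> flats M - {{}}.
      fps_of_poly (red_char_poly (restrict M F)) * chow_fps (contract M F))"
    if "loopless M" "gset M \<noteq> {}"
    using that by (rule chow_fps_recursion)
  show "\<exists>p :: int poly. chow_fps M = fps_of_poly p" if "loopless M"
    using chow_fps_eq[OF that] by (rule exI)
  show "chow_fps M = 1" if "loopless M" "mrank M = 0"
    using that by (rule chow_fps_mrank_0)
  fix h :: "'a matroid \<Rightarrow> int poly"
  show "fps_of_poly (h M) = chow_fps M"
    if "\<forall>M. loopless M \<and> mrank M = 0 \<longrightarrow> h M = 1"
      "\<forall>M. loopless M \<and> mrank M \<noteq> 0 \<longrightarrow>
        h M = (\<Sum>F \<in> flats M - {{}}. red_char_poly (restrict M F) * h (contract M F))"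
      "loopless M"
    by (rule chow_fps_unique[OF _ _ that(3)]) (use that(1,2) in blast)+
qed

end
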